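(* Let $d\in\mathbb N$, let $\psi:\mathbb N\to(0,\infty)$, and let $f$ be a dimension function satisfying: (I) there exist $s\in(d-1,d)$ and $C>0$ such that $f(y)\le C\,(y/x)^s f(x)$ for all $0<x<y$; (II) the map $x\mapsto x^{-d+1}f(x)$ is monotonically increasing on $(0,\infty)$. Let $F(x)=x^d f(x)$. For $\boldsymbol\theta\in\mathbb R^d$ let $\mathcal W^d_{\psi,\boldsymbol\theta}$ be the set of $\mathbf x\in\mathbb R^d$ such that $\|qx_1-\theta_1\|\cdots\|qx_d-\theta_d\|<\psi(q)$ for infinitely many $q\in\mathbb N$, and let $$\mathcal W^d_\psi=\{(\boldsymbol\theta,\mathbf x)\in[0,1]^{2d}:\ \mathbf x\in\mathcal W^d_{\psi,\boldsymbol\theta}\}.$$ Then $$\mathcal H^F\big(\mathcal W^d_\psi\cap[0,1]^{2d}\big)=\begin{cases}0 & \text{if } \sum_{q=1}^\infty q^d\,\psi(q)^{-d+1} f\!\left(\frac{\psi(q)}{q}\right)<\infty,\\[1ex] \infty & \text{if } \sum_{q=1}^\infty q^d\,\psi(q)^{-d+1} f\!\left(\frac{\psi(q)}{q}\right)=\infty \text{ and } \psi \text{ is monotonic}.\end{cases}$$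
   Context: $\|\cdot\|$ denotes the distance from a real number to the nearest integer. A dimension function is an increasing continuous function $f:(0,\infty)\to(0,\infty)$ with $f(r)\to0$ as $r\to0$ ($F$ is then also a dimension function). For $S\subset\mathbb R^{2d}$, $\mathcal H^F(S)=\lim_{\rho\to0}\inf\sum_i F(\operatorname{diam}B_i)$, the infimum over all countable covers $\{B_i\}$ of $S$ by sets of diameter at most $\rho$. *)

theory Defs
  imports "HOL-Analysis.Analysis"
begin

text \<open>Since \<^term>\<open>\<int>\<close> is closed and discrete, the infimum in \<^const>\<open>infdist\<close> is attained.\<close>

definition dist_int :: "real \<Rightarrow> real" where
  "dist_int x = infdist x \<int>"

definition dimension_function :: "(real \<Rightarrow> real) \<Rightarrow> bool" where
  "dimension_function f \<longleftrightarrow>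
     (\<forall>r>0. f r > 0) \<and> mono_on {0<..} f \<and> continuous_on {0<..} f \<and> (f \<longlongrightarrow> 0) (at_right 0)"

text \<open>A dimension function is only given on \<open>(0,\<infinity>)\<close>; it is extended to diameter \<open>0\<close> (single points
  and the empty set) by its limit \<open>0\<close>, whatever value the total function \<open>F\<close> has there.\<close>

definition gauge_diam :: "(real \<Rightarrow> real) \<Rightarrow> 'a::metric_space set \<Rightarrow> ennreal" where
  "gauge_diam F B = (if diameter B = 0 then 0 else ennreal (F (diameter B)))"

text \<open>Boundedness is required explicitly because \<^const>\<open>diameter\<close> is unspecified on unbounded sets.
  Finite covers are included: the sets may be empty.\<close>

definition fine_covers :: "real \<Rightarrow> 'a::metric_space set \<Rightarrow> (nat \<Rightarrow> 'a set) set" where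
  "fine_covers \<rho> S = {B. S \<subseteq> (\<Union>i. B i) \<and> (\<forall>i. bounded (B i) \<and> diameter (B i) \<le> \<rho>)}"

definition hausdorff_pre :: "(real \<Rightarrow> real) \<Rightarrow> real \<Rightarrow> 'a::metric_space set \<Rightarrow> ennreal" where
  "hausdorff_pre F \<rho> S = (INF B\<in>fine_covers \<rho> S. \<Sum>i. gauge_diam F (B i))"

definition hausdorff_measure :: "(real \<Rightarrow> real) \<Rightarrow> 'a::metric_space set \<Rightarrow> ennreal" where
  "hausdorff_measure F S = Lim (at_right 0) (\<lambda>\<rho>. hausdorff_pre F \<rho> S)"

lemma hausdorff_pre_antimono:
  assumes "\<rho> \<le> \<rho>'"
  shows "hausdorff_pre F \<rho>' S \<le> hausdorff_pre F \<rho> S"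
  unfolding hausdorff_pre_def
  by (rule INF_superset_mono) (use assms in \<open>auto simp: fine_covers_def intro: order_trans\<close>)

lemma tendsto_hausdorff_pre_SUP:
  "((\<lambda>\<rho>. hausdorff_pre F \<rho> S) \<longlongrightarrow> (SUP \<rho>\<in>{0<..}. hausdorff_pre F \<rho> S)) (at_right 0)"
proof (rule order_tendstoI)
  fix a assume "a < (SUP \<rho>\<in>{0<..}. hausdorff_pre F \<rho> S)"
  then obtain r where r: "r > 0" "a < hausdorff_pre F r S"
    by (auto simp: less_SUP_iff)
  have "a < hausdorff_pre F \<rho> S" if "\<rho> < r" for \<rho>
    using r(2) hausdorff_pre_antimono[of \<rho> r F S] that by (auto intro: less_le_trans)
  then show "\<forall>\<^sub>F \<rho> in at_right 0. a < hausdorff_pre F \<rho> S"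
    using r(1) by (auto simp: eventually_at_right_field)
next
  fix a assume a: "(SUP \<rho>\<in>{0<..}. hausdorff_pre F \<rho> S) < a"
  have "hausdorff_pre F \<rho> S < a" if "\<rho> > 0" for \<rho>
    using that by (intro le_less_trans[OF _ a] SUP_upper) auto
  then show "\<forall>\<^sub>F \<rho> in at_right 0. hausdorff_pre F \<rho> S < a"
    by (auto simp: eventually_at_right_field intro: exI[of _ 1])
qed

lemma hausdorff_measure_eq_SUP:
  "hausdorff_measure F S = (SUP \<rho>\<in>{0<..}. hausdorff_pre F \<rho> S)"
  unfolding hausdorff_measure_def
  by (rule tendsto_Lim[OF _ tendsto_hausdorff_pre_SUP]) simp

definition W_fibre :: "(nat \<Rightarrow> real) \<Rightarrow> real ^ 'n \<Rightarrow> (real ^ 'n) set" where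
  "W_fibre \<psi> \<theta> =
     {x. infinite {q::nat. q \<ge> 1 \<and> (\<Prod>i\<in>UNIV. dist_int (real q * x $ i - \<theta> $ i)) < \<psi> q}}"

text \<open>\<open>\<real>\<^sup>2\<^sup>d\<close> is \<open>\<real>\<^sup>d \<times> \<real>\<^sup>d\<close>, whose product metric in the library is the Euclidean one.\<close>

definition W_set :: "(nat \<Rightarrow> real) \<Rightarrow> ((real ^ 'n) \<times> (real ^ 'n)) set" where
  "W_set \<psi> = {(\<theta>, x) \<in> cbox 0 1 \<times> cbox 0 1. x \<in> W_fibre \<psi> \<theta>}"

end

theory Submission
  imports Defs "HOL-Analysis.Kronecker_Approximation_Theorem"
begin

text \<open>
  Put \<open>g x = x powi (1 - d) * f x\<close>, so that the summand is \<open>q * g (\<psi> q / q)\<close> and \<open>F r = r ^ (2 * d - 1) * g r\<close>.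

  Convergence. If the product of the distances is below \<open>\<psi> q\<close> and their minimum is about \<open>a = 2 ^ j * \<psi> q\<close>, then the
  product of the other ones is at most about \<open>2 powi (- j)\<close>. Counting the cubes of side \<open>a / q\<close> needed for these points
  with a Chebyshev weight costs \<open>q * g (\<psi> q / q)\<close> times a geometrically small factor in \<open>j\<close>, by the growth condition on
  \<open>g\<close>, and the Hausdorff-Cantelli argument applies.

  Divergence. Bounding all factors but one by \<open>1\<close> and slicing reduces the claim to \<open>d = 1\<close>, that is, to the points of the
  unit square lying in infinitely many of the strips \<open>\<bar>q * x - \<theta> - p\<bar> < \<psi> q\<close>, with gauge \<open>r * g r\<close>. By Dirichlet's theorem,
  at least half of the intervals of length comparable to \<open>4 powi (- k)\<close> contain, for every \<open>\<theta>\<close>, a point \<open>(p + \<theta>) / q\<close> with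
  \<open>2 ^ k \<le> q < 2 ^ (k + 1)\<close>. Combining finitely many such blocks gives a measure on thin strips that gives every square of
  a fixed dyadic grid at least half of its area, while a box of side \<open>r\<close> has mass at most a constant times
  \<open>r\<^sup>2 + \<eta> * r * g r\<close> with \<open>\<eta>\<close> as small as desired. Iterating inside dyadic squares yields a
  Cantor set whose mass on a ball of radius \<open>r\<close> is at most \<open>\<kappa> * r * g r\<close>, for every \<open>\<kappa> > 0\<close>. By compactness a cover can
  be tested on a finite level of the construction.
\<close>

section \<open>Hausdorff pre-measures\<close>

text \<open>Hypotheses (I) and (II) say that \<open>g\<close> is increasing and grows at most like x
  powr \<sigma>, where \<sigma> = s - d + 1 lies strictly between 0 and 1.

  The obstacle in the convergence half: for d > 1 the region where a product of distances is below
  \<delta> has volume \<delta> times a power of log (1 / \<delta>), while the series carries no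
  logarithm. A weight with exponent e - 1 on every coordinate but the minimal one sums to a constant
  1 / e in place of a logarithm, and e = (1 - \<sigma>) / 2 still leaves the factor 2 powr (- e) to
  the power j.

  In the divergence half, different denominators are never shown to be independent. Each block
  contributes its own sparse set of squares and the upper bounds are added over the blocks. The
  small \<eta> is paid for by divergence: arbitrarily late blocks, each scaled by a tiny \<eta>',
  still reach total weight 1. The term in r squared is absorbed later, because \<sigma> < 1 makes g
  r / r unbounded near 0.\<close>

lemma hausdorff_pre_le:
  assumes "B \<in> fine_covers \<rho> S"
  shows "hausdorff_pre F \<rho> S \<le> (\<Sum>i. gauge_diam F (B i))"
  unfolding hausdorff_pre_def using assms by (rule INF_lower)

lemma hausdorff_pre_mono:
  assumes "S \<subseteq> T"
  shows "hausdorff_pre F \<rho> S \<le> hausdorff_pre F \<rho> T"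
  unfolding hausdorff_pre_def
  by (rule INF_superset_mono) (use assms in \<open>auto simp: fine_covers_def\<close>)

lemma hausdorff_pre_UN_le:
  fixes S :: "nat \<Rightarrow> 'a::metric_space set"
  shows "hausdorff_pre F \<rho> (\<Union>n. S n) \<le> (\<Sum>n. hausdorff_pre F \<rho> (S n))"
proof (rule ennreal_le_epsilon)
  fix e :: real assume e: "e > 0" and fin: "(\<Sum>n. hausdorff_pre F \<rho> (S n)) < top"
  have fin1: "hausdorff_pre F \<rho> (S n) < top" for n
    using fin by (metis ennreal_suminf_lessD)
  have "\<exists>B\<in>fine_covers \<rho> (S n). (\<Sum>i. gauge_diam F (B i)) < hausdorff_pre F \<rho> (S n) + ennreal (e * (1/2)^Suc n)" for n
  proof -
    have "hausdorff_pre F \<rho> (S n) < hausdorff_pre F \<rho> (S n) + ennreal (e * (1/2)^Suc n)"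
      using fin1[of n] e by (simp add: ennreal_add_left_cancel_less[where c=0, simplified])
    then show ?thesis unfolding hausdorff_pre_def by (subst (asm) INF_less_iff) auto
  qed
  then obtain B where B: "\<And>n. B n \<in> fine_covers \<rho> (S n)"
    "\<And>n. (\<Sum>i. gauge_diam F (B n i)) < hausdorff_pre F \<rho> (S n) + ennreal (e * (1/2)^Suc n)"
    by metis
  define C where "C = (\<lambda>p. case prod_decode p of (n,i) \<Rightarrow> B n i)"
  have "C \<in> fine_covers \<rho> (\<Union>n. S n)"
  proof -
    have "x \<in> (\<Union>p. C p)" if "x \<in> S n" for x n
    proof -
      from B(1)[of n] that obtain i where "x \<in> B n i" by (auto simp: fine_covers_def)
      then have "x \<in> C (prod_encode (n,i))" by (simp add: C_def)
      then show ?thesis by blast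
    qed
    moreover have "bounded (C p) \<and> diameter (C p) \<le> \<rho>" for p
      using B(1) by (auto simp: C_def fine_covers_def split: prod.split)
    ultimately show ?thesis by (auto simp: fine_covers_def)
  qed
  then have "hausdorff_pre F \<rho> (\<Union>n. S n) \<le> (\<Sum>p. gauge_diam F (C p))"
    by (rule hausdorff_pre_le)
  also have "\<dots> = (\<Sum>p. (\<lambda>(n,i). gauge_diam F (B n i)) (prod_decode p))"
    by (simp add: C_def case_prod_beta)
  also have "\<dots> = (\<Sum>n. \<Sum>i. gauge_diam F (B n i))"
    by (rule suminf_ennreal_2dimen) simp
  also have "\<dots> \<le> (\<Sum>n. hausdorff_pre F \<rho> (S n) + ennreal (e * (1/2)^Suc n))"
    by (intro suminf_le less_imp_le[OF B(2)]) auto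
  also have "\<dots> = (\<Sum>n. hausdorff_pre F \<rho> (S n)) + (\<Sum>n. ennreal (e * (1/2)^Suc n))"
    by (rule suminf_add[symmetric]) auto
  also have "(\<Sum>n. ennreal (e * (1/2)^Suc n)) = ennreal e"
  proof -
    have "(\<lambda>n. e * (1/2)^Suc n) sums (e * 1)"
      by (intro sums_mult power_half_series)
    then show ?thesis
      using e by (subst suminf_ennreal2) (auto simp: sums_iff)
  qed
  finally show "hausdorff_pre F \<rho> (\<Union>n. S n) \<le> (\<Sum>n. hausdorff_pre F \<rho> (S n)) + ennreal e" .
qed

lemma hausdorff_pre_finite_cover:
  fixes S :: "'a::metric_space set"
  assumes C: "finite C" "S \<subseteq> (\<Union>c\<in>C. B c)" and B: "\<And>c. c \<in> C \<Longrightarrow> bounded (B c) \<and> diameter (B c) \<le> r"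
    and r: "r \<le> \<rho>" and F: "\<And>t. 0 < t \<Longrightarrow> t \<le> r \<Longrightarrow> F t \<le> K" "K \<ge> 0"
    and \<rho>: "\<rho> \<ge> 0"
  shows "hausdorff_pre F \<rho> S \<le> ennreal (real (card C) * K)"
proof -
  obtain e where e: "bij_betw e {..<card C} C"
    using C(1) ex_bij_betw_nat_finite[of C] by (auto simp: atLeast0LessThan)
  define D where "D = (\<lambda>n. if n < card C then B (e n) else {})"
  have D: "bounded (D n) \<and> diameter (D n) \<le> \<rho>" for n
    using B[of "e n"] e r \<rho> by (auto simp: D_def bij_betw_def intro: order_trans)
  have "D \<in> fine_covers \<rho> S"
  proof -
    have "x \<in> (\<Union>n. D n)" if x: "x \<in> S" for x
    proof -
      obtain c where c: "c \<in> C" "x \<in> B c" using C(2) x by auto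
      then obtain n where "n < card C" "c = e n" using e by (auto simp: bij_betw_def)
      then show ?thesis using c by (auto simp: D_def intro!: exI[of _ n])
    qed
    with D show ?thesis by (auto simp: fine_covers_def)
  qed
  then have "hausdorff_pre F \<rho> S \<le> (\<Sum>n. gauge_diam F (D n))"
    by (rule hausdorff_pre_le)
  also have "\<dots> = (\<Sum>n<card C. gauge_diam F (D n))"
    by (rule suminf_finite) (auto simp: D_def gauge_diam_def)
  also have "\<dots> \<le> (\<Sum>n<card C. ennreal K)"
  proof (rule sum_mono)
    fix n assume n: "n \<in> {..<card C}"
    then have *: "e n \<in> C" using e by (auto simp: bij_betw_def)
    have "0 \<le> diameter (B (e n))" using B[OF *] by (simp add: diameter_ge_0)
    then show "gauge_diam F (D n) \<le> ennreal K"
      using n B[OF *] F by (auto simp: D_def gauge_diam_def intro!: ennreal_leI)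
  qed
  also have "\<dots> = ennreal (real (card C) * K)"
    by (simp add: ennreal_mult' ennreal_of_nat_eq_real_of_nat)
  finally show ?thesis .
qed

section \<open>Distance to the nearest integer, and its sums along arithmetic progressions\<close>

lemma dist_int_le: "dist_int x \<le> \<bar>x - of_int p\<bar>"
  unfolding dist_int_def by (rule order_trans[OF infdist_le[of "of_int p"]]) (auto simp: dist_real_def)

lemma dist_int_nonneg: "0 \<le> dist_int x"
  by (simp add: dist_int_def infdist_nonneg)

lemma dist_int_attained: "\<exists>p::int. dist_int x = \<bar>x - of_int p\<bar>"
proof -
  obtain y where "y \<in> \<int>" "infdist x (\<int>::real set) = dist x y"
    using infdist_attains_inf[OF closed_Ints, of x] by (metis Ints_0 empty_iff)
  then show ?thesis by (auto simp: dist_int_def dist_real_def elim!: Ints_cases)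
qed

lemma dist_int_le_half: "dist_int x \<le> 1/2"
  using dist_int_le[of x "round x"] of_int_round_abs_le[of x] by (simp add: abs_minus_commute)

lemma dist_int_lipschitz: "\<bar>dist_int x - dist_int y\<bar> \<le> \<bar>x - y\<bar>"
  unfolding dist_int_def using infdist_triangle_abs[of x \<int> y] by (simp add: dist_real_def)

text \<open>The points v * a - t pass through about q unit periods, and in each period every
  distance bucket of width a is met at most twice, once on either side of the integer. Coding v by
  nearest integer, bucket and side is injective, since two points with the same code are less than a
  apart. The integers range over {-2..q + 1}, whence q + 4.\<close>

lemma sum_dist_int_grid_le:
  fixes h :: "real \<Rightarrow> real"
  assumes h: "\<And>y. 0 \<le> y \<Longrightarrow> 0 \<le> h y" "\<And>y z. 0 \<le> y \<Longrightarrow> y \<le> z \<Longrightarrow> h z \<le> h y"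
    and a: "0 < a" and t: "0 \<le> t" "t \<le> 1" and V: "real V * a \<le> real q"
  shows "(\<Sum>v\<le>V. h (dist_int (real v * a - t))) \<le> 2 * (real q + 4) * (\<Sum>m\<le>nat \<lfloor>1/(2*a)\<rfloor>. h (real m * a))"
proof -
  have "\<exists>p. \<forall>v. dist_int (real v * a - t) = \<bar>real v * a - t - of_int (p v)\<bar>"
    by (intro choice allI dist_int_attained)
  then obtain p where p: "\<And>v. dist_int (real v * a - t) = \<bar>real v * a - t - of_int (p v)\<bar>" by blast
  define m where "m v = nat \<lfloor>dist_int (real v * a - t) / a\<rfloor>" for v
  define b where "b v \<longleftrightarrow> real v * a - t \<ge> of_int (p v)" for v
  have m1: "real (m v) * a \<le> dist_int (real v * a - t)" "dist_int (real v * a - t) < (real (m v) + 1) * a" for v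
  proof -
    have "0 \<le> dist_int (real v * a - t) / a" using dist_int_nonneg a by simp
    then have "real (m v) \<le> dist_int (real v * a - t) / a" "dist_int (real v * a - t) / a < real (m v) + 1"
      unfolding m_def by linarith+
    then show "real (m v) * a \<le> dist_int (real v * a - t)" "dist_int (real v * a - t) < (real (m v) + 1) * a"
      using a by (auto simp: field_simps)
  qed
  define T where "T = {-2..int q + 1} \<times> {..nat \<lfloor>1/(2*a)\<rfloor>} \<times> (UNIV :: bool set)"
  define \<tau> where "\<tau> v = (p v, m v, b v)" for v
  have inj: "inj_on \<tau> {..V}"
  proof (rule inj_onI)
    fix v w assume eq: "\<tau> v = \<tau> w"
    then have e: "p v = p w" "m v = m w" "b v = b w" by (auto simp: \<tau>_def)
    have "\<bar>real v * a - real w * a\<bar> < a"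
      using m1[of v] m1[of w] e p[of v] p[of w] by (cases "b v") (auto simp: b_def algebra_simps abs_if split: if_splits)
    then have "\<bar>real v - real w\<bar> * a < 1 * a" using a by (simp add: abs_mult left_diff_distrib[symmetric])
    then have "\<bar>real v - real w\<bar> < 1" using a by (metis mult_less_cancel_right_pos)
    then show "v = w" by linarith
  qed
  have sub: "\<tau> ` {..V} \<subseteq> T"
  proof -
    have "\<tau> v \<in> T" if "v \<le> V" for v
    proof -
      have "real v * a \<le> real V * a" using that a by (simp add: mult_right_mono)
      then have "-1 \<le> real v * a - t" "real v * a - t \<le> real q" using V t mult_nonneg_nonneg[of "real v" a] a by linarith+
      moreover have "\<bar>real v * a - t - of_int (p v)\<bar> \<le> 1/2" using p[of v] dist_int_le_half by metis
      ultimately have "-2 \<le> p v" "p v \<le> int q + 1" by linarith+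
      moreover have "m v \<le> nat \<lfloor>1/(2*a)\<rfloor>" unfolding m_def
      proof (intro nat_mono floor_mono)
        show "dist_int (real v * a - t) / a \<le> 1 / (2*a)"
          using divide_right_mono[OF dist_int_le_half, of a "real v * a - t"] a by simp
      qed
      ultimately show ?thesis by (simp add: \<tau>_def T_def)
    qed
    then show ?thesis by auto
  qed
  have "(\<Sum>v\<le>V. h (dist_int (real v * a - t))) \<le> (\<Sum>v\<le>V. (\<lambda>(p,m,b). h (real m * a)) (\<tau> v))"
    using m1 a by (intro sum_mono) (auto simp: \<tau>_def intro!: h)
  also have "\<dots> = (\<Sum>z\<in>\<tau> ` {..V}. (\<lambda>(p,m,b). h (real m * a)) z)"
    by (simp add: sum.reindex[OF inj])
  also have "\<dots> \<le> (\<Sum>z\<in>T. (\<lambda>(p,m,b). h (real m * a)) z)"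
    using sub a by (intro sum_mono2) (auto simp: T_def intro!: h)
  also have "\<dots> = real (card {-2..int q + 1}) * ((\<Sum>m\<le>nat \<lfloor>1/(2*a)\<rfloor>. h (real m * a)) * 2)"
    unfolding T_def by (simp add: sum.cartesian_product[symmetric] sum_distrib_left[symmetric] sum_distrib_right[symmetric] mult.commute)
  also have "\<dots> = 2 * (real q + 4) * (\<Sum>m\<le>nat \<lfloor>1/(2*a)\<rfloor>. h (real m * a))"
    by simp
  finally show ?thesis .
qed

text \<open>Discrete counterpart of integrating x powr (e - 1). The increment bound is concavity of
  x powr e, obtained from Young's inequality for (n - 1) / n and 1 with exponents e and 1 -
  e.\<close>

lemma sum_powr_le:
  fixes e :: real
  assumes e: "0 < e" "e \<le> 1"
  shows "(\<Sum>m\<le>M. (real m + 1) powr (e - 1)) \<le> (real M + 1) powr e / e"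
proof (induction M)
  case 0
  then show ?case using e by (simp add: field_simps)
next
  case (Suc M)
  define n where "n = real M + 2"
  have n: "n > 1" by (simp add: n_def)
  have "((n - 1) / n) powr e * 1 powr (1 - e) \<le> e * ((n - 1) / n) + (1 - e) * 1"
    using e n by (intro Youngs_inequality_0) auto
  then have "(n - 1) powr e / n powr e \<le> 1 - e / n"
    using n by (simp add: powr_divide field_simps)
  then have "(n - 1) powr e \<le> n powr e - e * (n powr e / n)"
    using n by (simp add: field_simps)
  moreover have "n powr e / n = n powr (e - 1)" using n by (simp add: powr_diff)
  ultimately have "(n - 1) powr e / e + n powr (e - 1) \<le> n powr e / e"
    using e by (simp add: divide_simps) (simp add: algebra_simps)
  then show ?case using Suc by (simp add: n_def algebra_simps)
qed

section \<open>Covering the neighbourhoods of the resonant sets\<close>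

text \<open>The dyadic pieces of the product neighbourhood: the coordinate \<open>k\<close> realises the minimum of the distances, and
  \<open>a\<close> is comparable to it. Such a piece is covered efficiently by cubes of side \<open>a / q\<close>.\<close>

definition near_set :: "'n::finite \<Rightarrow> nat \<Rightarrow> real \<Rightarrow> real \<Rightarrow> ((real ^ 'n) \<times> (real ^ 'n)) set" where
  "near_set k q a t = {(\<theta>, x) \<in> cbox 0 1 \<times> cbox 0 1. dist_int (real q * x $ k - \<theta> $ k) \<le> 2 * a \<and>
     (\<Prod>i\<in>UNIV - {k}. dist_int (real q * x $ i - \<theta> $ i) + a) \<le> t}"

text \<open>\<open>w i\<close> keeps the indices of \<theta> and x in the same coordinate i
  together, so that the weights used for counting cells factor over i.\<close>

definition grid_cell :: "real \<Rightarrow> ('n::finite \<Rightarrow> nat \<times> nat) \<Rightarrow> ((real ^ 'n) \<times> (real ^ 'n)) set" where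
  "grid_cell b w = {(\<theta>, x). \<forall>i. real (fst (w i)) * b \<le> \<theta> $ i \<and> \<theta> $ i \<le> (real (fst (w i)) + 1) * b \<and>
     real (snd (w i)) * b \<le> x $ i \<and> x $ i \<le> (real (snd (w i)) + 1) * b}"

lemma grid_cell_diameter:
  fixes w :: "'n::finite \<Rightarrow> nat \<times> nat"
  assumes b: "b \<ge> 0"
  shows "bounded (grid_cell b w)" "diameter (grid_cell b w) \<le> 2 * real CARD('n) * b"
proof -
  have d: "dist z z' \<le> 2 * real CARD('n) * b" if "z \<in> grid_cell b w" "z' \<in> grid_cell b w" for z z'
  proof -
    obtain \<theta> x \<theta>' x' where z: "z = (\<theta>, x)" "z' = (\<theta>', x')" by (meson surj_pair)
    have 1: "norm (u - u') \<le> real CARD('n) * b" if "\<And>i. \<bar>u $ i - u' $ i\<bar> \<le> b" for u u' :: "real ^ 'n"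
    proof -
      have "norm (u - u') \<le> (\<Sum>i\<in>UNIV. \<bar>(u - u') $ i\<bar>)" by (rule norm_le_l1_cart)
      also have "\<dots> \<le> (\<Sum>i\<in>(UNIV::'n set). b)" using that by (intro sum_mono) auto
      finally show ?thesis by simp
    qed
    have "\<bar>\<theta> $ i - \<theta>' $ i\<bar> \<le> b" "\<bar>x $ i - x' $ i\<bar> \<le> b" for i
    proof -
      have "real (fst (w i)) * b \<le> \<theta> $ i" "\<theta> $ i \<le> (real (fst (w i)) + 1) * b"
           "real (snd (w i)) * b \<le> x $ i" "x $ i \<le> (real (snd (w i)) + 1) * b"
           "real (fst (w i)) * b \<le> \<theta>' $ i" "\<theta>' $ i \<le> (real (fst (w i)) + 1) * b"
           "real (snd (w i)) * b \<le> x' $ i" "x' $ i \<le> (real (snd (w i)) + 1) * b"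
        using that unfolding z grid_cell_def by blast+
      then show "\<bar>\<theta> $ i - \<theta>' $ i\<bar> \<le> b" "\<bar>x $ i - x' $ i\<bar> \<le> b"
        unfolding distrib_right mult_1 by linarith+
    qed
    then have "norm (\<theta> - \<theta>') \<le> real CARD('n) * b" "norm (x - x') \<le> real CARD('n) * b"
      using 1 by blast+
    moreover have "dist z z' \<le> norm (\<theta> - \<theta>') + norm (x - x')"
      unfolding z dist_norm diff_Pair by (rule norm_Pair_le)
    ultimately show ?thesis by simp
  qed
  show "bounded (grid_cell b w)"
  proof (cases "grid_cell b w = {}")
    case False
    then obtain z where "z \<in> grid_cell b w" by blast
    then show ?thesis unfolding bounded_def using d by blast
  qed simp
  show "diameter (grid_cell b w) \<le> 2 * real CARD('n) * b"
    using d b by (intro diameter_le) (auto simp: dist_norm)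
qed

text \<open>Inside a cell, q * x - \<theta> varies by at most a + b \<le> 2 * a, so each distance
  plus a changes by a factor of at most 3 and the corners inherit the bounds of the piece. Corners
  are counted by Chebyshev's method: with S = 3 ^ d * t, every admissible family has S powr (1 - e)
  times the product of the (Y + a) powr (e - 1) at least 1, and the sum of these products over all
  families factors over the coordinates.\<close>

lemma near_set_cover:
  fixes k :: "'n::finite" and a e t :: real
  assumes q: "q \<ge> 1" and a: "0 < a" "a \<le> 1/2" and e: "0 < e" "e \<le> 1" and t: "t > 0"
  shows "\<exists>C. finite C \<and> near_set k q a t \<subseteq> (\<Union>w\<in>C. grid_cell (a / real q) w) \<and>
     real (card C) \<le> (3 ^ CARD('n) * t) powr (1 - e) *
        ((100 * (real q)\<^sup>2 / a) * (20 * (real q)\<^sup>2 / (e * a\<^sup>2)) ^ (CARD('n) - 1))"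
proof -
  define b where "b = a / real q"
  define V where "V = nat \<lfloor>real q / a\<rfloor>"
  \<comment> \<open>The distance at the lower corner of a cell; the x-index is multiplied by a
    because q * b = a.\<close>
  define Y where "Y uv = dist_int (real (snd uv) * a - real (fst uv) * b)" for uv :: "nat \<times> nat"
  have b: "b > 0" "real q * b = a" "b \<le> a" "b \<le> 1"
    using q a by (auto simp: b_def field_simps)
  have V: "real V * a \<le> real q" "real V * b \<le> 1" "real V + 1 \<le> 2 * real q / a"
  proof -
    have "real V \<le> real q / a" unfolding V_def using a by simp
    then show "real V * a \<le> real q" using a by (simp add: field_simps)
    then show "real V * b \<le> 1" using q by (simp add: b_def field_simps)
    have "1 \<le> real q / a" using q a by (simp add: field_simps)
    with \<open>real V \<le> real q / a\<close> show "real V + 1 \<le> 2 * real q / a" by simp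
  qed
  define P where "P = PiE (UNIV :: 'n set) (\<lambda>_. {..V} \<times> {..V})"
  define C where "C = {w \<in> P. Y (w k) \<le> 4 * a \<and> (\<Prod>i\<in>UNIV - {k}. Y (w i) + a) \<le> 3 ^ CARD('n) * t}"
  have finP: "finite P" unfolding P_def by (intro finite_PiE) auto
  have Y0: "Y uv \<ge> 0" for uv by (simp add: Y_def dist_int_nonneg)
  have cover: "near_set k q a t \<subseteq> (\<Union>w\<in>C. grid_cell b w)"
  proof
    fix z assume z: "z \<in> near_set k q a t"
    then obtain \<theta> x where zz: "z = (\<theta>, x)" by (cases z)
    have cb: "\<theta> \<in> cbox 0 1" "x \<in> cbox 0 1" and y: "dist_int (real q * x $ k - \<theta> $ k) \<le> 2 * a"
      "(\<Prod>i\<in>UNIV - {k}. dist_int (real q * x $ i - \<theta> $ i) + a) \<le> t"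
      using z by (auto simp: zz near_set_def)
    define w where "w i = (nat \<lfloor>\<theta> $ i / b\<rfloor>, nat \<lfloor>x $ i / b\<rfloor>)" for i
    have fl: "real (nat \<lfloor>c / b\<rfloor>) * b \<le> c \<and> c \<le> (real (nat \<lfloor>c / b\<rfloor>) + 1) * b \<and> nat \<lfloor>c / b\<rfloor> \<le> V"
      if "0 \<le> c" "c \<le> 1" for c
    proof -
      have "0 \<le> c / b" using that b by simp
      then have "real (nat \<lfloor>c / b\<rfloor>) \<le> c / b" "c / b \<le> real (nat \<lfloor>c / b\<rfloor>) + 1" by linarith+
      moreover have "nat \<lfloor>c / b\<rfloor> \<le> V" unfolding V_def
        using that b a q by (intro nat_mono floor_mono) (simp add: b_def field_simps)
      ultimately show ?thesis using b by (simp add: field_simps)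
    qed
    have c01: "0 \<le> \<theta> $ i" "\<theta> $ i \<le> 1" "0 \<le> x $ i" "x $ i \<le> 1" for i
      using cb by (auto simp: mem_box_cart)
    have wP: "w \<in> P" unfolding P_def using fl c01 by (auto simp: w_def)
    have zc: "z \<in> grid_cell b w"
      unfolding zz grid_cell_def using fl c01 by (auto simp: w_def)
    have yy: "\<bar>Y (w i) - dist_int (real q * x $ i - \<theta> $ i)\<bar> \<le> 2 * a" for i
    proof -
      have 1: "real (fst (w i)) * b \<le> \<theta> $ i" "\<theta> $ i \<le> (real (fst (w i)) + 1) * b"
        "real (snd (w i)) * b \<le> x $ i" "x $ i \<le> (real (snd (w i)) + 1) * b"
        using zc unfolding zz grid_cell_def by blast+
      have 2: "real q * (real (snd (w i)) * b) \<le> real q * x $ i" "real q * x $ i \<le> real q * ((real (snd (w i)) + 1) * b)"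
        using 1 by (auto intro: mult_left_mono)
      have 3: "real q * (real (snd (w i)) * b) = real (snd (w i)) * a"
        "real q * ((real (snd (w i)) + 1) * b) = (real (snd (w i)) + 1) * a" using b(2) by (auto simp: algebra_simps)
      have "\<bar>(real (snd (w i)) * a - real (fst (w i)) * b) - (real q * x $ i - \<theta> $ i)\<bar> \<le> 2 * a"
        using 1(1,2) 2[unfolded 3] b(3) a unfolding distrib_right mult_1 by linarith
      then show ?thesis unfolding Y_def using dist_int_lipschitz order_trans by blast
    qed
    have lin: "y + a \<le> 3 * (D + a)" if "\<bar>y - D\<bar> \<le> 2 * a" "0 \<le> D" for y D :: real
      using that a by (auto simp: abs_le_iff)
    have "Y (w k) \<le> 4 * a" using yy[of k] y by linarith
    moreover have "(\<Prod>i\<in>UNIV - {k}. Y (w i) + a) \<le> 3 ^ CARD('n) * t"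
    proof -
      have "(\<Prod>i\<in>UNIV - {k}. Y (w i) + a) \<le> (\<Prod>i\<in>UNIV - {k}. 3 * (dist_int (real q * x $ i - \<theta> $ i) + a))"
      proof (intro prod_mono conjI)
        fix i show "Y (w i) + a \<le> 3 * (dist_int (real q * x $ i - \<theta> $ i) + a)"
          by (rule lin[OF yy dist_int_nonneg])
        show "0 \<le> Y (w i) + a" using Y0 a by (simp add: add_nonneg_nonneg)
      qed
      also have "\<dots> = 3 ^ (CARD('n) - 1) * (\<Prod>i\<in>UNIV - {k}. dist_int (real q * x $ i - \<theta> $ i) + a)"
        by (simp only: prod.distrib prod_constant) (simp add: card_Diff_singleton)
      also have "\<dots> \<le> 3 ^ CARD('n) * t"
        using y(2) t by (intro mult_mono power_increasing) (auto intro!: prod_nonneg add_nonneg_nonneg dist_int_nonneg less_imp_le[OF a(1)])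
      finally show ?thesis .
    qed
    ultimately have "w \<in> C" using wP by (simp add: C_def)
    with zc show "z \<in> (\<Union>w\<in>C. grid_cell b w)" by blast
  qed
  \<comment> \<open>The minimal coordinate k is counted with weight 0 or 1; only the others carry
    the fractional power.\<close>
  define \<omega> where "\<omega> i uv = (if i = k then (if Y uv \<le> 4 * a then 1 else 0) else (Y uv + a) powr (e - 1))" for i uv
  define S where "S = 3 ^ CARD('n) * t"
  have S: "S > 0" using t by (simp add: S_def)
  have w0: "\<omega> i uv \<ge> 0" for i uv by (simp add: \<omega>_def)
  have split: "(\<Prod>i\<in>UNIV. \<phi> i) = \<phi> k * (\<Prod>i\<in>UNIV - {k}. \<phi> i)" for \<phi> :: "'n \<Rightarrow> real"
    by (simp add: prod.remove)
  have "real (card C) \<le> (\<Sum>w\<in>C. S powr (1 - e) * (\<Prod>i\<in>UNIV. \<omega> i (w i)))"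
  proof -
    have "1 \<le> S powr (1 - e) * (\<Prod>i\<in>UNIV. \<omega> i (w i))" if w: "w \<in> C" for w
    proof -
      define Q where "Q = (\<Prod>i\<in>UNIV - {k}. Y (w i) + a)"
      have Q: "0 < Q" "Q \<le> S" using w a
        by (auto simp: Q_def S_def C_def intro!: prod_pos add_nonneg_pos Y0)
      have "(\<Prod>i\<in>UNIV. \<omega> i (w i)) = (\<Prod>i\<in>UNIV - {k}. (Y (w i) + a) powr (e - 1))"
        using w by (subst split) (auto simp: \<omega>_def C_def intro!: prod.cong)
      also have "\<dots> = Q powr (e - 1)"
        unfolding Q_def using Y0 a by (subst prod_powr_distrib) (auto intro!: add_nonneg_nonneg)
      finally have "S powr (1 - e) * (\<Prod>i\<in>UNIV. \<omega> i (w i)) = (S / Q) powr (1 - e)"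
        using Q S powr_minus_divide[of Q "1 - e"] by (simp add: powr_divide)
      also have "\<dots> \<ge> 1" using Q S e by (intro ge_one_powr_ge_zero) auto
      finally show ?thesis .
    qed
    then have "(\<Sum>w\<in>C. 1) \<le> (\<Sum>w\<in>C. S powr (1 - e) * (\<Prod>i\<in>UNIV. \<omega> i (w i)))"
      by (intro sum_mono) 
    then show ?thesis by simp
  qed
  also have "\<dots> \<le> (\<Sum>w\<in>P. S powr (1 - e) * (\<Prod>i\<in>UNIV. \<omega> i (w i)))"
    using finP by (intro sum_mono2) (auto simp: C_def intro!: mult_nonneg_nonneg prod_nonneg w0)
  also have "\<dots> = S powr (1 - e) * (\<Prod>i\<in>UNIV. \<Sum>uv\<in>{..V}\<times>{..V}. \<omega> i uv)"
    unfolding P_def by (subst prod_sum_PiE) (auto simp: sum_distrib_left)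
  also have "\<dots> \<le> S powr (1 - e) * ((100 * (real q)\<^sup>2 / a) * (20 * (real q)\<^sup>2 / (e * a\<^sup>2)) ^ (CARD('n) - 1))"
  proof (intro mult_left_mono)
    \<comment> \<open>One coordinate at a time: there are at most 2 * q / a indices for \<theta>,
      and for each of them the x-indices form the progression of
      \<open>sum_dist_int_grid_le\<close>, where 2 * (q + 4) \<le> 10 * q.\<close>
    have gen: "(\<Sum>uv\<in>{..V}\<times>{..V}. h (Y uv)) \<le> (2 * real q / a) * (10 * real q * H)"
      if h: "\<And>y. 0 \<le> y \<Longrightarrow> 0 \<le> h y" "\<And>y z. 0 \<le> y \<Longrightarrow> y \<le> z \<Longrightarrow> h z \<le> h y"
        and H: "(\<Sum>m\<le>nat \<lfloor>1/(2*a)\<rfloor>. h (real m * a)) \<le> H" for h H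
    proof -
      have H0: "H \<ge> 0" using a by (intro order_trans[OF _ H] sum_nonneg h) auto
      have "(\<Sum>uv\<in>{..V}\<times>{..V}. h (Y uv)) = (\<Sum>u\<le>V. \<Sum>v\<le>V. h (dist_int (real v * a - real u * b)))"
        by (simp add: sum.cartesian_product Y_def case_prod_beta)
      also have "\<dots> \<le> (\<Sum>u\<le>V. 10 * real q * H)"
      proof (intro sum_mono)
        fix u assume "u \<in> {..V}"
        then have "real u * b \<le> real V * b" using b by (intro mult_right_mono) auto
        with V have "real u * b \<le> 1" by linarith
        then have "(\<Sum>v\<le>V. h (dist_int (real v * a - real u * b))) \<le> 2 * (real q + 4) * (\<Sum>m\<le>nat \<lfloor>1/(2*a)\<rfloor>. h (real m * a))"
          using b V a by (intro sum_dist_int_grid_le h) auto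
        also have "\<dots> \<le> (10 * real q) * H"
        proof (rule mult_mono[OF _ H])
          show "2 * (real q + 4) \<le> 10 * real q" using of_nat_mono[OF q, where 'a=real] by simp
        qed (use a in \<open>auto intro!: sum_nonneg h\<close>)
        finally show "(\<Sum>v\<le>V. h (dist_int (real v * a - real u * b))) \<le> 10 * real q * H" .
      qed
      also have "\<dots> = (real V + 1) * (10 * real q * H)" by (simp add: algebra_simps)
      also have "\<dots> \<le> (2 * real q / a) * (10 * real q * H)"
        using V H0 by (intro mult_right_mono) auto
      finally show ?thesis .
    qed
    have k: "(\<Sum>uv\<in>{..V}\<times>{..V}. \<omega> k uv) \<le> 100 * (real q)\<^sup>2 / a"
    proof -
      have "(\<Sum>m\<le>nat \<lfloor>1/(2*a)\<rfloor>. if real m * a \<le> 4 * a then 1 else (0::real)) = real (card {m. m \<le> nat \<lfloor>1/(2*a)\<rfloor> \<and> real m * a \<le> 4 * a})"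
        by (simp add: sum.If_cases Int_def)
      also have "\<dots> \<le> real (card {..4::nat})"
        using a by (intro of_nat_mono card_mono) auto
      also have "\<dots> = 5" by simp
      finally have "(\<Sum>uv\<in>{..V}\<times>{..V}. (if Y uv \<le> 4 * a then 1 else 0)) \<le> (2 * real q / a) * (10 * real q * 5)"
        by (intro gen) auto
      then show ?thesis by (simp add: \<omega>_def power2_eq_square)
    qed
    have o: "(\<Sum>uv\<in>{..V}\<times>{..V}. \<omega> i uv) \<le> 20 * (real q)\<^sup>2 / (e * a\<^sup>2)" if "i \<noteq> k" for i
    proof -
      define M where "M = nat \<lfloor>1/(2*a)\<rfloor>"
      have M: "real M + 1 \<le> 1 / a"
      proof -
        have "real M \<le> 1/(2*a)" unfolding M_def using a by simp
        moreover have "1 \<le> 1/(2*a)" using a by (simp add: field_simps)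
        ultimately have "real M + 1 \<le> 1/(2*a) + 1/(2*a)" by linarith
        also have "\<dots> = 1 / a" by (simp add: field_simps)
        finally show ?thesis .
      qed
      have "(\<Sum>m\<le>M. (real m * a + a) powr (e - 1)) = a powr (e - 1) * (\<Sum>m\<le>M. (real m + 1) powr (e - 1))"
        using a by (simp add: sum_distrib_left powr_mult[symmetric] algebra_simps)
      also have "\<dots> \<le> a powr (e - 1) * ((1 / a) powr e / e)"
      proof (intro mult_left_mono)
        have "(\<Sum>m\<le>M. (real m + 1) powr (e - 1)) \<le> (real M + 1) powr e / e" by (rule sum_powr_le[OF e])
        also have "\<dots> \<le> (1 / a) powr e / e"
          using M e by (intro divide_right_mono powr_mono2) auto
        finally show "(\<Sum>m\<le>M. (real m + 1) powr (e - 1)) \<le> (1 / a) powr e / e" .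
      qed auto
      also have "\<dots> = 1 / (e * a)"
        using a e by (simp add: powr_divide powr_diff field_simps)
      finally have "(\<Sum>uv\<in>{..V}\<times>{..V}. (Y uv + a) powr (e - 1)) \<le> (2 * real q / a) * (10 * real q * (1 / (e * a)))"
        using a e by (intro gen) (auto simp: M_def intro!: powr_mono2')
      then show ?thesis using that by (simp add: \<omega>_def power2_eq_square mult_ac)
    qed
    have "(\<Prod>i\<in>UNIV. \<Sum>uv\<in>{..V}\<times>{..V}. \<omega> i uv) = (\<Sum>uv\<in>{..V}\<times>{..V}. \<omega> k uv) * (\<Prod>i\<in>UNIV-{k}. \<Sum>uv\<in>{..V}\<times>{..V}. \<omega> i uv)"
      by (rule split)
    also have "\<dots> \<le> (100 * (real q)\<^sup>2 / a) * (\<Prod>i\<in>UNIV-{k}. 20 * (real q)\<^sup>2 / (e * a\<^sup>2))"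
      using k o a by (intro mult_mono prod_mono conjI) (auto intro!: sum_nonneg prod_nonneg w0)
    also have "\<dots> = (100 * (real q)\<^sup>2 / a) * (20 * (real q)\<^sup>2 / (e * a\<^sup>2)) ^ (CARD('n) - 1)"
      by (simp add: card_Diff_singleton)
    finally show "(\<Prod>i\<in>UNIV. \<Sum>uv\<in>{..V}\<times>{..V}. \<omega> i uv) \<le> (100 * (real q)\<^sup>2 / a) * (20 * (real q)\<^sup>2 / (e * a\<^sup>2)) ^ (CARD('n) - 1)" .
  qed auto
  finally have "real (card C) \<le> S powr (1 - e) * ((100 * (real q)\<^sup>2 / a) * (20 * (real q)\<^sup>2 / (e * a\<^sup>2)) ^ (CARD('n) - 1))" .
  moreover have "finite C" using finP by (simp add: C_def)
  ultimately show ?thesis using cover unfolding S_def b_def by blast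
qed

section \<open>Convergence half: the cost of one denominator q\<close>

lemma power_powr_swap: "0 < x \<Longrightarrow> (x ^ j) powr s = (x powr s) ^ j" for x s :: real
  by (induction j) (auto simp: powr_mult)

text \<open>Stands for f stripped of the factor x ^ (d - 1): monotonicity is (II), the growth bound
  is (I) with \<sigma> = s - d + 1. That \<sigma> < 1 drives the geometric decay in j, the bound
  over large scales and the absorption of linear terms.\<close>

locale gauge_growth =
  fixes g :: "real \<Rightarrow> real" and \<sigma> C :: real
  assumes g_pos: "0 < x \<Longrightarrow> 0 < g x"
    and g_mono: "0 < x \<Longrightarrow> x \<le> y \<Longrightarrow> g x \<le> g y"
    and g_growth: "0 < x \<Longrightarrow> x \<le> y \<Longrightarrow> g y \<le> C * (y / x) powr \<sigma> * g x"
    and sigma: "0 < \<sigma>" "\<sigma> < 1" and C_ge_1: "1 \<le> C"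
begin

lemma g_scale: "0 < x \<Longrightarrow> 1 \<le> c \<Longrightarrow> g (c * x) \<le> C * c * g x"
proof -
  assume x: "0 < x" and c: "1 \<le> c"
  have "g (c * x) \<le> C * (c * x / x) powr \<sigma> * g x"
    using x c by (intro g_growth) auto
  also have "\<dots> \<le> C * c * g x"
    using x c sigma C_ge_1 g_pos[OF x] powr_mono[of \<sigma> 1 c]
    by (intro mult_right_mono mult_left_mono) auto
  finally show ?thesis .
qed

end

definition product_set :: "nat \<Rightarrow> real \<Rightarrow> ((real ^ 'n) \<times> (real ^ 'n)) set" where
  "product_set q \<delta> = {(\<theta>, x) \<in> cbox 0 1 \<times> cbox 0 1. (\<Prod>i\<in>UNIV. dist_int (real q * x $ i - \<theta> $ i)) < \<delta>}"

text \<open>Let y be the minimal distance, attained at k, and j the least index with y < 2 ^ (j + 1)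
  * \<delta>. If j > 0, then a = 2 ^ j * \<delta> \<le> y, so the remaining product is at most
  \<delta> / a = 1 / 2 ^ j, and adding a at most doubles each factor. If j = 0, every factor plus a
  is at most 1. As y \<le> 1/2, no piece with a > 1/2 occurs.\<close>

lemma product_set_subset_near_sets:
  assumes \<delta>: "0 < \<delta>" "\<delta> \<le> 1/2"
  shows "(product_set q \<delta> :: ((real ^ 'n) \<times> (real ^ 'n)) set) \<subseteq>
    (\<Union>j. if 2 ^ j * \<delta> \<le> 1/2 then (\<Union>k. near_set k q (2 ^ j * \<delta>) (2 ^ CARD('n) / 2 ^ j)) else {})"
proof
  fix z :: "(real ^ 'n) \<times> (real ^ 'n)" assume z: "z \<in> product_set q \<delta>"
  obtain \<theta> x where zz: "z = (\<theta>, x)" by (cases z)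
  define y where "y i = dist_int (real q * x $ i - \<theta> $ i)" for i
  have cb: "\<theta> \<in> cbox 0 1" "x \<in> cbox 0 1" and pr: "(\<Prod>i\<in>UNIV. y i) < \<delta>"
    using z by (auto simp: zz product_set_def y_def)
  have y0: "0 \<le> y i" "y i \<le> 1/2" for i
    unfolding y_def by (rule dist_int_nonneg, rule dist_int_le_half)
  have "Min (range y) \<in> range y" by (rule Min_in) auto
  then obtain k where "Min (range y) = y k" by blast
  then have k: "y k \<le> y i" for i by (metis Min_le finite_imageI finite rangeI)
  have "\<exists>n. y k < 2 ^ n * (2 * \<delta>)"
  proof -
    obtain n where "1 / (2 * \<delta>) < 2 ^ n" using real_arch_pow[of 2] by auto
    then have "1 < 2 ^ n * (2 * \<delta>)" using \<delta> by (simp add: field_simps)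
    then show ?thesis using y0(2)[of k] by (intro exI[of _ n]) linarith
  qed
  define j where "j = (LEAST n. y k < 2 ^ n * (2 * \<delta>))"
  define a where "a = 2 ^ j * \<delta>"
  have j1: "y k < 2 * a" unfolding a_def j_def using LeastI_ex[OF \<open>\<exists>n. y k < 2 ^ n * (2 * \<delta>)\<close>] by simp
  have j2: "a \<le> y k" if "j > 0"
  proof -
    have "\<not> y k < 2 ^ (j - 1) * (2 * \<delta>)" unfolding j_def by (rule not_less_Least) (use that in \<open>simp add: j_def\<close>)
    moreover have "2 ^ (j - 1) * (2 * \<delta>) = a" using that by (cases j) (auto simp: a_def)
    ultimately show ?thesis by simp
  qed
  have a: "0 < a" using \<delta> by (simp add: a_def)
  have a2: "a \<le> 1/2"
  proof (cases "j = 0")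
    case False then show ?thesis using j2 y0(2)[of k] by linarith
  qed (use \<delta> in \<open>simp add: a_def\<close>)
  have "(\<Prod>i\<in>UNIV - {k}. y i + a) \<le> 2 ^ CARD('n) / 2 ^ j"
  proof (cases "j = 0")
    case True
    have "(\<Prod>i\<in>UNIV - {k}. y i + a) \<le> 1"
    proof (intro prod_le_1 conjI)
      fix i show "0 \<le> y i + a" "y i + a \<le> 1" using y0[of i] a a2 by linarith+
    qed
    also have "\<dots> \<le> 2 ^ CARD('n) / 2 ^ j" using True by simp
    finally show ?thesis .
  next
    case False
    then have ak: "a \<le> y k" using j2 by simp
    define Q where "Q = (\<Prod>i\<in>UNIV - {k}. y i)"
    have Q: "0 \<le> Q" using y0 by (auto simp: Q_def intro: prod_nonneg)
    have "y k * Q < \<delta>" using pr by (simp add: Q_def prod.remove[of UNIV k])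
    moreover have "a * Q \<le> y k * Q" using ak Q by (rule mult_right_mono)
    ultimately have "2 ^ j * Q * \<delta> < 1 * \<delta>" by (simp add: a_def mult_ac)
    then have Qj: "Q \<le> 1 / 2 ^ j" using \<delta> by (simp add: field_simps)
    have "(\<Prod>i\<in>UNIV - {k}. y i + a) \<le> (\<Prod>i\<in>UNIV - {k}. 2 * y i)"
    proof (intro prod_mono conjI)
      fix i show "0 \<le> y i + a" using y0[of i] a by linarith
      show "y i + a \<le> 2 * y i" using k[of i] ak by linarith
    qed
    also have "\<dots> = 2 ^ (CARD('n) - 1) * Q"
      unfolding Q_def by (simp only: prod.distrib prod_constant) (simp add: card_Diff_singleton)
    also have "\<dots> \<le> 2 ^ CARD('n) * (1 / 2 ^ j)"
      using Q Qj by (intro mult_mono power_increasing) auto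
    finally show ?thesis by simp
  qed
  then have "z \<in> near_set k q a (2 ^ CARD('n) / 2 ^ j)"
    unfolding zz near_set_def using cb j1 by (simp add: y_def)
  then show "z \<in> (\<Union>j. if 2 ^ j * \<delta> \<le> 1/2 then (\<Union>k. near_set k q (2 ^ j * \<delta>) (2 ^ CARD('n) / 2 ^ j)) else {})"
    using a2 unfolding a_def by (intro UN_I[of j]) auto
qed

context gauge_growth
begin

text \<open>There are about q ^ (2 * d) / a ^ (2 * d - 1) cells, times t powr (1 - e), and a cell of
  side a / q costs about (a / q) ^ (2 * d - 1) * g (a / q): the powers of a cancel and one factor q
  remains. Per step of j the count brings 2 powr (e - 1) and the growth of g brings 2 powr \<sigma>;
  their product is 2 powr (- e) by the choice of e.\<close>

lemma hausdorff_pre_near_sets_le: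
  fixes \<delta> \<rho> :: real and j q :: nat
  defines "e \<equiv> (1 - \<sigma>) / 2" and "d \<equiv> CARD('n::finite)"
  defines "K \<equiv> real d * ((6 ^ d) powr (1 - e) * (100 * (20 / e) ^ (d - 1)) * ((2 * real d) ^ (2 * d - 1) * (C * (2 * real d))) * C)"
  assumes q: "1 \<le> q" and \<delta>: "0 < \<delta>" "2 ^ j * \<delta> \<le> 1/2" and \<rho>: "real d / real q \<le> \<rho>"
  shows "hausdorff_pre (\<lambda>x. x ^ (2 * d - 1) * g x) \<rho>
      (\<Union>k::'n. near_set k q (2 ^ j * \<delta>) (2 ^ d / 2 ^ j)) \<le> ennreal (K * (2 powr (- e)) ^ j * (real q * g (\<delta> / real q)))"
proof -
  define a where "a = 2 ^ j * \<delta>"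
  have a: "0 < a" "a \<le> 1/2" using \<delta> by (auto simp: a_def)
  have e: "0 < e" "e \<le> 1" using sigma by (auto simp: e_def)
  have d: "d \<ge> 1" by (simp add: d_def Suc_leI)
  have rq: "real q \<ge> 1" using q by simp
  define Bd where "Bd = (3 ^ d * (2 ^ d / 2 ^ j)) powr (1 - e) *
        ((100 * (real q)\<^sup>2 / a) * (20 * (real q)\<^sup>2 / (e * a\<^sup>2)) ^ (d - 1))"
  have "\<exists>Cs. finite Cs \<and> near_set k q a (2 ^ d / 2 ^ j) \<subseteq> (\<Union>w\<in>Cs. grid_cell (a / real q) w) \<and> real (card Cs) \<le> Bd" for k :: 'n
    unfolding Bd_def d_def by (rule near_set_cover[OF q a e]) simp
  then obtain Cs where Cs: "\<And>k::'n. finite (Cs k)"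
    "\<And>k. near_set k q a (2 ^ d / 2 ^ j) \<subseteq> (\<Union>w\<in>Cs k. grid_cell (a / real q) w)" "\<And>k. real (card (Cs k)) \<le> Bd"
    by metis
  define T where "T = (SIGMA k:UNIV. Cs k)"
  have finT: "finite T" unfolding T_def using Cs(1) by auto
  have cardT: "real (card T) \<le> real d * Bd"
  proof -
    have "card T = (\<Sum>k\<in>UNIV. card (Cs k))" unfolding T_def using Cs(1) by (simp add: card_SigmaI)
    then have "real (card T) = (\<Sum>k\<in>UNIV. real (card (Cs k)))" by simp
    also have "\<dots> \<le> (\<Sum>k\<in>(UNIV::'n set). Bd)" by (intro sum_mono Cs(3))
    finally show ?thesis by (simp add: d_def)
  qed
  define b where "b = a / real q"
  define R where "R = 2 * real d * b"
  have b: "0 < b" using a rq by (simp add: b_def)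
  have R: "0 < R" "R \<le> \<rho>"
  proof -
    show "0 < R" using b d by (simp add: R_def)
    have "R = (2 * a) * (real d / real q)" by (simp add: R_def b_def)
    also have "\<dots> \<le> 1 * (real d / real q)" using a by (intro mult_right_mono) auto
    finally show "R \<le> \<rho>" using \<rho> by simp
  qed
  have gR: "g R \<le> C * (2 * real d) * g b"
    unfolding R_def using g_scale[OF b, of "2 * real d"] d by simp
  have gb: "g b \<le> C * (2 powr \<sigma>) ^ j * g (\<delta> / real q)"
  proof -
    have "\<delta> / real q \<le> b" using \<delta> rq by (auto simp: b_def a_def intro!: divide_right_mono)
    then have "g b \<le> C * (b / (\<delta> / real q)) powr \<sigma> * g (\<delta> / real q)"
      using \<delta> rq by (intro g_growth) auto
    also have "b / (\<delta> / real q) = 2 ^ j" using \<delta> rq by (simp add: b_def a_def)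
    also have "(2 ^ j) powr \<sigma> = (2 powr \<sigma>) ^ j"
      by (simp add: power_powr_swap)
    finally show ?thesis .
  qed
  have "hausdorff_pre (\<lambda>x. x ^ (2 * d - 1) * g x) \<rho> (\<Union>k::'n. near_set k q a (2 ^ d / 2 ^ j))
      \<le> ennreal (real (card T) * (R ^ (2 * d - 1) * g R))"
  proof (rule hausdorff_pre_finite_cover[OF finT, where B = "\<lambda>(k,w). grid_cell b w"])
    show "(\<Union>k::'n. near_set k q a (2 ^ d / 2 ^ j)) \<subseteq> (\<Union>c\<in>T. case c of (k, w) \<Rightarrow> grid_cell b w)"
    proof
      fix z assume "z \<in> (\<Union>k::'n. near_set k q a (2 ^ d / 2 ^ j))"
      then obtain k :: 'n where "z \<in> near_set k q a (2 ^ d / 2 ^ j)" by blast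
      then obtain w where "w \<in> Cs k" "z \<in> grid_cell b w" using Cs(2)[of k] unfolding b_def by blast
      then show "z \<in> (\<Union>c\<in>T. case c of (k, w) \<Rightarrow> grid_cell b w)"
        by (intro UN_I[of "(k,w)"]) (auto simp: T_def)
    qed
    show "bounded (case c of (k, w) \<Rightarrow> grid_cell b w) \<and> diameter (case c of (k, w) \<Rightarrow> grid_cell b w) \<le> R" for c :: "'n \<times> ('n \<Rightarrow> nat \<times> nat)"
      using grid_cell_diameter[of b] b by (auto simp: R_def d_def split: prod.split)
    show "t ^ (2 * d - 1) * g t \<le> R ^ (2 * d - 1) * g R" if "0 < t" "t \<le> R" for t
      using that g_pos[of t] by (intro mult_mono power_mono g_mono) auto
  qed (use R g_pos[of R] in auto)
  also have "\<dots> \<le> ennreal (K * (2 powr (- e)) ^ j * (real q * g (\<delta> / real q)))"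
  proof (rule ennreal_leI)
    have Bd0: "Bd \<ge> 0" unfolding Bd_def using a e by (intro mult_nonneg_nonneg) auto
    have "real (card T) * (R ^ (2 * d - 1) * g R)
       \<le> (real d * Bd) * (R ^ (2 * d - 1) * (C * (2 * real d) * (C * (2 powr \<sigma>) ^ j * g (\<delta> / real q))))"
    proof (intro mult_mono cardT order_refl)
      show "g R \<le> C * (2 * real d) * (C * (2 powr \<sigma>) ^ j * g (\<delta> / real q))"
        using C_ge_1 by (intro order_trans[OF gR] mult_left_mono[OF gb]) auto
    qed (use Bd0 R g_pos[of R] in auto)
    also have "\<dots> = K * (2 powr (- e)) ^ j * (real q * g (\<delta> / real q))"
    proof -
      obtain m where m: "d = Suc m" using d by (cases d) auto
      have 1: "(3 ^ d * (2 ^ d / 2 ^ j)) powr (1 - e) = (6 ^ d) powr (1 - e) * (2 powr (e - 1)) ^ j"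
      proof -
        have "(3 ^ d * (2 ^ d / 2 ^ j)) powr (1 - e) = ((6::real) ^ d / 2 ^ j) powr (1 - e)"
          by (simp add: power_mult_distrib[symmetric])
        also have "\<dots> = (6 ^ d) powr (1 - e) / (2 ^ j) powr (1 - e)" by (simp add: powr_divide)
        also have "(2 ^ j) powr (1 - e) = ((2::real) powr (1 - e)) ^ j"
          by (simp add: power_powr_swap)
        also have "(6 ^ d) powr (1 - e) / ((2::real) powr (1 - e)) ^ j = (6 ^ d) powr (1 - e) * (2 powr (e - 1)) ^ j"
          using powr_minus_divide[of 2 "1 - e"] by (simp add: power_divide)
        finally show ?thesis .
      qed
      have 2: "(100 * (real q)\<^sup>2 / a) * (20 * (real q)\<^sup>2 / (e * a\<^sup>2)) ^ (d - 1) * R ^ (2 * d - 1)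
          = 100 * (20 / e) ^ (d - 1) * (2 * real d) ^ (2 * d - 1) * real q"
      proof -
        let ?A = "20 * (real q)\<^sup>2 / (e * a\<^sup>2)" and ?B = "100 * (real q)\<^sup>2 / a"
        have "R ^ (2 * d - 1) = (2 * real d) ^ (2 * d - 1) * b ^ (2 * d - 1)" by (simp add: R_def power_mult_distrib)
        also have "b ^ (2 * d - 1) = b * (b\<^sup>2) ^ m" by (simp add: m power_mult)
        finally have R1: "R ^ (2 * d - 1) = (2 * real d) ^ (2 * d - 1) * (b * (b\<^sup>2) ^ m)" .
        have R2: "?A ^ (d - 1) * (b\<^sup>2) ^ m = (20 / e) ^ (d - 1)"
        proof -
          have "(20 * (real q)\<^sup>2 / (e * a\<^sup>2)) * b\<^sup>2 = 20 / e"
            using a e rq by (simp add: b_def power_divide)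
          then show ?thesis unfolding m by (simp add: power_mult_distrib[symmetric])
        qed
        have R3: "?B * b = 100 * real q" using a rq by (simp add: b_def power2_eq_square)
        have "?B * ?A ^ (d - 1) * R ^ (2 * d - 1) = (?B * b) * (?A ^ (d - 1) * (b\<^sup>2) ^ m) * (2 * real d) ^ (2 * d - 1)"
          unfolding R1 by (simp only: mult_ac)
        then show ?thesis unfolding R2 R3 by (simp only: mult_ac)
      qed
      have 3: "(2 powr (e - 1)) ^ j * (2 powr \<sigma>) ^ j = (2 powr (- e)) ^ j"
      proof -
        have "(2::real) powr (e - 1) * 2 powr \<sigma> = 2 powr (- e)"
          unfolding powr_add[symmetric] by (rule arg_cong[where f = "(powr) 2"]) (simp add: e_def field_simps)
        then show ?thesis by (simp add: power_mult_distrib[symmetric])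
      qed
      have "(real d * Bd) * (R ^ (2 * d - 1) * (C * (2 * real d) * (C * (2 powr \<sigma>) ^ j * g (\<delta> / real q))))
        = real d * (6 ^ d) powr (1 - e) * ((2 powr (e - 1)) ^ j * (2 powr \<sigma>) ^ j) *
          ((100 * (real q)\<^sup>2 / a) * (20 * (real q)\<^sup>2 / (e * a\<^sup>2)) ^ (d - 1) * R ^ (2 * d - 1)) *
          (C * (2 * real d) * C * g (\<delta> / real q))"
        unfolding Bd_def 1 by (simp only: mult_ac)
      also have "\<dots> = K * (2 powr (- e)) ^ j * (real q * g (\<delta> / real q))"
        unfolding 2 3 K_def by (simp only: mult_ac)
      finally show ?thesis .
    qed
    finally show "real (card T) * (R ^ (2 * d - 1) * g R) \<le> K * (2 powr (- e)) ^ j * (real q * g (\<delta> / real q))" .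
  qed
  finally show ?thesis unfolding a_def .
qed

text \<open>The condition on \<rho> does not involve j, so one \<rho> serves all the pieces and
  their costs sum to a geometric series.\<close>

lemma hausdorff_pre_product_set_le:
  "\<exists>K\<ge>0. \<forall>q \<delta> \<rho>. 1 \<le> q \<longrightarrow> 0 < \<delta> \<longrightarrow> \<delta> \<le> 1/2 \<longrightarrow> real CARD('n::finite) / real q \<le> \<rho> \<longrightarrow>
     hausdorff_pre (\<lambda>x. x ^ (2 * CARD('n) - 1) * g x) \<rho> (product_set q \<delta> :: ((real ^ 'n) \<times> (real ^ 'n)) set)
       \<le> ennreal (K * (real q * g (\<delta> / real q)))"
proof -
  define e where "e = (1 - \<sigma>) / 2"
  define d where "d = CARD('n)"
  define K where "K = real d * ((6 ^ d) powr (1 - e) * (100 * (20 / e) ^ (d - 1)) * ((2 * real d) ^ (2 * d - 1) * (C * (2 * real d))) * C)"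
  define r where "r = 2 powr (- e)"
  have e: "0 < e" using sigma by (simp add: e_def)
  have r: "0 < r" "r < 1" using e by (auto simp: r_def powr_less_one)
  have K: "0 \<le> K" unfolding K_def using e C_ge_1 by (intro mult_nonneg_nonneg) auto
  have "hausdorff_pre (\<lambda>x. x ^ (2 * d - 1) * g x) \<rho> (product_set q \<delta> :: ((real ^ 'n) \<times> (real ^ 'n)) set)
       \<le> ennreal (K / (1 - r) * (real q * g (\<delta> / real q)))"
    if q: "1 \<le> q" and \<delta>: "0 < \<delta>" "\<delta> \<le> 1/2" and \<rho>: "real d / real q \<le> \<rho>" for q \<delta> \<rho>
  proof -
    define T where "T = real q * g (\<delta> / real q)"
    have T: "0 \<le> T" using g_pos[of "\<delta> / real q"] q \<delta> by (simp add: T_def)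
    have rho0: "0 \<le> \<rho>" by (rule order_trans[OF _ \<rho>]) simp
    let ?F = "\<lambda>x. x ^ (2 * d - 1) * g x"
    let ?S = "\<lambda>j. if 2 ^ j * \<delta> \<le> 1/2 then (\<Union>k::'n. near_set k q (2 ^ j * \<delta>) (2 ^ d / 2 ^ j)) else {}"
    have "hausdorff_pre ?F \<rho> (product_set q \<delta> :: ((real ^ 'n) \<times> (real ^ 'n)) set) \<le> hausdorff_pre ?F \<rho> (\<Union>j. ?S j)"
      unfolding d_def by (rule hausdorff_pre_mono[OF product_set_subset_near_sets[OF \<delta>]])
    also have "\<dots> \<le> (\<Sum>j. hausdorff_pre ?F \<rho> (?S j))" by (rule hausdorff_pre_UN_le)
    also have "\<dots> \<le> (\<Sum>j. ennreal (K * r ^ j * T))"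
    proof (rule suminf_le)
      fix j
      show "hausdorff_pre ?F \<rho> (?S j) \<le> ennreal (K * r ^ j * T)"
      proof (cases "2 ^ j * \<delta> \<le> 1/2")
        case True
        show ?thesis
          using hausdorff_pre_near_sets_le[OF q \<delta>(1) True \<rho>[unfolded d_def]] True
          unfolding K_def r_def T_def d_def e_def by simp
      next
        case False
        have "hausdorff_pre ?F \<rho> ({} :: ((real ^ 'n) \<times> (real ^ 'n)) set) \<le> ennreal (real (card ({}::nat set)) * 0)"
          by (rule hausdorff_pre_finite_cover[where r = 0 and B = "\<lambda>_. {}"]) (use rho0 in auto)
        then show ?thesis using False by simp
      qed
    qed auto
    also have "\<dots> = ennreal (K / (1 - r) * T)"
    proof (rule suminf_ennreal_eq)
      have "(\<lambda>j. (K * T) * r ^ j) sums ((K * T) * (1 / (1 - r)))"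
        using r by (intro sums_mult geometric_sums) auto
      then show "(\<lambda>j. K * r ^ j * T) sums (K / (1 - r) * T)" by (simp add: mult_ac)
    qed (use K T r in auto)
    finally show ?thesis by (simp add: T_def)
  qed
  moreover have "0 \<le> K / (1 - r)" using K r by simp
  ultimately show ?thesis unfolding d_def by blast
qed

lemma hausdorff_measure_W_set_eq_0:
  fixes \<psi> :: "nat \<Rightarrow> real"
  assumes psi: "\<And>q. q \<ge> 1 \<Longrightarrow> \<psi> q > 0"
    and sm: "summable (\<lambda>q. real (Suc q) * g (\<psi> (Suc q) / real (Suc q)))"
  shows "hausdorff_measure (\<lambda>x. x ^ (2 * CARD('n::finite) - 1) * g x) (W_set \<psi> :: ((real ^ 'n) \<times> (real ^ 'n)) set) = 0"
proof -
  let ?F = "\<lambda>x. x ^ (2 * CARD('n) - 1) * g x"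
  let ?W = "W_set \<psi> :: ((real ^ 'n) \<times> (real ^ 'n)) set"
  define T where "T q = real q * g (\<psi> q / real q)" for q
  obtain K where K: "K \<ge> 0" "\<And>q \<delta> \<rho>. 1 \<le> q \<Longrightarrow> 0 < \<delta> \<Longrightarrow> \<delta> \<le> 1/2 \<Longrightarrow> real CARD('n) / real q \<le> \<rho> \<Longrightarrow>
     hausdorff_pre ?F \<rho> (product_set q \<delta> :: ((real ^ 'n) \<times> (real ^ 'n)) set) \<le> ennreal (K * (real q * g (\<delta> / real q)))"
    using hausdorff_pre_product_set_le[where 'n='n] by auto
  have smT: "summable T" using sm unfolding T_def[symmetric] summable_Suc_iff .
  \<comment> \<open>The cover bound asks for \<psi> q \<le> 1/2. Convergence ensures this
    eventually: by \<open>g_scale\<close>, \<psi> q > 1/2 would make the summand at least g (1/2) /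
    C.\<close>
  have psi_small: "\<forall>\<^sub>F q in sequentially. \<psi> q \<le> 1/2"
  proof -
    have "\<forall>\<^sub>F q in sequentially. T q < g (1/2) / C"
      using summable_LIMSEQ_zero[OF smT] g_pos[of "1/2"] C_ge_1 by (intro order_tendstoD) auto
    then show ?thesis using eventually_ge_at_top[of 1]
    proof (eventually_elim)
      case (elim q)
      show ?case
      proof (rule ccontr)
        assume n: "\<not> \<psi> q \<le> 1/2"
        have q: "q \<ge> 1" using elim(2) by simp
        then have rq: "real q \<ge> 1" by simp
        have "g (1/2) \<le> C * real q * g (1 / (2 * real q))"
          using g_scale[of "1 / (2 * real q)" "real q"] rq by simp
        also have "\<dots> \<le> C * real q * g (\<psi> q / real q)"
          using n rq C_ge_1 by (intro mult_left_mono g_mono) (auto simp: field_simps)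
        finally have "g (1/2) / C \<le> T q" using C_ge_1 by (simp add: T_def field_simps)
        with elim(1) show False by simp
      qed
    qed
  qed
  have "hausdorff_pre ?F \<rho> ?W = 0" if \<rho>: "\<rho> > 0" for \<rho>
  proof -
    have "hausdorff_pre ?F \<rho> ?W \<le> 0 + ennreal e" if e: "e > 0" for e
    proof -
      obtain N0 where N0: "\<And>q. q \<ge> N0 \<Longrightarrow> \<psi> q \<le> 1/2" using psi_small by (auto simp: eventually_sequentially)
      obtain N1 where N1: "real CARD('n) / \<rho> \<le> real N1" using real_arch_simple by blast
      obtain N2 where N2: "\<And>n. n \<ge> N2 \<Longrightarrow> \<bar>\<Sum>i. T (i + n)\<bar> < e / (K + 1)"
        using suminf_exist_split[OF _ smT, of "e / (K + 1)"] e K(1) by (auto simp: real_norm_def)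
      define N where "N = Max {N0, N1, N2, 1}"
      have N: "N \<ge> N0" "N \<ge> N1" "N \<ge> N2" "N \<ge> 1" by (auto simp: N_def)
      have "?W \<subseteq> (\<Union>n. product_set (n + N) (\<psi> (n + N)))"
      proof
        fix z assume "z \<in> ?W"
        then obtain \<theta> x where z: "z = (\<theta>, x)" "\<theta> \<in> cbox 0 1" "x \<in> cbox 0 1"
          and inf: "infinite {q::nat. q \<ge> 1 \<and> (\<Prod>i\<in>UNIV. dist_int (real q * x $ i - \<theta> $ i)) < \<psi> q}"
          by (auto simp: W_set_def W_fibre_def)
        then obtain q where "q > N" "(\<Prod>i\<in>UNIV. dist_int (real q * x $ i - \<theta> $ i)) < \<psi> q"
          unfolding infinite_nat_iff_unbounded by blast
        then show "z \<in> (\<Union>n. product_set (n + N) (\<psi> (n + N)))"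
          using z by (intro UN_I[of "q - N"]) (auto simp: product_set_def)
      qed
      then have "hausdorff_pre ?F \<rho> ?W \<le> hausdorff_pre ?F \<rho> (\<Union>n. product_set (n + N) (\<psi> (n + N)) :: ((real ^ 'n) \<times> (real ^ 'n)) set)"
        by (rule hausdorff_pre_mono)
      also have "\<dots> \<le> (\<Sum>n. hausdorff_pre ?F \<rho> (product_set (n + N) (\<psi> (n + N)) :: ((real ^ 'n) \<times> (real ^ 'n)) set))"
        by (rule hausdorff_pre_UN_le)
      also have "\<dots> \<le> (\<Sum>n. ennreal (K * T (n + N)))"
        unfolding T_def
      proof (intro suminf_le K(2))
        fix n
        have "real CARD('n) / \<rho> \<le> real (n + N)" using N1 N by linarith
        then show "real CARD('n) / real (n + N) \<le> \<rho>" using \<rho> N by (simp add: field_simps)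
      qed (use N N0 psi in auto)
      also have "\<dots> = ennreal (K * (\<Sum>n. T (n + N)))"
      proof (rule suminf_ennreal_eq)
        show "0 \<le> K * T (i + N)" for i
          using K(1) psi[of "i + N"] N g_pos[of "\<psi> (i + N) / real (i + N)"] by (simp add: T_def)
        show "(\<lambda>i. K * T (i + N)) sums (K * (\<Sum>n. T (n + N)))"
          using smT by (intro sums_mult summable_sums) (simp add: summable_iff_shift)
      qed
      also have "\<dots> \<le> ennreal e"
      proof (rule ennreal_leI)
        have "K * (\<Sum>n. T (n + N)) \<le> K * (e / (K + 1))"
          using N2[OF N(3)] K(1) by (intro mult_left_mono) auto
        also have "\<dots> \<le> e" using K(1) e by (simp add: field_simps)
        finally show "K * (\<Sum>n. T (n + N)) \<le> e" .
      qed
      finally show ?thesis by simp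
    qed
    then have "hausdorff_pre ?F \<rho> ?W \<le> 0" by (rule ennreal_le_epsilon)
    then show ?thesis by simp
  qed
  then show ?thesis unfolding hausdorff_measure_eq_SUP by simp
qed

end

section \<open>Slicing down to the plane\<close>

lemma emeasure_lborel_cbox_Times:
  fixes a b c d :: "real ^ 'n"
  assumes "\<And>i. a $ i \<le> b $ i" "\<And>i. c $ i \<le> d $ i"
  shows "emeasure lborel (cbox a b \<times> cbox c d) = ennreal ((\<Prod>i\<in>UNIV. b $ i - a $ i) * (\<Prod>i\<in>UNIV. d $ i - c $ i))"
proof -
  have *: "emeasure lborel (cbox u v) = ennreal (\<Prod>i\<in>UNIV. v $ i - u $ i)" if "\<And>i. u $ i \<le> v $ i" for u v :: "real ^ 'n"
  proof -
    have "cbox u v \<noteq> {}" using that by (auto simp: interval_ne_empty_cart)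
    then have "measure lborel (cbox u v) = (\<Prod>i\<in>UNIV. v $ i - u $ i)" by (rule content_cbox_cart)
    moreover have "emeasure lborel (cbox u v) = ennreal (measure lborel (cbox u v))"
      by (intro emeasure_eq_ennreal_measure) (use emeasure_lborel_cbox_finite[of u v] in auto)
    ultimately show ?thesis by simp
  qed
  have "emeasure lborel (cbox a b \<times> cbox c d) = emeasure (lborel \<Otimes>\<^sub>M lborel) (cbox a b \<times> cbox c d)"
    by (simp add: lborel_prod)
  also have "\<dots> = emeasure lborel (cbox a b) * emeasure lborel (cbox c d)"
    by (rule lborel.emeasure_pair_measure_Times) auto
  also have "\<dots> = ennreal (\<Prod>i\<in>UNIV. b $ i - a $ i) * ennreal (\<Prod>i\<in>UNIV. d $ i - c $ i)"
    using assms * by simp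
  also have "\<dots> = ennreal ((\<Prod>i\<in>UNIV. b $ i - a $ i) * (\<Prod>i\<in>UNIV. d $ i - c $ i))"
    using assms by (intro ennreal_mult[symmetric] prod_nonneg) auto
  finally show ?thesis .
qed

text \<open>A cover element of diameter \<open>r\<close> meets few slices: averaging the covers induced on the slices over the remaining
  coordinates gains the factor \<open>r ^ (2 * (CARD('n) - 1))\<close>.\<close>

lemma hausdorff_pre_slice_le:
  fixes A :: "(real \<times> real) set" and k :: "'n::finite" and W :: "((real ^ 'n) \<times> (real ^ 'n)) set"
  assumes W: "\<And>\<theta> x. \<theta> \<in> cbox 0 1 \<Longrightarrow> x \<in> cbox 0 1 \<Longrightarrow> (\<theta> $ k, x $ k) \<in> A \<Longrightarrow> (\<theta>, x) \<in> W"
    and A: "A \<subseteq> {0..1} \<times> {0..1}"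
    and G: "\<And>r. 0 < r \<Longrightarrow> 0 \<le> G r" "\<And>r r'. 0 < r \<Longrightarrow> r \<le> r' \<Longrightarrow> G r \<le> G r'"
  shows "hausdorff_pre G \<rho> A \<le> ennreal (4 ^ (CARD('n) - 1)) * hausdorff_pre (\<lambda>r. r ^ (2 * (CARD('n) - 1)) * G r) \<rho> W"
proof -
  define m where "m = CARD('n) - 1"
  let ?F = "\<lambda>r. r ^ (2 * m) * G r"
  have main: "hausdorff_pre G \<rho> A \<le> ennreal (4 ^ m) * (\<Sum>j. gauge_diam ?F (B j))" if B: "B \<in> fine_covers \<rho> W" for B
  proof -
    define d where "d j = diameter (B j)" for j
    have bd: "bounded (B j)" "d j \<le> \<rho>" "0 \<le> d j" for j
      using B by (auto simp: fine_covers_def d_def diameter_ge_0)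
    define b where "b j = (SOME z. z \<in> B j)" for j
    have b: "b j \<in> B j" if "B j \<noteq> {}" for j using that by (simp add: b_def some_in_eq)
    \<comment> \<open>The boxes are all of [0, 1] in coordinate k and have side 2 * d j elsewhere,
      so that X j contains every base point of the unit cube whose slice meets B j. The volume (2 *
      d j) ^ (2 * m) is the origin of 4 ^ m.\<close>
    define lo where "lo j v = (\<chi> i. if i = k then 0 else v $ i - d j)" for j and v :: "real ^ 'n"
    define hi where "hi j v = (\<chi> i. if i = k then 1 else v $ i + d j)" for j and v :: "real ^ 'n"
    define X where "X j = (if B j = {} then {} else
       cbox (lo j (fst (b j))) (hi j (fst (b j))) \<times> cbox (lo j (snd (b j))) (hi j (snd (b j))))" for j
    define \<gamma> where "\<gamma> j = gauge_diam G (B j)" for j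
    have Xm: "X j \<in> sets lborel" for j
      unfolding X_def by (auto simp: cbox_Pair_eq[symmetric])
    have mX: "\<gamma> j * emeasure lborel (X j) \<le> ennreal (4 ^ m) * gauge_diam ?F (B j)" for j
    proof (cases "B j = {} \<or> d j = 0")
      case True
      then show ?thesis by (auto simp: X_def \<gamma>_def gauge_diam_def d_def)
    next
      case False
      then have d: "0 < d j" using bd(3)[of j] by simp
      have pr: "(\<Prod>i\<in>UNIV. hi j v $ i - lo j v $ i) = (2 * d j) ^ m" for v
      proof -
        have "(\<Prod>i\<in>UNIV. hi j v $ i - lo j v $ i) = (hi j v $ k - lo j v $ k) * (\<Prod>i\<in>UNIV - {k}. hi j v $ i - lo j v $ i)"
          by (simp add: prod.remove)
        also have "(\<Prod>i\<in>UNIV - {k}. hi j v $ i - lo j v $ i) = (\<Prod>i\<in>UNIV - {k}. 2 * d j)"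
          by (rule prod.cong) (auto simp: hi_def lo_def)
        finally show ?thesis by (simp add: hi_def lo_def card_Diff_singleton m_def)
      qed
      have le: "lo j v $ i \<le> hi j v $ i" for v i using d by (simp add: lo_def hi_def)
      have "emeasure lborel (X j) = ennreal ((2 * d j) ^ m * (2 * d j) ^ m)"
        using False unfolding X_def by (simp add: emeasure_lborel_cbox_Times[OF le le] pr)
      then have "\<gamma> j * emeasure lborel (X j) = ennreal (G (d j) * ((2 * d j) ^ m * (2 * d j) ^ m))"
        using False d G(1)[OF d] by (simp add: \<gamma>_def gauge_diam_def d_def[symmetric] ennreal_mult)
      also have "G (d j) * ((2 * d j) ^ m * (2 * d j) ^ m) = 4 ^ m * (d j ^ (2 * m) * G (d j))"
      proof -
        have "(2 * d j) ^ m * (2 * d j) ^ m = (4 * (d j)\<^sup>2) ^ m"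
          unfolding power_mult_distrib[symmetric] by (rule arg_cong[where f = "\<lambda>x. x ^ m"]) (simp add: power2_eq_square)
        also have "\<dots> = 4 ^ m * d j ^ (2 * m)" by (simp add: power_mult_distrib power_mult)
        finally show ?thesis by simp
      qed
      also have "ennreal (4 ^ m * (d j ^ (2 * m) * G (d j))) = ennreal (4 ^ m) * gauge_diam ?F (B j)"
        using False d G(1)[OF d] by (simp add: gauge_diam_def d_def[symmetric] ennreal_mult)
      finally show ?thesis by simp
    qed
    let ?cube = "cbox 0 1 \<times> cbox 0 1 :: ((real ^ 'n) \<times> (real ^ 'n)) set"
    \<comment> \<open>The coordinates of z other than k fix a plane. The projections of those B j
      that can meet it cover A, and projecting does not increase diameters. Integrating over the
      cube, which has volume 1, then averages over all planes.\<close>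
    have pw: "hausdorff_pre G \<rho> A \<le> (\<Sum>j. \<gamma> j * indicator (X j) z)" if z: "z \<in> ?cube" for z
    proof -
      define pj where "pj y = (fst y $ k, snd y $ k)" for y :: "(real ^ 'n) \<times> (real ^ 'n)"
      define D where "D j = (if z \<in> X j then pj ` B j else {})" for j
      have lip: "dist (pj y) (pj y') \<le> dist y y'" for y y'
      proof -
        have c: "(u $ k)\<^sup>2 \<le> (norm u)\<^sup>2" for u :: "real ^ 'n"
          by (metis abs_le_square_iff abs_norm_cancel component_le_norm_cart)
        show ?thesis
          unfolding pj_def dist_prod_def
          using c[of "fst y - fst y'"] c[of "snd y - snd y'"] by (auto simp: dist_norm intro!: real_sqrt_le_mono add_mono)
      qed
      have bD: "bounded (D j) \<and> diameter (D j) \<le> d j" for j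
      proof -
        have *: "dist u v \<le> d j" if "u \<in> D j" "v \<in> D j" for u v
        proof -
          from that obtain y y' where "y \<in> B j" "y' \<in> B j" "u = pj y" "v = pj y'" by (auto simp: D_def split: if_splits)
          then show ?thesis using lip[of y y'] diameter_bounded_bound[OF bd(1), of y j y'] by (simp add: d_def)
        qed
        have "bounded (D j)"
        proof (cases "D j = {}")
          case False
          then obtain u where "u \<in> D j" by blast
          then show ?thesis unfolding bounded_def using * by blast
        qed simp
        moreover have "diameter (D j) \<le> d j" using * bd(3) by (intro diameter_le) (auto simp: dist_norm)
        ultimately show ?thesis ..
      qed
      have "D \<in> fine_covers \<rho> A"
      proof -
        have "p \<in> (\<Union>j. D j)" if p: "p \<in> A" for p
        proof -
          obtain t u where tu: "p = (t, u)" by (cases p)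
          have tu01: "0 \<le> t" "t \<le> 1" "0 \<le> u" "u \<le> 1" using p A by (auto simp: tu)
          define \<theta> where "\<theta> = (\<chi> i. if i = k then t else fst z $ i)"
          define x where "x = (\<chi> i. if i = k then u else snd z $ i)"
          have "fst z \<in> cbox 0 1" "snd z \<in> cbox 0 1" using z by auto
          then have cb: "\<theta> \<in> cbox 0 1" "x \<in> cbox 0 1" using tu01 by (auto simp: \<theta>_def x_def mem_box_cart)
          then have "(\<theta>, x) \<in> W" using p by (intro W) (auto simp: \<theta>_def x_def tu)
          then obtain j where j: "(\<theta>, x) \<in> B j" using B by (auto simp: fine_covers_def)
          have dj: "dist (\<theta>, x) (b j) \<le> d j"
            using diameter_bounded_bound[OF bd(1) j b] j by (auto simp: d_def)
          have "norm (\<theta> - fst (b j)) \<le> d j" "norm (x - snd (b j)) \<le> d j"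
            using dist_fst_le[of "(\<theta>, x)" "b j"] dist_snd_le[of "(\<theta>, x)" "b j"] dj by (auto simp: dist_norm)
          then have "\<bar>(\<theta> - fst (b j)) $ i\<bar> \<le> d j" "\<bar>(x - snd (b j)) $ i\<bar> \<le> d j" for i
            by (meson component_le_norm_cart order_trans)+
          then have c: "\<bar>\<theta> $ i - fst (b j) $ i\<bar> \<le> d j" "\<bar>x $ i - snd (b j) $ i\<bar> \<le> d j" for i by auto
          have c': "\<bar>fst z $ i - fst (b j) $ i\<bar> \<le> d j" "\<bar>snd z $ i - snd (b j) $ i\<bar> \<le> d j" if "i \<noteq> k" for i
            using c[of i] that by (auto simp: \<theta>_def x_def)
          have zk: "0 \<le> fst z $ k" "fst z $ k \<le> 1" "0 \<le> snd z $ k" "snd z $ k \<le> 1"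
            using z by (auto simp: mem_box_cart)
          have "fst z \<in> cbox (lo j (fst (b j))) (hi j (fst (b j)))" "snd z \<in> cbox (lo j (snd (b j))) (hi j (snd (b j)))"
            using c' zk by (auto simp: mem_box_cart lo_def hi_def abs_le_iff algebra_simps)
          then have "z \<in> X j" using j by (auto simp: X_def mem_Times_iff)
          moreover have "p = pj (\<theta>, x)" by (simp add: pj_def \<theta>_def x_def tu)
          ultimately have "p \<in> D j" using j by (auto simp: D_def)
          then show ?thesis by blast
        qed
        moreover have "diameter (D j) \<le> \<rho>" for j using bD[of j] bd(2)[of j] by linarith
        ultimately show ?thesis using bD by (auto simp: fine_covers_def)
      qed
      then have "hausdorff_pre G \<rho> A \<le> (\<Sum>j. gauge_diam G (D j))" by (rule hausdorff_pre_le)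
      also have "\<dots> \<le> (\<Sum>j. \<gamma> j * indicator (X j) z)"
      proof (rule suminf_le)
        fix j
        have "0 \<le> diameter (D j)" using bD by (simp add: diameter_ge_0)
        show "gauge_diam G (D j) \<le> \<gamma> j * indicator (X j) z"
        proof (cases "diameter (D j) = 0 \<or> z \<notin> X j")
          case True then show ?thesis by (auto simp: gauge_diam_def D_def)
        next
          case False
          then have "0 < diameter (D j)" using \<open>0 \<le> diameter (D j)\<close> by simp
          moreover have "diameter (D j) \<le> d j" using bD by simp
          ultimately have "ennreal (G (diameter (D j))) \<le> ennreal (G (d j))" "d j \<noteq> 0"
            using G by (auto intro!: ennreal_leI)
          then show ?thesis using False by (simp add: gauge_diam_def \<gamma>_def d_def)
        qed
      qed auto
      finally show ?thesis .
    qed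
    have cube1: "emeasure lborel ?cube = 1"
      by (subst emeasure_lborel_cbox_Times) auto
    have cubem: "?cube \<in> sets lborel" by (auto simp: cbox_Pair_eq[symmetric])
    have "hausdorff_pre G \<rho> A = (\<integral>\<^sup>+z. hausdorff_pre G \<rho> A * indicator ?cube z \<partial>lborel)"
      by (simp only: nn_integral_cmult_indicator[OF cubem] cube1 mult_1_right)
    also have "\<dots> \<le> (\<integral>\<^sup>+z. (\<Sum>j. \<gamma> j * indicator (X j) z) \<partial>lborel)"
      using pw by (intro nn_integral_mono) (auto split: split_indicator)
    also have "\<dots> = (\<Sum>j. \<integral>\<^sup>+z. \<gamma> j * indicator (X j) z \<partial>lborel)"
      using Xm by (intro nn_integral_suminf) auto
    also have "\<dots> = (\<Sum>j. \<gamma> j * emeasure lborel (X j))"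
      using Xm by (simp add: nn_integral_cmult_indicator)
    also have "\<dots> \<le> (\<Sum>j. ennreal (4 ^ m) * gauge_diam ?F (B j))"
      by (intro suminf_le mX) auto
    also have "\<dots> = ennreal (4 ^ m) * (\<Sum>j. gauge_diam ?F (B j))" by simp
    finally show ?thesis .
  qed
  have "ennreal (1 / 4 ^ m) * hausdorff_pre G \<rho> A \<le> hausdorff_pre ?F \<rho> W"
    unfolding hausdorff_pre_def[of ?F]
  proof (rule INF_greatest)
    fix B assume "B \<in> fine_covers \<rho> W"
    from main[OF this] have "ennreal (1 / 4 ^ m) * hausdorff_pre G \<rho> A \<le> ennreal (1 / 4 ^ m) * (ennreal (4 ^ m) * (\<Sum>j. gauge_diam ?F (B j)))"
      by (rule mult_left_mono) simp
    also have "\<dots> = (\<Sum>j. gauge_diam ?F (B j))"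
      by (simp add: mult.assoc[symmetric] ennreal_mult[symmetric])
    finally show "ennreal (1 / 4 ^ m) * hausdorff_pre G \<rho> A \<le> (\<Sum>j. gauge_diam ?F (B j))" .
  qed
  then have "ennreal (4 ^ m) * (ennreal (1 / 4 ^ m) * hausdorff_pre G \<rho> A) \<le> ennreal (4 ^ m) * hausdorff_pre ?F \<rho> W"
    by (rule mult_left_mono) simp
  moreover have "ennreal (4 ^ m) * (ennreal (1 / 4 ^ m) * hausdorff_pre G \<rho> A) = hausdorff_pre G \<rho> A"
    by (simp add: mult.assoc[symmetric] ennreal_mult[symmetric])
  ultimately show ?thesis by (simp add: m_def)
qed

section \<open>Choice of scales\<close>

text \<open>If \<open>4 ^ k * v k\<close> is bounded, the indices that maximise \<open>2 ^ j * v j\<close> over \<open>j \<ge> k\<close> for some \<open>k\<close> still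
  carry at least half of the divergent sum, and \<open>v\<close> decays geometrically along them.\<close>

lemma select_scales:
  fixes v :: "nat \<Rightarrow> real" and \<eta> :: real
  assumes v: "\<And>k. 0 < v k" and ns: "\<not> summable (\<lambda>k. 4 ^ k * v k)" and \<eta>: "0 < \<eta>"
  shows "\<exists>S \<eta>'. finite S \<and> S \<subseteq> {N..} \<and> 0 < \<eta>' \<and> \<eta>' \<le> \<eta> \<and> 1 \<le> (\<Sum>k\<in>S. \<eta>' * (4 ^ k * v k)) \<and>
     (\<Sum>k\<in>S. \<eta>' * (4 ^ k * v k)) \<le> 2 \<and> (\<forall>k\<in>S. \<forall>k'\<in>S. k < k' \<longrightarrow> 2 ^ k' * v k' \<le> 2 ^ k * v k)"
proof (cases "\<exists>k\<ge>N. 1 / \<eta> \<le> 4 ^ k * v k")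
  case True
  then obtain k where k: "k \<ge> N" "1 / \<eta> \<le> 4 ^ k * v k" by blast
  \<comment> \<open>A single large term suffices, normalised to total weight exactly 1.\<close>
  have p: "0 < 4 ^ k * v k" using v by simp
  have "1 / (4 ^ k * v k) \<le> \<eta>" using k(2) \<eta> p by (simp add: field_simps)
  then show ?thesis
    using k p by (intro exI[of _ "{k}"] exI[of _ "1 / (4 ^ k * v k)"]) auto
next
  case False
  then have bd: "4 ^ k * v k < 1 / \<eta>" if "k \<ge> N" for k using that by force
  define K where "K = {k. k \<ge> N \<and> (\<forall>k'>k. 2 ^ k' * v k' \<le> 2 ^ k * v k)}"
  define s where "s n = (\<Sum>k\<in>K \<inter> {..n}. \<eta> * (4 ^ k * v k))" for n
  have "\<exists>n. s n \<ge> 1"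
  proof (rule ccontr)
    assume "\<not> (\<exists>n. s n \<ge> 1)"
    then have s1: "s n < 1" for n by (meson not_le)
    \<comment> \<open>Boundedness of 4 ^ j * v j makes 2 ^ j * v j tend to 0, so its maximum over j
      \<ge> k is attained in a finite window, and the maximiser belongs to K.\<close>
    have "\<exists>m. m \<ge> k \<and> m \<in> K \<and> 2 ^ k * v k \<le> 2 ^ m * v m" if k: "k \<ge> N" for k
    proof -
      have p: "0 < 2 ^ k * v k" using v by simp
      obtain J where J: "(1 / \<eta>) / (2 ^ k * v k) < 2 ^ J" using real_arch_pow[of 2] by auto
      have tail: "2 ^ j * v j < 2 ^ k * v k" if j: "j \<ge> J" "j \<ge> N" for j
      proof -
        have "1 / \<eta> < 2 ^ J * (2 ^ k * v k)" using pos_divide_less_eq[OF p, THEN iffD1, OF J] .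
        also have "\<dots> \<le> 2 ^ j * (2 ^ k * v k)" using p j by (intro mult_right_mono power_increasing) auto
        finally have "4 ^ j * v j < 2 ^ j * (2 ^ k * v k)" using bd[OF j(2)] by simp
        moreover have "(4::real) ^ j = 2 ^ j * 2 ^ j" by (simp add: power_mult_distrib[symmetric])
        ultimately show ?thesis by (simp add: mult.assoc)
      qed
      let ?A = "(\<lambda>j. 2 ^ j * v j) ` {k..k + J}"
      have "Max ?A \<in> ?A" by (rule Max_in) auto
      then obtain m where m: "m \<in> {k..k+J}" "Max ?A = 2 ^ m * v m" by blast
      have mx: "2 ^ j * v j \<le> 2 ^ m * v m" if "j \<in> {k..k+J}" for j
        unfolding m(2)[symmetric] by (rule Max_ge) (use that in auto)
      have km: "2 ^ k * v k \<le> 2 ^ m * v m" by (rule mx) simp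
      have "2 ^ k' * v k' \<le> 2 ^ m * v m" if "k' > m" for k'
      proof (cases "k' \<le> k + J")
        case True then show ?thesis using that m by (intro mx) auto
      next
        case False
        then have "2 ^ k' * v k' < 2 ^ k * v k" using k by (intro tail) auto
        then show ?thesis using km by linarith
      qed
      then have "m \<in> K" using m k by (auto simp: K_def)
      then show ?thesis using m km by auto
    qed
    then obtain m where m: "\<And>k. k \<ge> N \<Longrightarrow> m k \<ge> k \<and> m k \<in> K \<and> 2 ^ k * v k \<le> 2 ^ m k * v (m k)"
      by metis
    \<comment> \<open>Group the k by their maximiser p = m k \<ge> k. The 2 ^ k with k \<le> p sum
      to less than 2 * 2 ^ p, so a group costs at most 2 * (4 ^ p * v p). If the sums over K stayed
      below 1 / \<eta>, the whole series would converge.\<close>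
    have part: "(\<Sum>k\<in>{N..<N+n}. 4 ^ k * v k) \<le> 2 / \<eta>" for n
    proof -
      define M where "M = Max (insert 0 (m ` {N..<N+n}))"
      let ?T = "K \<inter> {..M}"
      have T: "m ` {N..<N+n} \<subseteq> ?T" using m by (auto simp: M_def)
      have "(\<Sum>k\<in>{N..<N+n}. 4 ^ k * v k) \<le> (\<Sum>k\<in>{N..<N+n}. 2 ^ k * (2 ^ m k * v (m k)))"
      proof (rule sum_mono)
        fix k assume "k \<in> {N..<N+n}"
        then have "2 ^ k * (2 ^ k * v k) \<le> 2 ^ k * (2 ^ m k * v (m k))" using m by (intro mult_left_mono) auto
        moreover have "(4::real) ^ k = 2 ^ k * 2 ^ k" by (simp add: power_mult_distrib[symmetric])
        ultimately show "4 ^ k * v k \<le> 2 ^ k * (2 ^ m k * v (m k))" by (simp add: mult.assoc)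
      qed
      also have "\<dots> = (\<Sum>p\<in>?T. \<Sum>k\<in>{k\<in>{N..<N+n}. m k = p}. 2 ^ k * (2 ^ m k * v (m k)))"
        by (rule sum.group[symmetric]) (use T in auto)
      also have "\<dots> \<le> (\<Sum>p\<in>?T. 2 * (4 ^ p * v p))"
      proof (rule sum_mono)
        fix p
        have "(\<Sum>k\<in>{k\<in>{N..<N+n}. m k = p}. 2 ^ k * (2 ^ m k * v (m k))) = (\<Sum>k\<in>{k\<in>{N..<N+n}. m k = p}. 2 ^ k) * (2 ^ p * v p)"
          by (simp add: sum_distrib_right)
        also have "\<dots> \<le> (\<Sum>k<Suc p. 2 ^ k) * (2 ^ p * v p)"
        proof (intro mult_right_mono sum_mono2)
          show "{k \<in> {N..<N + n}. m k = p} \<subseteq> {..<Suc p}" using m by force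
        qed (use v[of p] in auto)
        also have "(\<Sum>k<Suc p. 2 ^ k) * (2 ^ p * v p) \<le> (2 * 2 ^ p) * (2 ^ p * v p)"
        proof (rule mult_right_mono)
          have "(\<Sum>k<Suc p. (2::real) ^ k) = 2 ^ Suc p - 1" by (simp add: geometric_sum)
          then show "(\<Sum>k<Suc p. (2::real) ^ k) \<le> 2 * 2 ^ p" by simp
        qed (use v[of p] in auto)
        also have "\<dots> = 2 * (4 ^ p * v p)"
        proof -
          have "(4::real) ^ p = 2 ^ p * 2 ^ p" by (simp add: power_mult_distrib[symmetric])
          then show ?thesis by simp
        qed
        finally show "(\<Sum>k\<in>{k\<in>{N..<N+n}. m k = p}. 2 ^ k * (2 ^ m k * v (m k))) \<le> 2 * (4 ^ p * v p)" .
      qed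
      also have "\<dots> = 2 * s M / \<eta>" using \<eta> by (simp add: s_def sum_distrib_left[symmetric])
      also have "\<dots> \<le> 2 / \<eta>" using s1[of M] \<eta> by (intro divide_right_mono) auto
      finally show ?thesis .
    qed
    have "summable (\<lambda>k. 4 ^ (k + N) * v (k + N))"
    proof (rule summableI_nonneg_bounded)
      fix n show "(\<Sum>i<n. 4 ^ (i + N) * v (i + N)) \<le> 2 / \<eta>"
        using part[of n] sum.shift_bounds_nat_ivl[of "\<lambda>k. 4 ^ k * v k" 0 N n]
        by (simp add: add.commute atLeast0LessThan)
    qed (use v in \<open>auto intro: less_imp_le\<close>)
    then show False using ns by (simp only: summable_iff_shift[of "\<lambda>k. 4 ^ k * v k" N])
  qed
  \<comment> \<open>Stopping at the first partial sum that reaches 1 overshoots by at most one term,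
    and each term is at most 1.\<close>
  define n where "n = (LEAST n. s n \<ge> 1)"
  have n1: "s n \<ge> 1" unfolding n_def using \<open>\<exists>n. s n \<ge> 1\<close> by (rule LeastI_ex)
  have term_le: "\<eta> * (4 ^ k * v k) \<le> 1" if "k \<in> K" for k
    using bd[of k] that \<eta> by (simp add: K_def field_simps)
  have n2: "s n \<le> 2"
  proof (cases n)
    case 0
    have "s 0 \<le> (\<Sum>k\<in>K \<inter> {..0}. 1)" unfolding s_def by (intro sum_mono term_le) auto
    also have "\<dots> = real (card (K \<inter> {..0}))" by simp
    also have "\<dots> \<le> real (card {..0::nat})" by (intro of_nat_mono card_mono) auto
    finally show ?thesis using 0 by simp
  next
    case (Suc p)
    have "\<not> s p \<ge> 1" by (rule not_less_Least[of p "\<lambda>n. s n \<ge> 1", folded n_def]) (simp add: Suc)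
    moreover have "s n \<le> s p + 1"
    proof (cases "n \<in> K")
      case True
      have "K \<inter> {..n} = insert n (K \<inter> {..p})" using True by (auto simp: Suc le_Suc_eq)
      then have "s n = \<eta> * (4 ^ n * v n) + s p" by (simp add: s_def Suc)
      then show ?thesis using term_le[OF True] by simp
    next
      case False
      have "K \<inter> {..n} = K \<inter> {..p}" using False by (auto simp: Suc le_Suc_eq)
      then show ?thesis by (simp add: s_def)
    qed
    ultimately show ?thesis by simp
  qed
  show ?thesis
    using n1 n2 \<eta> unfolding s_def
    by (intro exI[of _ "K \<inter> {..n}"] exI[of _ \<eta>]) (auto simp: K_def)
qed

section \<open>Condensing the divergent series to dyadic blocks of denominators\<close>

context gauge_growth
begin

text \<open>(1/2) ^ n k is \<tau> k rounded down to a power of 1/2. The first entry of \<tau> fits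
  the strip width for all q of the block, since \<psi> decreases; the cap (1/4) ^ k makes squares
  fit into columns. Where the cap is attained, 4 ^ k * g (\<tau> k) \<ge> g 1 / C, so a convergent
  series would attain it only finitely often. The rest is Cauchy condensation up to constants.
  \<open>n\<close> is strictly increasing because \<tau> at least halves at every step.\<close>

lemma block_scales:
  fixes \<psi> :: "nat \<Rightarrow> real"
  assumes psi: "\<And>q. q \<ge> 1 \<Longrightarrow> \<psi> q > 0" and anti: "\<And>q q'. 1 \<le> q \<Longrightarrow> q \<le> q' \<Longrightarrow> \<psi> q' \<le> \<psi> q"
    and ns: "\<not> summable (\<lambda>q. real (Suc q) * g (\<psi> (Suc q) / real (Suc q)))"
  shows "\<exists>n::nat \<Rightarrow> nat. strict_mono n \<and> (\<forall>k. (1/2) ^ n k \<le> (1/4::real) ^ k) \<and>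
    (\<forall>k q. 2 ^ k \<le> q \<longrightarrow> q < 2 ^ (k + 1) \<longrightarrow> 2 ^ (k + 4) * (1/2) ^ n k \<le> \<psi> q) \<and>
    \<not> summable (\<lambda>k. 4 ^ k * g ((1/2) ^ n k))"
proof -
  define \<tau> where "\<tau> k = min (\<psi> (2 ^ (k + 1)) / 2 ^ (k + 4)) ((1/4) ^ k)" for k
  have \<tau>0: "0 < \<tau> k" "\<tau> k \<le> 1" for k using psi[of "2 ^ (k + 1)"]
    by (auto simp: \<tau>_def min_le_iff_disj power_le_one)
  have ex: "\<exists>n. (1/2) ^ n \<le> \<tau> k" for k
    using real_arch_pow_inv[OF \<tau>0(1), of "1/2" k] by (auto intro: less_imp_le)
  define n where "n k = (LEAST n. (1/2) ^ n \<le> \<tau> k)" for k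
  define h where "h k = (1/2::real) ^ n k" for k
  have h1: "h k \<le> \<tau> k" for k unfolding h_def n_def by (rule LeastI_ex[OF ex])
  have least: "n k \<le> p" if "(1/2) ^ p \<le> \<tau> k" for k p unfolding n_def using that by (rule Least_le)
  have h2: "\<tau> k / 2 \<le> h k" for k
  proof (cases "n k")
    case 0 then show ?thesis using \<tau>0[of k] by (simp add: h_def)
  next
    case (Suc p)
    then have "\<not> (1/2) ^ p \<le> \<tau> k" using least[of p k] by auto
    then show ?thesis using Suc by (simp add: h_def)
  qed
  have half: "\<tau> (Suc k) \<le> \<tau> k / 2" for k
  proof -
    have "\<psi> (2 ^ (Suc k + 1)) \<le> \<psi> (2 ^ (k + 1))" by (rule anti) auto
    then have "\<psi> (2 ^ (Suc k + 1)) / 2 ^ (Suc k + 4) \<le> \<psi> (2 ^ (k + 1)) / 2 ^ (Suc k + 4)" by (intro divide_right_mono) auto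
    also have "\<dots> = \<psi> (2 ^ (k + 1)) / 2 ^ (k + 4) / 2" by (simp add: power_add)
    finally have 1: "\<psi> (2 ^ (Suc k + 1)) / 2 ^ (Suc k + 4) \<le> \<psi> (2 ^ (k + 1)) / 2 ^ (k + 4) / 2" .
    have 2: "(1/4::real) ^ Suc k \<le> (1/4) ^ k / 2" by simp
    have "min a' b' \<le> min a b / 2" if "a' \<le> a / 2" "b' \<le> b / 2" for a a' b b' :: real
      using that by (auto simp: min_def)
    from this[OF 1 2] show ?thesis unfolding \<tau>_def .
  qed
  have sm: "strict_mono n"
  proof (rule strict_monoI_Suc)
    fix k
    have "\<tau> (Suc k) \<le> 1/2" using half[of k] \<tau>0[of k] by linarith
    then have "h (Suc k) < 1" using h1[of "Suc k"] by linarith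
    then have "n (Suc k) \<noteq> 0" unfolding h_def by (metis less_irrefl power_0)
    then obtain p where p: "n (Suc k) = Suc p" by (cases "n (Suc k)") auto
    have "(1/2) ^ p \<le> \<tau> k" using h1[of "Suc k"] half[of k] by (simp add: h_def p)
    then show "n k < n (Suc k)" using least[of p k] p by simp
  qed
  have width: "2 ^ (k + 4) * h k \<le> \<psi> q" if "2 ^ k \<le> q" "q < 2 ^ (k + 1)" for k q
  proof -
    have "h k \<le> \<psi> (2 ^ (k + 1)) / 2 ^ (k + 4)" using h1[of k] by (simp add: \<tau>_def)
    then have "2 ^ (k + 4) * h k \<le> \<psi> (2 ^ (k + 1))" by (simp add: field_simps)
    also have "\<dots> \<le> \<psi> q" using that order_trans[OF one_le_power[of "2::nat" k] that(1)] by (intro anti) auto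
    finally show ?thesis .
  qed
  have "\<not> summable (\<lambda>k. 4 ^ k * g (h k))"
  proof
    assume s1: "summable (\<lambda>k. 4 ^ k * g (h k))"
    have s2: "summable (\<lambda>k. 4 ^ k * g (\<tau> k))"
    proof (rule summable_comparison_test'[where N = 0])
      show "summable (\<lambda>k. 2 * C * (4 ^ k * g (h k)))" using s1 by (rule summable_mult)
      fix k
      have "g (\<tau> k) \<le> C * 2 * g (\<tau> k / 2)" using g_scale[of "\<tau> k / 2" 2] \<tau>0[of k] by simp
      also have "\<dots> \<le> C * 2 * g (h k)" using C_ge_1 h2 \<tau>0[of k] by (intro mult_left_mono g_mono) auto
      finally have "4 ^ k * g (\<tau> k) \<le> 4 ^ k * (C * 2 * g (h k))" by (intro mult_left_mono) auto
      then show "norm (4 ^ k * g (\<tau> k)) \<le> 2 * C * (4 ^ k * g (h k))"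
        using g_pos[OF \<tau>0(1), of k] by (simp add: mult_ac)
    qed
    define u where "u k = g (\<psi> (2 ^ (k + 1)) / 2 ^ (k + 1))" for k
    have s3: "summable (\<lambda>k. 4 ^ k * u k)"
    proof (rule summable_comparison_test_ev)
      show "summable (\<lambda>k. 8 * C * (4 ^ k * g (\<tau> k)))" using s2 by (rule summable_mult)
      have "\<forall>\<^sub>F k in sequentially. 4 ^ k * g (\<tau> k) < g 1 / C"
        using summable_LIMSEQ_zero[OF s2] g_pos[of 1] C_ge_1 by (intro order_tendstoD) auto
      then show "\<forall>\<^sub>F k in sequentially. norm (4 ^ k * u k) \<le> 8 * C * (4 ^ k * g (\<tau> k))"
      proof eventually_elim
        case (elim k)
        have "\<tau> k \<noteq> (1/4) ^ k"
        proof
          assume "\<tau> k = (1/4) ^ k"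
          moreover have "g (4 ^ k * (1/4) ^ k) \<le> C * 4 ^ k * g ((1/4) ^ k)" by (rule g_scale) auto
          ultimately have "g 1 \<le> C * (4 ^ k * g (\<tau> k))" by (simp add: power_mult_distrib[symmetric] mult.assoc)
          then show False using elim C_ge_1 by (simp add: field_simps)
        qed
        then have e: "\<tau> k = \<psi> (2 ^ (k + 1)) / 2 ^ (k + 4)" by (auto simp: \<tau>_def min_def split: if_splits)
        have "u k = g (8 * \<tau> k)" by (simp add: u_def e power_add)
        also have "\<dots> \<le> C * 8 * g (\<tau> k)" by (rule g_scale) (use \<tau>0 in auto)
        finally have "4 ^ k * u k \<le> 4 ^ k * (C * 8 * g (\<tau> k))" by (intro mult_left_mono) auto
        moreover have "0 \<le> u k" unfolding u_def using psi[of "2 ^ (k + 1)"] by (intro less_imp_le g_pos) auto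
        ultimately show ?case by (simp add: mult_ac)
      qed
    qed
    define T where "T q = real q * g (\<psi> q / real q)" for q
    have T0: "0 \<le> T q" if "q \<ge> 1" for q using psi[OF that] g_pos[of "\<psi> q / real q"] that by (simp add: T_def)
    have u0: "0 \<le> u k" for k unfolding u_def using psi[of "2 ^ (k + 1)"] by (intro less_imp_le g_pos) auto
    have blk: "(\<Sum>q\<in>{2 ^ (K + 1)..<2 ^ (K + 2)}. T q) \<le> 8 * (4 ^ K * u K)" for K
    proof -
      have "(\<Sum>q\<in>{2 ^ (K + 1)..<2 ^ (K + 2)}. T q) \<le> (\<Sum>q\<in>{2 ^ (K + 1)..<2 ^ (K + 2)::nat}. 2 ^ (K + 2) * u K)"
      proof (rule sum_mono)
        fix q :: nat assume q: "q \<in> {2 ^ (K + 1)..<2 ^ (K + 2)}"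
        have q1: "q \<ge> 1" using q order_trans[OF one_le_power[of "2::nat" "K + 1"]] by auto
        have r: "2 ^ (K + 1) \<le> real q" "real q \<le> 2 ^ (K + 2)"
          using q of_nat_mono[of "2 ^ (K + 1)" q, where 'a = real] of_nat_mono[of q "2 ^ (K + 2)", where 'a = real] by auto
        have "\<psi> q \<le> \<psi> (2 ^ (K + 1))" using q by (intro anti) auto
        then have "\<psi> q / real q \<le> \<psi> (2 ^ (K + 1)) / 2 ^ (K + 1)"
          using r psi[OF q1] by (intro frac_le) auto
        then have "g (\<psi> q / real q) \<le> u K" unfolding u_def using psi[OF q1] q1 by (intro g_mono) auto
        then show "T q \<le> 2 ^ (K + 2) * u K" unfolding T_def using r u0
          g_pos[of "\<psi> q / real q"] psi[OF q1] q1 by (intro mult_mono) auto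
      qed
      also have "\<dots> = 2 ^ (K + 1) * (2 ^ (K + 2) * u K)" by simp
      also have "\<dots> = 8 * (4 ^ K * u K)"
      proof -
        have "(4::real) ^ K = 2 ^ K * 2 ^ K" by (simp add: power_mult_distrib[symmetric])
        then show ?thesis by simp
      qed
      finally show ?thesis .
    qed
    have tot: "(\<Sum>q\<in>{2..<2 ^ (K + 1)}. T q) \<le> 8 * (\<Sum>k<K. 4 ^ k * u k)" for K
    proof (induction K)
      case (Suc K)
      have "{2..<2 ^ (Suc K + 1)} = {2..<2 ^ (K + 1)} \<union> {2 ^ (K + 1)..<(2::nat) ^ (K + 2)}"
        using ivl_disj_un_two(3)[of 2 "(2::nat) ^ (K + 1)" "2 ^ (K + 2)"] by simp
      then have "(\<Sum>q\<in>{2..<2 ^ (Suc K + 1)}. T q) = (\<Sum>q\<in>{2..<2 ^ (K + 1)}. T q) + (\<Sum>q\<in>{2 ^ (K + 1)..<2 ^ (K + 2)}. T q)"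
        by (simp only:) (rule sum.union_disjoint, auto)
      then show ?case using Suc blk[of K] by (simp add: distrib_left)
    qed simp
    have "summable (\<lambda>q. T (Suc q))"
    proof (rule summableI_nonneg_bounded)
      fix N
      have "(\<Sum>q<N. T (Suc q)) = (\<Sum>q\<in>Suc ` {..<N}. T q)" by (simp add: sum.reindex)
      also have "\<dots> \<le> (\<Sum>q\<in>insert 1 {2..<2 ^ (N + 1)}. T q)"
      proof (rule sum_mono2)
        have "Suc N < 2 ^ (N + 1)" by (rule less_le_trans[OF less_exp]) simp
        then show "Suc ` {..<N} \<subseteq> insert 1 {2..<2 ^ (N + 1)}" by auto
      qed (use T0 in auto)
      also have "\<dots> \<le> T 1 + 8 * (\<Sum>k<N. 4 ^ k * u k)" using tot[of N] by simp
      also have "\<dots> \<le> T 1 + 8 * (\<Sum>k. 4 ^ k * u k)"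
        using u0 by (intro add_left_mono mult_left_mono sum_le_suminf s3) auto
      finally show "(\<Sum>q<N. T (Suc q)) \<le> T 1 + 8 * (\<Sum>k. 4 ^ k * u k)" .
    qed (use T0 in auto)
    then show False using ns by (simp add: T_def)
  qed
  moreover have "h k \<le> (1/4) ^ k" for k using h1[of k] by (simp add: \<tau>_def)
  ultimately show ?thesis using sm width unfolding h_def by blast
qed

end

section \<open>Ubiquity of shifted fractions\<close>

lemma card_int_interval_le:
  fixes C :: "int set"
  assumes C: "\<And>c. c \<in> C \<Longrightarrow> u \<le> of_int c \<and> of_int c \<le> v" and uv: "u \<le> v + 1"
  shows "real (card C) \<le> v - u + (1::real)"
proof -
  have "C \<subseteq> {\<lceil>u\<rceil>..\<lfloor>v\<rfloor>}" using C by (auto simp: ceiling_le_iff le_floor_iff)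
  then have "card C \<le> card {\<lceil>u\<rceil>..\<lfloor>v\<rfloor>}" by (intro card_mono) auto
  then have "real (card C) \<le> real (nat (\<lfloor>v\<rfloor> - \<lceil>u\<rceil> + 1))" by simp
  also have "\<dots> \<le> v - u + 1"
  proof (cases "\<lfloor>v\<rfloor> - \<lceil>u\<rceil> + 1 \<ge> 0")
    case True
    then have "real (nat (\<lfloor>v\<rfloor> - \<lceil>u\<rceil> + 1)) = of_int \<lfloor>v\<rfloor> - of_int \<lceil>u\<rceil> + 1" by simp
    then show ?thesis using of_int_floor_le[of v] le_of_int_ceiling[of u] by linarith
  qed (use uv in simp)
  finally show ?thesis .
qed

lemma card_nat_interval_le:
  fixes C :: "nat set"
  assumes C: "\<And>c. c \<in> C \<Longrightarrow> u \<le> real c \<and> real c \<le> v" and uv: "u \<le> v + 1"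
  shows "real (card C) \<le> v - u + (1::real)"
proof -
  have "card (int ` C) = card C" by (simp add: card_image)
  moreover have "real (card (int ` C)) \<le> v - u + 1" using C uv by (intro card_int_interval_le) auto
  ultimately show ?thesis by simp
qed

lemma sum_inverse_le: "(\<Sum>n\<in>{1..<2 ^ m}. 1 / real n) \<le> real m"
proof (induction m)
  case (Suc m)
  have "{1..<2 ^ Suc m} = {1..<2 ^ m} \<union> {2 ^ m..<(2::nat) ^ Suc m}"
    using ivl_disj_un_two(3)[of 1 "(2::nat) ^ m" "2 ^ Suc m"] by simp
  then have "(\<Sum>n\<in>{1..<2 ^ Suc m}. 1 / real n) = (\<Sum>n\<in>{1..<2 ^ m}. 1 / real n) + (\<Sum>n\<in>{2 ^ m..<2 ^ Suc m}. 1 / real n)"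
    by (simp only:) (rule sum.union_disjoint, auto)
  also have "(\<Sum>n\<in>{2 ^ m..<2 ^ Suc m}. 1 / real n) \<le> (\<Sum>n\<in>{2 ^ m..<2 ^ Suc m::nat}. 1 / 2 ^ m)"
  proof (rule sum_mono)
    fix n :: nat assume "n \<in> {2 ^ m..<2 ^ Suc m}"
    then have "2 ^ m \<le> real n" using of_nat_mono[of "2 ^ m" n, where 'a = real] by simp
    then show "1 / real n \<le> 1 / 2 ^ m" by (intro frac_le) auto
  qed
  also have "\<dots> = 1" by simp
  finally show ?case using Suc by simp
qed simp

text \<open>A column is an interval of length \<open>1024 / 4 ^ k\<close>; it is good if for every \<open>\<theta>\<close> its middle half
  contains a shifted fraction \<open>(p + \<theta>) / q\<close> whose denominator lies in the \<open>k\<close>-th dyadic block.\<close>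

definition good_column :: "nat \<Rightarrow> nat \<Rightarrow> bool" where
  "good_column k c \<longleftrightarrow> (\<forall>\<theta>::real. \<exists>(q::nat) (p::int). 2 ^ k \<le> q \<and> q < 2 ^ (k + 1) \<and>
     \<bar>(of_int p + \<theta>) / real q - (real c + 1/2) * (1024 / 4 ^ k)\<bar> \<le> 256 / 4 ^ k)"

text \<open>Uniformity in \<theta> comes from a congruence. Let r = \<lfloor>n * \<theta>\<rfloor>
  and let u invert a modulo n. Among the n integers from 2 ^ k on, one is congruent to u * r, and
  for this q the product q * a is r modulo n. Then n * (q * x - \<theta> - p) is the sum of q * (n *
  x - a), at most 2 in absolute value as q \<le> 2 * 2 ^ k, and of r - n * \<theta>, at most
  1.\<close>

lemma shifted_fraction_near:
  fixes x \<theta> :: real and a n :: int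
  assumes cop: "coprime a n" and n: "0 < n" "n \<le> 2 ^ k" and ap: "\<bar>of_int n * x - of_int a\<bar> < 1 / 2 ^ k"
  shows "\<exists>(q::nat) (p::int). 2 ^ k \<le> q \<and> q < 2 ^ (k + 1) \<and> \<bar>(of_int p + \<theta>) / real q - x\<bar> \<le> 3 / (of_int n * 2 ^ k)"
proof -
  define r where "r = \<lfloor>of_int n * \<theta>\<rfloor>"
  obtain u v where uv: "u * a + v * n = 1" using bezout_int[of a n] cop by auto
  define Q where "Q = 2 ^ k + ((u * r - 2 ^ k) mod n)"
  have Q: "2 ^ k \<le> Q" "Q < 2 ^ k + n" using n by (auto simp: Q_def)
  have "n dvd Q - u * r"
  proof -
    have "Q - u * r = (u * r - 2 ^ k) mod n - (u * r - 2 ^ k)" by (simp add: Q_def)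
    then show ?thesis by (metis dvd_minus_mod dvd_minus_iff minus_diff_eq)
  qed
  then obtain w where w: "Q - u * r = n * w" by blast
  define p where "p = w * a - v * r"
  have "Q * a - r = n * p"
  proof -
    have "Q * a - r = (Q - u * r) * a + u * a * r - r" by (simp add: algebra_simps)
    also have "u * a = 1 - v * n" using uv by simp
    finally show ?thesis unfolding w by (simp add: p_def algebra_simps)
  qed
  then have Qa: "of_int Q * of_int a = of_int n * of_int p + (of_int r :: real)"
    by (metis add.commute diff_add_cancel of_int_add of_int_mult)
  define q where "q = nat Q"
  have "Q > 0" using Q(1) zero_less_power[of "2::int" k] by linarith
  then have qQ: "real q = of_int Q" by (simp add: q_def)
  have "int (2 ^ k) \<le> int q" "int q < int (2 ^ (k + 1))" using Q n \<open>Q > 0\<close> by (auto simp: q_def)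
  then have q: "2 ^ k \<le> q" "q < 2 ^ (k + 1)" by (simp_all only: of_nat_le_iff of_nat_less_iff)
  then have rq: "2 ^ k \<le> real q" "real q \<le> 2 * 2 ^ k"
    using of_nat_mono[of "2 ^ k" q, where 'a = real] of_nat_mono[of q "2 ^ (k + 1)", where 'a = real] by auto
  have n0: "(0::real) < of_int n" using n by simp
  have "\<bar>of_int n * (real q * x - \<theta> - of_int p)\<bar> \<le> 3"
  proof -
    have "of_int n * (real q * x - \<theta> - of_int p) = real q * (of_int n * x - of_int a) + (real q * of_int a - of_int n * of_int p - of_int n * \<theta>)"
      by (simp add: algebra_simps)
    also have "real q * of_int a - of_int n * of_int p - of_int n * \<theta> = of_int r - of_int n * \<theta>"
      using Qa qQ by simp
    finally have e: "of_int n * (real q * x - \<theta> - of_int p) = real q * (of_int n * x - of_int a) + (of_int r - of_int n * \<theta>)" .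
    have "\<bar>real q * (of_int n * x - of_int a)\<bar> = real q * \<bar>of_int n * x - of_int a\<bar>" by (simp add: abs_mult)
    also have "\<dots> \<le> (2 * 2 ^ k) * (1 / 2 ^ k)" using rq ap by (intro mult_mono) auto
    finally have "\<bar>real q * (of_int n * x - of_int a)\<bar> \<le> 2" by simp
    moreover have "\<bar>of_int r - of_int n * \<theta>\<bar> \<le> 1" unfolding r_def by linarith
    ultimately show ?thesis unfolding e by linarith
  qed
  then have "of_int n * \<bar>real q * x - \<theta> - of_int p\<bar> \<le> 3" using n0 by (simp add: abs_mult)
  then have b: "\<bar>real q * x - \<theta> - of_int p\<bar> \<le> 3 / of_int n" using n0 by (simp add: field_simps)
  have "(0::real) < 2 ^ k" by simp
  then have q0: "0 < real q" using rq(1) by linarith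
  have "(of_int p + \<theta>) / real q - x = - (real q * x - \<theta> - of_int p) / real q"
    using q0 by (simp add: field_simps)
  then have "\<bar>(of_int p + \<theta>) / real q - x\<bar> = \<bar>real q * x - \<theta> - of_int p\<bar> / real q" using q0 by simp
  also have "\<dots> \<le> (3 / of_int n) / 2 ^ k" using b rq n by (intro frac_le) auto
  finally show ?thesis using q by (intro exI[of _ q] exI[of _ p]) simp
qed

text \<open>For n \<ge> 2 ^ k / 64 the error 3 / (n * 2 ^ k) is at most 192 / 4 ^ k, below a quarter
  of the column width 1024 / 4 ^ k.\<close>

lemma good_columnI:
  assumes cop: "coprime a n" and n: "0 < n" "n \<le> 2 ^ k" "2 ^ k \<le> 64 * n"
    and ap: "\<bar>of_int n * ((real c + 1/2) * (1024 / 4 ^ k)) - of_int a\<bar> < 1 / 2 ^ k"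
  shows "good_column k c"
  unfolding good_column_def
proof
  fix \<theta> :: real
  have "(2::real) ^ k \<le> 64 * of_int n" using n(3) by (metis of_int_le_iff of_int_mult of_int_numeral of_int_power)
  then have "(3::real) / (of_int n * 2 ^ k) \<le> 192 / (2 ^ k * 2 ^ k)" using n(1) by (simp add: field_simps)
  also have "\<dots> \<le> 256 / 4 ^ k" by (simp add: power_mult_distrib[symmetric] divide_right_mono)
  finally have 1: "(3::real) / (of_int n * 2 ^ k) \<le> 256 / 4 ^ k" .
  from shifted_fraction_near[OF cop n(1,2) ap, of \<theta>] obtain q :: nat and p :: int
    where qp: "2 ^ k \<le> q" "q < 2 ^ (k + 1)"
      "\<bar>(of_int p + \<theta>) / real q - (real c + 1/2) * (1024 / 4 ^ k)\<bar> \<le> 3 / (of_int n * 2 ^ k)"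
    by blast
  show "\<exists>(q::nat) (p::int). 2 ^ k \<le> q \<and> q < 2 ^ (k + 1) \<and>
     \<bar>(of_int p + \<theta>) / real q - (real c + 1/2) * (1024 / 4 ^ k)\<bar> \<le> 256 / 4 ^ k"
    using qp order_trans[OF qp(3) 1] by blast
qed

text \<open>The midpoint of a bad column has a Dirichlet denominator n below H = 2 ^ k / 64. For
  each such n there are at most n * \<delta> + 3 numerators, and around each fraction at most 2 * 2
  ^ k / (1024 * n) + 1 columns. Multiplying out and summing over n < H gives the four terms; the
  harmonic sum produces the factor k.\<close>

lemma card_bad_columns_le:
  fixes \<alpha> \<delta> :: real
  assumes k: "k \<ge> 6" and \<delta>: "0 < \<delta>" "\<delta> \<le> 1" and D: "finite D"
    and Dx: "\<And>c. c \<in> D \<Longrightarrow> \<alpha> \<le> (real c + 1/2) * (1024 / 4 ^ k) \<and> (real c + 1/2) * (1024 / 4 ^ k) \<le> \<alpha> + \<delta>"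
  shows "real (card {c \<in> D. \<not> good_column k c}) \<le> \<delta> * 4 ^ k / 32768 + \<delta> * 4 ^ k / 4096 + 6 * real k * 2 ^ k / 1024 + 3 * 2 ^ k / 64"
proof -
  define N where "N = (2::real) ^ k"
  define s where "s = 1024 / N\<^sup>2"
  have N: "N > 0" "N \<ge> 1" by (auto simp: N_def)
  have N2: "N\<^sup>2 = 4 ^ k" by (simp add: N_def power2_eq_square power_mult_distrib[symmetric])
  have s: "s > 0" using N by (simp add: s_def)
  define H where "H = (2::nat) ^ (k - 6)"
  have H: "real H = N / 64" "64 * H = 2 ^ k"
    using k power_add[of "2::real" "k - 6" 6] power_add[of "2::nat" "k - 6" 6] by (auto simp: H_def N_def)
  define x where "x c = (real c + 1/2) * s" for c
  define M where "M n a = {c \<in> D. \<bar>real n * x c - of_int a\<bar> \<le> 1 / N}" for n :: nat and a :: int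
  define I where "I n = {\<lceil>real n * \<alpha> - 1\<rceil>..\<lfloor>real n * \<alpha> + real n * \<delta> + 1\<rfloor>}" for n :: nat
  have sub: "{c \<in> D. \<not> good_column k c} \<subseteq> (\<Union>n\<in>{1..<H}. \<Union>a\<in>I n. M n a)"
  proof
    fix c assume "c \<in> {c \<in> D. \<not> good_column k c}"
    then have c: "c \<in> D" "\<not> good_column k c" by auto
    obtain a n where an: "coprime a n" "0 < n" "n \<le> int (2 ^ k)" "\<bar>of_int n * x c - of_int a\<bar> < 1 / real (2 ^ k)"
      by (rule Dirichlet_approx_coprime[of "2 ^ k" "x c"]) auto
    have an4: "\<bar>of_int n * x c - of_int a\<bar> < 1 / N" using an(4) by (simp add: N_def)
    have xc: "x c = (real c + 1/2) * (1024 / 4 ^ k)" by (simp add: x_def s_def N2)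
    have "\<not> 2 ^ k \<le> 64 * n"
    proof
      assume "2 ^ k \<le> 64 * n"
      then have "good_column k c"
        using an an4 unfolding xc N_def by (intro good_columnI[of a n]) auto
      with c show False by simp
    qed
    then have "64 * n < int (64 * H)" unfolding H(2) by simp
    then have nH: "nat n < H" "nat n \<ge> 1" using an(2) by auto
    have nn: "real (nat n) = of_int n" using an(2) by simp
    have xa: "\<alpha> \<le> x c" "x c \<le> \<alpha> + \<delta>" using Dx[OF c(1)] by (auto simp: xc)
    have "real (nat n) * \<alpha> \<le> real (nat n) * x c" "real (nat n) * x c \<le> real (nat n) * (\<alpha> + \<delta>)"
      using xa by (auto intro!: mult_left_mono)
    moreover have "1 / N \<le> 1" using N by simp
    ultimately have "real (nat n) * \<alpha> - 1 \<le> of_int a" "of_int a \<le> real (nat n) * \<alpha> + real (nat n) * \<delta> + 1"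
      using an4 unfolding nn distrib_left by linarith+
    then have "a \<in> I (nat n)" unfolding I_def atLeastAtMost_iff ceiling_le_iff le_floor_iff by simp
    moreover have "c \<in> M (nat n) a" using c an4 nn by (simp add: M_def)
    ultimately show "c \<in> (\<Union>n\<in>{1..<H}. \<Union>a\<in>I n. M n a)" using nH by auto
  qed
  have Mc: "real (card (M n a)) \<le> 2 / (real n * (N * s)) + 1" if n: "n \<ge> 1" for n a
  proof -
    have n0: "real n > 0" using n by simp
    define y where "y = of_int a / (real n * s) - 1/2"
    define z where "z = 1 / (real n * (N * s))"
    have z: "z > 0" using n0 N s by (simp add: z_def)
    have "real (card (M n a)) \<le> (y + z) - (y - z) + 1"
    proof (rule card_nat_interval_le)
      fix c assume "c \<in> M n a"
      then have "\<bar>real n * x c - of_int a\<bar> \<le> 1 / N" by (simp add: M_def)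
      moreover have "real n * x c - of_int a = (real n * s) * (real c - y)"
        using n0 s by (simp add: x_def y_def field_simps)
      ultimately have "(real n * s) * \<bar>real c - y\<bar> \<le> 1 / N" using n0 s by (simp add: abs_mult)
      then have "\<bar>real c - y\<bar> \<le> z" using n0 s N by (simp add: z_def field_simps)
      then show "y - z \<le> real c \<and> real c \<le> y + z" by linarith
    qed (use z in simp)
    then show ?thesis by (simp add: z_def mult_ac)
  qed
  have Ic: "real (card (I n)) \<le> real n * \<delta> + 3" for n
  proof -
    have "real (card (I n)) \<le> (real n * \<alpha> + real n * \<delta> + 1) - (real n * \<alpha> - 1) + 1"
    proof (rule card_int_interval_le)
      fix c assume "c \<in> I n"
      then show "real n * \<alpha> - 1 \<le> of_int c \<and> of_int c \<le> real n * \<alpha> + real n * \<delta> + 1"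
        unfolding I_def atLeastAtMost_iff ceiling_le_iff le_floor_iff .
    qed (use \<delta> in simp)
    then show ?thesis by simp
  qed
  have Ns: "1 / (N * s) = N / 1024" using N by (simp add: s_def power2_eq_square)
  have "card {c \<in> D. \<not> good_column k c} \<le> card (\<Union>n\<in>{1..<H}. \<Union>a\<in>I n. M n a)"
    using D by (intro card_mono[OF _ sub]) (auto simp: M_def I_def)
  also have "\<dots> \<le> (\<Sum>n\<in>{1..<H}. card (\<Union>a\<in>I n. M n a))" by (rule card_UN_le) simp
  also have "\<dots> \<le> (\<Sum>n\<in>{1..<H}. \<Sum>a\<in>I n. card (M n a))" by (intro sum_mono card_UN_le) (simp add: I_def)
  finally have "real (card {c \<in> D. \<not> good_column k c}) \<le> real (\<Sum>n\<in>{1..<H}. \<Sum>a\<in>I n. card (M n a))"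
    by (rule of_nat_mono)
  also have "\<dots> = (\<Sum>n\<in>{1..<H}. \<Sum>a\<in>I n. real (card (M n a)))" by simp
  also have "\<dots> \<le> (\<Sum>n\<in>{1..<H}. \<Sum>a\<in>I n. 2 / (real n * (N * s)) + 1)" by (intro sum_mono Mc) auto
  also have "\<dots> = (\<Sum>n\<in>{1..<H}. real (card (I n)) * (2 / (real n * (N * s)) + 1))" by simp
  also have "\<dots> \<le> (\<Sum>n\<in>{1..<H}. (real n * \<delta> + 3) * (2 / (real n * (N * s)) + 1))"
    using N s by (intro sum_mono mult_right_mono Ic) (auto intro!: add_nonneg_nonneg)
  also have "\<dots> \<le> (\<Sum>n\<in>{1..<H}. \<delta> * N / 512 + real H * \<delta> + 6 * N / 1024 * (1 / real n) + 3)"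
  proof (rule sum_mono)
    fix n assume n: "n \<in> {1..<H}"
    then have n0: "real n > 0" "real n \<le> real H" by auto
    have "2 / (real n * (N * s)) = (2 / real n) * (1 / (N * s))" by simp
    also have "\<dots> = (2 * N / 1024) / real n" unfolding Ns by simp
    finally have e2: "2 / (real n * (N * s)) = (2 * N / 1024) / real n" .
    have "(real n * \<delta> + 3) * (2 / (real n * (N * s)) + 1) = \<delta> * N / 512 + real n * \<delta> + 6 * N / 1024 * (1 / real n) + 3"
      unfolding e2 using n0(1) by (simp add: field_simps)
    moreover have "real n * \<delta> \<le> real H * \<delta>" using n0 \<delta> by (intro mult_right_mono) auto
    ultimately show "(real n * \<delta> + 3) * (2 / (real n * (N * s)) + 1) \<le> \<delta> * N / 512 + real H * \<delta> + 6 * N / 1024 * (1 / real n) + 3"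
      by linarith
  qed
  also have "\<dots> = real (card {1..<H}) * (\<delta> * N / 512 + real H * \<delta> + 3) + 6 * N / 1024 * (\<Sum>n\<in>{1..<H}. 1 / real n)"
    by (simp add: sum.distrib sum_distrib_left algebra_simps)
  also have "\<dots> \<le> real H * (\<delta> * N / 512 + real H * \<delta> + 3) + 6 * N / 1024 * real k"
  proof (intro add_mono mult_mono order_refl)
    have "(\<Sum>n\<in>{1..<H}. 1 / real n) \<le> real (k - 6)" unfolding H_def by (rule sum_inverse_le)
    then show "(\<Sum>n\<in>{1..<H}. 1 / real n) \<le> real k" by linarith
  qed (use \<delta> N in \<open>auto intro!: sum_nonneg add_nonneg_nonneg\<close>)
  also have "\<dots> = \<delta> * 4 ^ k / 32768 + \<delta> * 4 ^ k / 4096 + 6 * real k * 2 ^ k / 1024 + 3 * 2 ^ k / 64"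
    unfolding N2[symmetric] N_def[symmetric] H(1) by (simp add: field_simps power2_eq_square)
  finally show ?thesis .
qed

text \<open>An interval of length \<delta> = (1/2) ^ l holds \<delta> * 4 ^ k / 1024 columns, so
  \<delta> * 4 ^ k / 2048 bad ones are tolerable. The two leading terms of
  \<open>card_bad_columns_le\<close> use 9 / 32768 of \<delta> * 4 ^ k out of 16 / 32768; the
  remaining 7 / 32768 absorbs the lower order terms for large k.\<close>

lemma eventually_half_columns_good:
  "\<forall>\<^sub>F k in sequentially. 2 * k \<ge> 10 + l \<and> (\<forall>J. 2 ^ (2 * k - 10 - l) \<le>
      2 * card {c \<in> {J * 2 ^ (2 * k - 10 - l)..<(J + 1) * 2 ^ (2 * k - 10 - l)}. good_column k c})"
proof -
  have lim: "(\<lambda>k. 6 / 1024 * (real k / 2 ^ k) + 3 / 64 * (1/2) ^ k) \<longlonglongrightarrow> 6 / 1024 * 0 + 3 / 64 * 0"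
    using lim_n_over_pown[of "2::real"] by (intro tendsto_intros LIMSEQ_realpow_zero) auto
  have "\<forall>\<^sub>F k in sequentially. 6 / 1024 * (real k / 2 ^ k) + 3 / 64 * (1/2) ^ k < (1/2) ^ l * 7 / 32768"
    by (rule order_tendstoD(2)[OF lim]) simp
  then show ?thesis using eventually_ge_at_top[of "6 + l"] 
  proof eventually_elim
    case (elim k)
    define e where "e = 2 * k - 10 - l"
    have ke: "2 * k = e + 10 + l" using elim by (simp add: e_def)
    define \<delta> where "\<delta> = (1/2::real) ^ l"
    have \<delta>: "0 < \<delta>" "\<delta> \<le> 1" by (auto simp: \<delta>_def power_le_one)
    have 4: "(4::real) ^ k = 2 ^ e * 1024 * 2 ^ l"
    proof -
      have "(4::real) ^ k = 2 ^ (2 * k)" by (simp add: power_mult)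
      then show ?thesis unfolding ke by (simp add: power_add)
    qed
    have s: "2 ^ e * (1024 / 4 ^ k) = \<delta>" unfolding 4 by (simp add: \<delta>_def power_one_over)
    have "2 ^ e \<le> 2 * card {c \<in> {J * 2 ^ e..<(J + 1) * 2 ^ e}. good_column k c}" for J
    proof -
      let ?D = "{J * 2 ^ e..<(J + 1) * 2 ^ e}"
      have "real (card {c \<in> ?D. \<not> good_column k c}) \<le> \<delta> * 4 ^ k / 32768 + \<delta> * 4 ^ k / 4096 + 6 * real k * 2 ^ k / 1024 + 3 * 2 ^ k / 64"
      proof (rule card_bad_columns_le[OF _ \<delta>])
        show "k \<ge> 6" using elim by simp
        fix c assume c: "c \<in> ?D"
        then have "real (J * 2 ^ e) \<le> real c" "real (Suc c) \<le> real ((J + 1) * 2 ^ e)"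
          by (auto simp only: of_nat_le_iff atLeastLessThan_iff Suc_le_eq)
        then have "real J * 2 ^ e \<le> real c + 1/2" "real c + 1/2 \<le> (real J + 1) * 2 ^ e" by (auto simp: algebra_simps)
        then have "real J * 2 ^ e * (1024 / 4 ^ k) \<le> (real c + 1/2) * (1024 / 4 ^ k)"
            "(real c + 1/2) * (1024 / 4 ^ k) \<le> (real J + 1) * 2 ^ e * (1024 / 4 ^ k)"
          by - (rule mult_right_mono, assumption, simp)+
        then show "real J * \<delta> \<le> (real c + 1/2) * (1024 / 4 ^ k) \<and> (real c + 1/2) * (1024 / 4 ^ k) \<le> real J * \<delta> + \<delta>"
          using s by (simp only: mult.assoc) (simp add: algebra_simps)
      qed simp
      also have "\<dots> \<le> \<delta> * 4 ^ k / 2048"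
      proof -
        have "6 * real k * 2 ^ k / 1024 + 3 * 2 ^ k / 64 = 4 ^ k * (6 / 1024 * (real k / 2 ^ k) + 3 / 64 * (1/2) ^ k)"
        proof -
          have "(4::real) ^ k = 2 ^ k * 2 ^ k" by (simp add: power_mult_distrib[symmetric])
          then show ?thesis by (simp add: field_simps power_one_over)
        qed
        also have "\<dots> \<le> 4 ^ k * (\<delta> * 7 / 32768)" using elim unfolding \<delta>_def by (intro mult_left_mono) auto
        finally show ?thesis by (simp add: field_simps)
      qed
      also have "\<dots> = 2 ^ e / 2" unfolding 4 by (simp add: \<delta>_def power_one_over)
      finally have bad: "2 * real (card {c \<in> ?D. \<not> good_column k c}) \<le> 2 ^ e" by simp
      have "card {c \<in> ?D. good_column k c} + card {c \<in> ?D. \<not> good_column k c} = card ({c \<in> ?D. good_column k c} \<union> {c \<in> ?D. \<not> good_column k c})"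
        by (rule card_Un_disjoint[symmetric]) auto
      also have "{c \<in> ?D. good_column k c} \<union> {c \<in> ?D. \<not> good_column k c} = ?D" by auto
      also have "card ?D = 2 ^ e" by (simp add: algebra_simps)
      finally have "real (card {c \<in> ?D. good_column k c} + card {c \<in> ?D. \<not> good_column k c}) = real (2 ^ e)"
        by (rule arg_cong)
      then have "real (card {c \<in> ?D. good_column k c}) + real (card {c \<in> ?D. \<not> good_column k c}) = 2 ^ e"
        unfolding of_nat_add of_nat_power by simp
      with bad have "2 ^ e \<le> 2 * real (card {c \<in> ?D. good_column k c})" by linarith
      then have "real (2 ^ e) \<le> real (2 * card {c \<in> ?D. good_column k c})" by simp
      then show ?thesis by (simp only: of_nat_le_iff)
    qed
    then show ?case using elim by (auto simp: e_def)
  qed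
qed

section \<open>Measures carried by thin strips\<close>

text \<open>Half-open, so that the squares of one level are disjoint and each is the exact union of
  its descendants.\<close>

definition sq :: "nat \<Rightarrow> nat \<Rightarrow> nat \<Rightarrow> (real \<times> real) set" where
  "sq l i j = {real i * (1/2) ^ l..<(real i + 1) * (1/2) ^ l} \<times> {real j * (1/2) ^ l..<(real j + 1) * (1/2) ^ l}"

lemma measure_lborel_Times:
  fixes A B :: "real set"
  assumes "A \<in> sets borel" "B \<in> sets borel"
  shows "measure lborel (A \<times> B) = measure lborel A * measure lborel B"
proof -
  have "emeasure lborel (A \<times> B) = emeasure (lborel \<Otimes>\<^sub>M lborel) (A \<times> B)" by (simp add: lborel_prod)
  also have "\<dots> = emeasure lborel A * emeasure lborel B"
    using assms by (intro lborel.emeasure_pair_measure_Times) auto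
  finally show ?thesis by (simp add: measure_def enn2real_mult)
qed

lemma emeasure_lborel_bounded_finite:
  fixes A :: "(real \<times> real) set"
  assumes "bounded A"
  shows "emeasure lborel A < \<infinity>"
proof -
  obtain a b where "A \<subseteq> cbox a b" using bounded_subset_cbox_symmetric[OF assms] by blast
  then have "emeasure lborel A \<le> emeasure lborel (cbox a b)" by (intro emeasure_mono) auto
  then show ?thesis using emeasure_lborel_cbox_finite[of a b] by (rule le_less_trans)
qed

lemma measure_lborel_Ico_Int_le:
  fixes a h u r :: real
  assumes "0 \<le> h" "0 \<le> r"
  shows "measure lborel ({a..<a + h} \<inter> {u..u + r}) \<le> min h r"
proof -
  have "measure lborel ({a..<a + h} \<inter> {u..u + r}) \<le> measure lborel {a..<a + h}"
    using assms by (intro measure_mono_fmeasurable) (auto intro!: fmeasurableI)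
  moreover have "measure lborel ({a..<a + h} \<inter> {u..u + r}) \<le> measure lborel {u..u + r}"
    using assms by (intro measure_mono_fmeasurable) (auto intro!: fmeasurableI)
  ultimately show ?thesis using assms by simp
qed

text \<open>Each pair of a row of height \<open>h\<close> and a good column of width \<open>s\<close> receives a single square of side \<open>h\<close>. This alone makes
  the squares sparse enough for the upper bound at every scale, whichever strip they come from.\<close>

locale dyadic_block =
  fixes n m :: nat and Gd :: "nat set" and X :: "nat \<Rightarrow> nat \<Rightarrow> real" and h s :: real
  assumes h: "h = (1/2) ^ n" and s: "s = (1/2) ^ m" and Gd: "Gd \<subseteq> {..<2 ^ m}"
    and X: "i < 2 ^ n \<Longrightarrow> c \<in> Gd \<Longrightarrow> real c * s \<le> X i c \<and> X i c + h \<le> (real c + 1) * s"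
begin

definition cell :: "nat \<Rightarrow> nat \<Rightarrow> (real \<times> real) set" where
  "cell i c = {real i * h..<real i * h + h} \<times> {X i c..<X i c + h}"

definition cells :: "(real \<times> real) set" where
  "cells = (\<Union>(i, c)\<in>{..<2 ^ n} \<times> Gd. cell i c)"

lemma hs_pos: "0 < h" "0 < s" by (auto simp: h s)

lemma finite_Gd: "finite Gd" using Gd finite_subset by blast

lemma cell_borel: "cell i c \<in> sets borel"
  unfolding cell_def by (intro borel_Times) auto

lemma bounded_cell: "bounded (cell i c)"
  unfolding cell_def by (intro bounded_Times) auto

lemma cells_borel: "cells \<in> sets borel"
  unfolding cells_def using finite_Gd by (intro sets.finite_UN) (auto simp: cell_borel)

lemma bounded_cells: "bounded cells"
  unfolding cells_def using finite_Gd by (intro bounded_UN) (auto simp: bounded_cell)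

lemma measure_cell: "measure lborel (cell i c) = h\<^sup>2"
  using hs_pos unfolding cell_def by (subst measure_lborel_Times) (auto simp: power2_eq_square)

text \<open>The square holds 2 ^ (n - l) rows and at least 2 ^ (m - l) / 2 good columns. The
  corresponding cells lie inside it, have area h squared, and are disjoint because their rows or
  their columns are.\<close>

lemma cells_lower:
  assumes l: "l \<le> m" "l \<le> n" and I: "I < 2 ^ l"
    and J: "2 ^ (m - l) \<le> 2 * card {c \<in> Gd. c \<in> {J * 2 ^ (m - l)..<(J + 1) * 2 ^ (m - l)}}"
  shows "(1/4) ^ l * h / (2 * s) \<le> measure lborel (cells \<inter> sq l I J)"
proof -
  define Ri where "Ri = {I * 2 ^ (n - l)..<(I + 1) * 2 ^ (n - l)}"
  define Rc where "Rc = {c \<in> Gd. c \<in> {J * 2 ^ (m - l)..<(J + 1) * 2 ^ (m - l)}}"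
  have fin: "finite Ri" "finite Rc" using finite_Gd by (auto simp: Ri_def Rc_def)
  have hl: "2 ^ (n - l) * h = (1/2) ^ l"
  proof -
    have "(1/2::real) ^ n = (1/2) ^ (n - l) * (1/2) ^ l" using l by (simp add: power_add[symmetric])
    then show ?thesis by (simp add: h power_one_over)
  qed
  have sl: "2 ^ (m - l) * s = (1/2) ^ l"
  proof -
    have "(1/2::real) ^ m = (1/2) ^ (m - l) * (1/2) ^ l" using l by (simp add: power_add[symmetric])
    then show ?thesis by (simp add: s power_one_over)
  qed
  have Ri: "i < 2 ^ n \<and> real I * (1/2) ^ l \<le> real i * h \<and> real i * h + h \<le> (real I + 1) * (1/2) ^ l" if "i \<in> Ri" for i
  proof -
    have "i < (I + 1) * 2 ^ (n - l)" using that by (simp add: Ri_def)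
    also have "\<dots> \<le> 2 ^ l * 2 ^ (n - l)" using I by (intro mult_right_mono) auto
    also have "\<dots> = 2 ^ n" using l by (simp add: power_add[symmetric])
    finally have 1: "i < 2 ^ n" .
    have "real (I * 2 ^ (n - l)) \<le> real i" "real (Suc i) \<le> real ((I + 1) * 2 ^ (n - l))"
      using that by (auto simp only: of_nat_le_iff Ri_def atLeastLessThan_iff Suc_le_eq)
    then have "real I * 2 ^ (n - l) \<le> real i" "real i + 1 \<le> (real I + 1) * 2 ^ (n - l)"
      by (auto simp: algebra_simps)
    then have "real I * 2 ^ (n - l) * h \<le> real i * h" "(real i + 1) * h \<le> (real I + 1) * 2 ^ (n - l) * h"
      using hs_pos by (auto intro!: mult_right_mono simp del: distrib_right)
    then show ?thesis using 1 unfolding mult.assoc hl by (simp add: algebra_simps)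
  qed
  have Rc: "c \<in> Gd \<and> real J * (1/2) ^ l \<le> real c * s \<and> (real c + 1) * s \<le> (real J + 1) * (1/2) ^ l" if "c \<in> Rc" for c
  proof -
    have "real (J * 2 ^ (m - l)) \<le> real c" "real (Suc c) \<le> real ((J + 1) * 2 ^ (m - l))"
      using that by (auto simp only: of_nat_le_iff Rc_def atLeastLessThan_iff Suc_le_eq mem_Collect_eq)
    then have "real J * 2 ^ (m - l) \<le> real c" "real c + 1 \<le> (real J + 1) * 2 ^ (m - l)"
      by (auto simp: algebra_simps)
    then have "real J * 2 ^ (m - l) * s \<le> real c * s" "(real c + 1) * s \<le> (real J + 1) * 2 ^ (m - l) * s"
      using hs_pos by (auto intro!: mult_right_mono simp del: distrib_right)
    then show ?thesis using that unfolding mult.assoc sl by (simp add: Rc_def)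
  qed
  have sub: "(\<Union>(i, c)\<in>Ri \<times> Rc. cell i c) \<subseteq> cells \<inter> sq l I J"
  proof -
    have "cell i c \<subseteq> cells \<inter> sq l I J" if ic: "i \<in> Ri" "c \<in> Rc" for i c
    proof -
      have b: "real c * s \<le> X i c" "X i c + h \<le> (real c + 1) * s" using X[of i c] Ri[OF ic(1)] Rc[OF ic(2)] by auto
      have "cell i c \<subseteq> sq l I J"
        unfolding cell_def sq_def using b Ri[OF ic(1)] Rc[OF ic(2)] by (intro Sigma_mono) auto
      moreover have "cell i c \<subseteq> cells" unfolding cells_def using Ri[OF ic(1)] Rc[OF ic(2)] by blast
      ultimately show ?thesis by blast
    qed
    then show ?thesis by auto
  qed
  have disj: "disjoint_family_on (\<lambda>(i, c). cell i c) (Ri \<times> Rc)"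
    unfolding disjoint_family_on_def
  proof (intro ballI impI)
    fix p p' assume p: "p \<in> Ri \<times> Rc" "p' \<in> Ri \<times> Rc" "p \<noteq> p'"
    obtain i c i' c' where pp: "p = (i, c)" "p' = (i', c')" by (metis surj_pair)
    have uniq: "a = b" if "real a * t \<le> y" "y < real a * t + t" "real b * t \<le> y" "y < real b * t + t" "t > 0" for a b :: nat and t y :: real
    proof -
      have "real a * t < (real b + 1) * t" "real b * t < (real a + 1) * t" using that by (auto simp: algebra_simps)
      then have "real a < real b + 1" "real b < real a + 1" using that(5) by (auto simp: mult_less_cancel_right)
      then show ?thesis by linarith
    qed
    have "False" if z: "z \<in> cell i c" "z \<in> cell i' c'" for z
    proof -
      have "i = i'" using z hs_pos unfolding cell_def by (intro uniq[of i h "fst z" i']) auto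
      moreover have "c = c'"
      proof -
        have "real c * s \<le> X i c" "X i c + h \<le> real c * s + s" "real c' * s \<le> X i' c'" "X i' c' + h \<le> real c' * s + s"
          using X[of i c] X[of i' c'] Ri Rc p by (auto simp: pp distrib_right)
        moreover have "X i c \<le> snd z" "snd z < X i c + h" "X i' c' \<le> snd z" "snd z < X i' c' + h"
          using z by (auto simp: cell_def)
        ultimately show ?thesis using hs_pos by (intro uniq[of c s "snd z" c']) linarith+
      qed
      ultimately show False using p(3) by (simp add: pp)
    qed
    then show "(case p of (i, c) \<Rightarrow> cell i c) \<inter> (case p' of (i, c) \<Rightarrow> cell i c) = {}" by (auto simp: pp)
  qed
  have "measure lborel (\<Union>p\<in>Ri \<times> Rc. case p of (i, c) \<Rightarrow> cell i c) = (\<Sum>p\<in>Ri \<times> Rc. measure lborel (case p of (i, c) \<Rightarrow> cell i c))"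
  proof (rule measure_finite_Union[OF _ _ disj])
    show "(\<lambda>p. case p of (i, c) \<Rightarrow> cell i c) ` (Ri \<times> Rc) \<subseteq> sets lborel" using cell_borel by auto
    show "emeasure lborel (case p of (i, c) \<Rightarrow> cell i c) \<noteq> \<infinity>" for p
      using emeasure_lborel_bounded_finite[OF bounded_cell] by (auto split: prod.split simp: less_top)
  qed (use fin in auto)
  also have "\<dots> = real (card Ri * card Rc) * h\<^sup>2"
    by (simp add: case_prod_beta measure_cell card_cartesian_product)
  finally have eq: "measure lborel (\<Union>p\<in>Ri \<times> Rc. case p of (i, c) \<Rightarrow> cell i c) = real (card Ri) * real (card Rc) * h\<^sup>2" by simp
  have "(1/4) ^ l * h / (2 * s) \<le> real (card Ri) * real (card Rc) * h\<^sup>2"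
  proof -
    have "real (2 ^ (m - l)) \<le> real (2 * card Rc)" using J by (simp only: of_nat_le_iff Rc_def)
    then have c: "2 ^ (m - l) / 2 \<le> real (card Rc)" by simp
    have ri: "real (card Ri) * h = (1/2) ^ l" using hl by (simp add: Ri_def algebra_simps)
    have "(1/4) ^ l * h / (2 * s) = (1/2) ^ l * h * ((2 ^ (m - l) * s) / (2 * s))"
      unfolding sl by (simp add: power_mult_distrib[symmetric])
    also have "\<dots> = (1/2) ^ l * h * (2 ^ (m - l) / 2)" using hs_pos by simp
    also have "\<dots> \<le> (1/2) ^ l * h * real (card Rc)" using c hs_pos by (intro mult_left_mono) auto
    also have "\<dots> = real (card Ri) * real (card Rc) * h\<^sup>2" unfolding ri[symmetric] by (simp add: power2_eq_square)
    finally show ?thesis .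
  qed
  also have "\<dots> \<le> measure lborel (cells \<inter> sq l I J)"
    unfolding eq[symmetric]
  proof (rule measure_mono_fmeasurable[OF sub])
    show "(\<Union>p\<in>Ri \<times> Rc. case p of (i, c) \<Rightarrow> cell i c) \<in> sets lborel"
      using fin cell_borel by (intro sets.finite_UN) (auto simp: case_prod_beta)
    have "emeasure lborel (cells \<inter> sq l I J) < \<infinity>"
      by (rule emeasure_lborel_bounded_finite) (rule bounded_subset[OF bounded_cells], auto)
    moreover have "sq l I J \<in> sets borel" unfolding sq_def by (intro borel_Times) auto
    ultimately show "cells \<inter> sq l I J \<in> fmeasurable lborel" using cells_borel by (intro fmeasurableI) auto
  qed
  finally show ?thesis .
qed

text \<open>The box meets at most r / h + 2 rows and r / s + 2 columns, and any one cell in area at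
  most the square of min h r.\<close>

lemma cells_upper:
  assumes r: "0 < r"
  shows "measure lborel (cells \<inter> ({u..u + r} \<times> {v..v + r})) \<le> (r / h + 2) * (r / s + 2) * (min h r)\<^sup>2"
proof -
  define Bx where "Bx = {u..u + r} \<times> {v..v + r}"
  define Ri where "Ri = {i. i < 2 ^ n \<and> real i * h \<le> u + r \<and> u \<le> (real i + 1) * h}"
  define Rc where "Rc = {c \<in> Gd. real c * s \<le> v + r \<and> v \<le> (real c + 1) * s}"
  have fin: "finite Ri" "finite Rc" using finite_Gd by (auto simp: Ri_def Rc_def)
  have cR: "real (card {c. c \<in> A \<and> real c * t \<le> w + r \<and> w \<le> (real c + 1) * t}) \<le> r / t + 2" if t: "t > 0" for t w :: real and A :: "nat set"
  proof -
    have "real (card {c. c \<in> A \<and> real c * t \<le> w + r \<and> w \<le> (real c + 1) * t}) \<le> (w + r) / t - (w / t - 1) + 1"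
    proof (rule card_nat_interval_le)
      show "w / t - 1 \<le> (w + r) / t + 1" using t r by (simp add: add_divide_distrib)
    qed (use t in \<open>auto simp: field_simps\<close>)
    also have "\<dots> = r / t + 2" by (simp add: add_divide_distrib)
    finally show ?thesis .
  qed
  have Bxm: "Bx \<in> sets borel" unfolding Bx_def by (intro borel_Times) auto
  have sub: "cells \<inter> Bx \<subseteq> (\<Union>p\<in>Ri \<times> Rc. (case p of (i, c) \<Rightarrow> cell i c) \<inter> Bx)"
  proof
    fix z assume z: "z \<in> cells \<inter> Bx"
    then obtain i c where ic: "i < 2 ^ n" "c \<in> Gd" "z \<in> cell i c" by (auto simp: cells_def)
    have "i \<in> Ri" using ic z by (auto simp: Ri_def cell_def Bx_def algebra_simps)
    moreover have "c \<in> Rc"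
    proof -
      have "real c * s \<le> X i c" "X i c + h \<le> (real c + 1) * s" using X[OF ic(1,2)] by auto
      moreover have "X i c \<le> snd z" "snd z < X i c + h" "v \<le> snd z" "snd z \<le> v + r" using ic z by (auto simp: cell_def Bx_def)
      ultimately show ?thesis using ic by (auto simp: Rc_def)
    qed
    ultimately show "z \<in> (\<Union>p\<in>Ri \<times> Rc. (case p of (i, c) \<Rightarrow> cell i c) \<inter> Bx)" using ic z by auto
  qed
  have one: "measure lborel (cell i c \<inter> Bx) \<le> (min h r)\<^sup>2" for i c
  proof -
    have "cell i c \<inter> Bx = ({real i * h..<real i * h + h} \<inter> {u..u + r}) \<times> ({X i c..<X i c + h} \<inter> {v..v + r})"
      by (auto simp: cell_def Bx_def)
    then have "measure lborel (cell i c \<inter> Bx) = measure lborel ({real i * h..<real i * h + h} \<inter> {u..u + r}) * measure lborel ({X i c..<X i c + h} \<inter> {v..v + r})"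
      by (simp add: measure_lborel_Times)
    also have "\<dots> \<le> min h r * min h r"
      using hs_pos r by (intro mult_mono measure_lborel_Ico_Int_le) auto
    finally show ?thesis by (simp add: power2_eq_square)
  qed
  have fm: "(case p of (i, c) \<Rightarrow> cell i c) \<inter> Bx \<in> fmeasurable lborel" for p
  proof (cases p)
    case (Pair i c)
    have "emeasure lborel (cell i c \<inter> Bx) < \<infinity>"
      by (rule emeasure_lborel_bounded_finite) (rule bounded_subset[OF bounded_cell], auto)
    then show ?thesis using cell_borel Bxm by (auto simp: Pair intro!: fmeasurableI)
  qed
  have "measure lborel (cells \<inter> Bx) \<le> measure lborel (\<Union>p\<in>Ri \<times> Rc. (case p of (i, c) \<Rightarrow> cell i c) \<inter> Bx)"
    using fin fm cells_borel Bxm by (intro measure_mono_fmeasurable[OF sub] fmeasurable.finite_UN) auto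
  also have "\<dots> \<le> (\<Sum>p\<in>Ri \<times> Rc. measure lborel ((case p of (i, c) \<Rightarrow> cell i c) \<inter> Bx))"
    using fin by (intro measure_UNION_le fmeasurableD[OF fm]) auto
  also have "\<dots> \<le> (\<Sum>p\<in>Ri \<times> Rc. (min h r)\<^sup>2)" using one by (intro sum_mono) (auto split: prod.split)
  also have "\<dots> = real (card Ri) * real (card Rc) * (min h r)\<^sup>2" by (simp add: card_cartesian_product)
  also have "\<dots> \<le> (r / h + 2) * (r / s + 2) * (min h r)\<^sup>2"
    using cR[OF hs_pos(1), of "{..<2^n}" u] cR[OF hs_pos(2), of Gd v] hs_pos r
    by (intro mult_right_mono mult_mono) (auto simp: Ri_def Rc_def)
  finally show ?thesis unfolding Bx_def .
qed

end

section \<open>Superposing blocks of different scales into one measure\<close>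

lemma weighted_lborel_exists:
  fixes a :: "nat \<Rightarrow> real" and U :: "nat \<Rightarrow> (real \<times> real) set"
  assumes S: "finite S" and a: "\<And>k. k \<in> S \<Longrightarrow> 0 \<le> a k" and U: "\<And>k. k \<in> S \<Longrightarrow> U k \<in> sets borel \<and> bounded (U k)"
  shows "\<exists>\<nu>. sets \<nu> = sets borel \<and> finite_measure \<nu> \<and> (\<forall>A\<in>sets borel. measure \<nu> A = (\<Sum>k\<in>S. a k * measure lborel (U k \<inter> A)))"
proof -
  define \<Phi> where "\<Phi> z = (\<Sum>k\<in>S. ennreal (a k) * indicator (U k) z)" for z
  define \<nu> where "\<nu> = density lborel \<Phi>"
  have m: "\<Phi> \<in> borel_measurable lborel" unfolding \<Phi>_def
    using U by (intro borel_measurable_sum borel_measurable_times_ennreal borel_measurable_const borel_measurable_indicator) auto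
  have em: "emeasure \<nu> A = ennreal (\<Sum>k\<in>S. a k * measure lborel (U k \<inter> A))" if A: "A \<in> sets borel" for A
  proof -
    have "emeasure \<nu> A = (\<integral>\<^sup>+z. \<Phi> z * indicator A z \<partial>lborel)" unfolding \<nu>_def using A m by (intro emeasure_density) auto
    also have "\<dots> = (\<integral>\<^sup>+z. (\<Sum>k\<in>S. ennreal (a k) * indicator (U k \<inter> A) z) \<partial>lborel)"
      by (intro nn_integral_cong) (simp add: \<Phi>_def sum_distrib_right indicator_inter_arith mult.assoc)
    also have "\<dots> = (\<Sum>k\<in>S. \<integral>\<^sup>+z. ennreal (a k) * indicator (U k \<inter> A) z \<partial>lborel)"
      using U A by (intro nn_integral_sum borel_measurable_times_ennreal borel_measurable_const borel_measurable_indicator) auto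
    also have "\<dots> = (\<Sum>k\<in>S. ennreal (a k * measure lborel (U k \<inter> A)))"
    proof (rule sum.cong)
      fix k assume k: "k \<in> S"
      have "emeasure lborel (U k \<inter> A) < \<infinity>"
        by (rule emeasure_lborel_bounded_finite) (use U[OF k] in \<open>auto intro: bounded_subset\<close>)
      then have "emeasure lborel (U k \<inter> A) = ennreal (measure lborel (U k \<inter> A))"
        by (intro emeasure_eq_ennreal_measure) auto
      moreover have "U k \<inter> A \<in> sets lborel" using U[OF k] A by auto
      ultimately show "(\<integral>\<^sup>+z. ennreal (a k) * indicator (U k \<inter> A) z \<partial>lborel) = ennreal (a k * measure lborel (U k \<inter> A))"
        using a[OF k] by (simp add: nn_integral_cmult_indicator ennreal_mult)
    qed simp
    also have "\<dots> = ennreal (\<Sum>k\<in>S. a k * measure lborel (U k \<inter> A))" using a by (intro sum_ennreal) auto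
    finally show ?thesis .
  qed
  have "finite_measure \<nu>" by (rule finite_measureI) (use em[of UNIV] in \<open>simp add: \<nu>_def\<close>)
  moreover have "sets \<nu> = sets borel" by (simp add: \<nu>_def)
  moreover have "measure \<nu> A = (\<Sum>k\<in>S. a k * measure lborel (U k \<inter> A))" if "A \<in> sets borel" for A
    using em[OF that] a by (simp add: measure_def sum_nonneg enn2real_ennreal)
  ultimately show ?thesis by blast
qed

context gauge_growth
begin

text \<open>Constant for the scales above r: up to C, the quotient g h / h falls geometrically with
  ratio 2 powr (\<sigma> - 1) as h doubles.\<close>

definition geom :: real where "geom = C / (1 - 2 powr (\<sigma> - 1))"

lemma ratio_bounds: "0 < 2 powr (\<sigma> - 1)" "2 powr (\<sigma> - 1) < (1::real)"
  using sigma by (auto simp: powr_less_one)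

lemma geom_nonneg: "0 \<le> geom"
  using ratio_bounds C_ge_1 by (simp add: geom_def)

text \<open>Let k1 be the first index whose scale is at most r. By \<open>dec\<close> the terms
  decay at least like (1/2) ^ (k - k1) from there on, so they sum to at most twice the first, which
  monotonicity bounds by g r.\<close>

lemma sum_g_small_scales_le:
  fixes n :: "nat \<Rightarrow> nat"
  assumes fin: "finite S"
    and dec: "\<And>k k'. k \<in> S \<Longrightarrow> k' \<in> S \<Longrightarrow> k < k' \<Longrightarrow> 2 ^ k' * g ((1/2) ^ n k') \<le> 2 ^ k * g ((1/2) ^ n k)" and r: "0 < r"
  shows "(\<Sum>k\<in>{k\<in>S. (1/2) ^ n k \<le> r}. g ((1/2) ^ n k)) \<le> 2 * g r"
proof (cases "{k\<in>S. (1/2) ^ n k \<le> r} = {}")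
  case True
  show ?thesis unfolding True using g_pos[OF r] by simp
next
  case False
  define T where "T = {k\<in>S. (1/2) ^ n k \<le> r}"
  have T: "finite T" "T \<noteq> {}" using fin False by (auto simp: T_def)
  define k1 where "k1 = Min T"
  have k1: "k1 \<in> T" "\<And>k. k \<in> T \<Longrightarrow> k1 \<le> k" using T by (auto simp: k1_def)
  have b: "g ((1/2) ^ n k) \<le> (1/2) ^ (k - k1) * g ((1/2) ^ n k1)" if k: "k \<in> T" for k
  proof (cases "k = k1")
    case False
    then have lt: "k1 < k" using k1(2)[OF k] by simp
    then have "2 ^ k * g ((1/2) ^ n k) \<le> 2 ^ k1 * g ((1/2) ^ n k1)" using k k1(1) by (intro dec) (auto simp: T_def)
    moreover have "(2::real) ^ k = 2 ^ (k - k1) * 2 ^ k1" using lt by (simp add: power_add[symmetric])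
    ultimately have "2 ^ k1 * (2 ^ (k - k1) * g ((1/2) ^ n k)) \<le> 2 ^ k1 * g ((1/2) ^ n k1)" by (simp add: mult_ac)
    then have "2 ^ (k - k1) * g ((1/2) ^ n k) \<le> g ((1/2) ^ n k1)" by simp
    then show ?thesis by (simp add: power_one_over field_simps)
  qed simp
  have "(\<Sum>k\<in>T. g ((1/2) ^ n k)) \<le> (\<Sum>k\<in>T. (1/2) ^ (k - k1) * g ((1/2) ^ n k1))" by (intro sum_mono b)
  also have "\<dots> = (\<Sum>k\<in>T. (1/2) ^ (k - k1)) * g ((1/2) ^ n k1)" by (simp add: sum_distrib_right)
  also have "(\<Sum>k\<in>T. (1/2::real) ^ (k - k1)) = (\<Sum>j\<in>(\<lambda>k. k - k1) ` T. (1/2) ^ j)"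
    by (subst sum.reindex) (auto simp: inj_on_def dest!: k1(2))
  also have "\<dots> * g ((1/2) ^ n k1) \<le> 2 * g r"
  proof (rule mult_mono)
    have "(\<Sum>j\<in>(\<lambda>k. k - k1) ` T. (1/2::real) ^ j) \<le> (\<Sum>j. (1/2) ^ j)"
      using T by (intro sum_le_suminf) (auto intro: summable_geometric)
    also have "\<dots> = 2" by (subst suminf_geometric) auto
    finally show "(\<Sum>j\<in>(\<lambda>k. k - k1) ` T. (1/2::real) ^ j) \<le> 2" .
    show "g ((1/2) ^ n k1) \<le> g r" using k1(1) by (intro g_mono) (auto simp: T_def)
  qed (auto intro: less_imp_le[OF g_pos])
  finally show ?thesis by (simp add: T_def)
qed

text \<open>Counted back from the last index k1 with scale above r, strict monotonicity of
  \<open>n\<close> makes the scale at k at least 2 ^ (k1 - k) * r. Since \<sigma> < 1, the growth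
  bound turns this into geometric decay of g h / h.\<close>

lemma sum_g_large_scales_le:
  fixes n :: "nat \<Rightarrow> nat"
  assumes fin: "finite S" and sm: "strict_mono n" and r: "0 < r"
  shows "(\<Sum>k\<in>{k\<in>S. r < (1/2) ^ n k}. g ((1/2) ^ n k) / (1/2) ^ n k) \<le> geom * (g r / r)"
proof (cases "{k\<in>S. r < (1/2) ^ n k} = {}")
  case True
  show ?thesis unfolding True using g_pos[OF r] r geom_nonneg by simp
next
  case False
  define T where "T = {k\<in>S. r < (1/2) ^ n k}"
  have T: "finite T" "T \<noteq> {}" using fin False by (auto simp: T_def)
  define k1 where "k1 = Max T"
  have k1: "k1 \<in> T" "\<And>k. k \<in> T \<Longrightarrow> k \<le> k1" using T by (auto simp: k1_def)
  define \<rho> where "\<rho> = (2::real) powr (\<sigma> - 1)"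
  have \<rho>: "0 < \<rho>" "\<rho> < 1" using ratio_bounds by (auto simp: \<rho>_def)
  have gr: "0 < g r" using g_pos[OF r] .
  have b: "g ((1/2) ^ n k) / (1/2) ^ n k \<le> C * (g r / r) * \<rho> ^ (k1 - k)" if k: "k \<in> T" for k
  proof -
    define h where "h = (1/2::real) ^ n k"
    have h: "r < h" "0 < h" using k by (auto simp: T_def h_def)
    have step: "n k + (k1 - k) \<le> n k1"
    proof -
      have "n k + j \<le> n (k + j)" for j
      proof (induction j)
        case (Suc j)
        have "n (k + j) < n (k + Suc j)" using sm by (simp add: strict_mono_def)
        then show ?case using Suc by simp
      qed simp
      from this[of "k1 - k"] show ?thesis using k1(2)[OF k] by simp
    qed
    have "2 ^ (k1 - k) \<le> h / r"
    proof -
      have "2 ^ (k1 - k) * r \<le> 2 ^ (k1 - k) * (1/2) ^ n k1" using k1(1) by (intro mult_left_mono) (auto simp: T_def)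
      also have "\<dots> \<le> 2 ^ (k1 - k) * (1/2) ^ (n k + (k1 - k))" using step by (intro mult_left_mono power_decreasing) auto
      also have "\<dots> = h" by (simp add: h_def power_add power_one_over)
      finally show ?thesis using r by (simp add: field_simps)
    qed
    then have "(h / r) powr (\<sigma> - 1) \<le> (2 ^ (k1 - k)) powr (\<sigma> - 1)"
      using sigma by (intro powr_mono2') auto
    also have "\<dots> = \<rho> ^ (k1 - k)" by (simp add: \<rho>_def power_powr_swap)
    finally have p: "(h / r) powr (\<sigma> - 1) \<le> \<rho> ^ (k1 - k)" .
    have "g h / h \<le> (C * (h / r) powr \<sigma> * g r) / h" using g_growth[OF r, of h] h by (intro divide_right_mono) auto
    also have "\<dots> = C * (g r / r) * (h / r) powr (\<sigma> - 1)"
      using h r by (simp add: powr_diff)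
    also have "\<dots> \<le> C * (g r / r) * \<rho> ^ (k1 - k)" using p C_ge_1 gr r by (intro mult_left_mono) auto
    finally show ?thesis by (simp add: h_def)
  qed
  have "(\<Sum>k\<in>T. g ((1/2) ^ n k) / (1/2) ^ n k) \<le> (\<Sum>k\<in>T. C * (g r / r) * \<rho> ^ (k1 - k))" by (intro sum_mono b)
  also have "\<dots> = C * (g r / r) * (\<Sum>k\<in>T. \<rho> ^ (k1 - k))" by (simp add: sum_distrib_left)
  also have "(\<Sum>k\<in>T. \<rho> ^ (k1 - k)) = (\<Sum>j\<in>(\<lambda>k. k1 - k) ` T. \<rho> ^ j)"
    by (subst sum.reindex) (auto simp: inj_on_def dest!: k1(2))
  also have "C * (g r / r) * \<dots> \<le> C * (g r / r) * (1 / (1 - \<rho>))"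
  proof (rule mult_left_mono)
    have "(\<Sum>j\<in>(\<lambda>k. k1 - k) ` T. \<rho> ^ j) \<le> (\<Sum>j. \<rho> ^ j)"
      using T \<rho> by (intro sum_le_suminf) (auto intro: summable_geometric)
    also have "\<dots> = 1 / (1 - \<rho>)" using \<rho> by (subst suminf_geometric) auto
    finally show "(\<Sum>j\<in>(\<lambda>k. k1 - k) ` T. \<rho> ^ j) \<le> 1 / (1 - \<rho>)" .
  qed (use C_ge_1 gr r in auto)
  finally show ?thesis by (simp add: T_def geom_def \<rho>_def mult_ac)
qed

end

locale block_sequence = gauge_growth +
  fixes n :: "nat \<Rightarrow> nat" and \<psi> :: "nat \<Rightarrow> real"
  assumes sm: "strict_mono n" and hn: "\<And>k. (1/2) ^ n k \<le> (1/4::real) ^ k"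
    and width: "\<And>k q. 2 ^ k \<le> q \<Longrightarrow> q < 2 ^ (k + 1) \<Longrightarrow> 2 ^ (k + 4) * (1/2) ^ n k \<le> \<psi> q"
    and ns: "\<not> summable (\<lambda>k. 4 ^ k * g ((1/2) ^ n k))"
begin

text \<open>The measure has density a k on the cells of block k, summed over the blocks from
  \<open>select_scales\<close>. Cells occupy a fraction comparable to h k / s k of each square of
  level l, so block k contributes about a k * (h k / s k) = \<eta>' * (4 ^ k * g (h k)) per unit
  area, and these weights total between 1 and 2. Late blocks give q \<ge> N; finiteness of the sum
  gives the bounded density P and a common tolerance \<epsilon>.\<close>

lemma multiscale_measure_exists:
  assumes \<eta>: "0 < \<eta>"
  shows "\<exists>\<nu> P \<epsilon>. sets \<nu> = sets borel \<and> finite_measure \<nu> \<and> 0 \<le> P \<and> 0 < \<epsilon> \<and>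
    (\<forall>I<2 ^ l. \<forall>J<2 ^ l. (1/4) ^ l / 2 \<le> measure \<nu> (sq l I J)) \<and>
    (\<forall>u v r. 0 < r \<longrightarrow> measure \<nu> ({u..u + r} \<times> {v..v + r}) \<le> (18 + 9 * geom) * (r\<^sup>2 + \<eta> * (r * g r))) \<and>
    (\<forall>A\<in>sets borel. bounded A \<longrightarrow> measure \<nu> A \<le> P * measure lborel A) \<and>
    (\<forall>A\<in>sets borel. 0 < measure \<nu> A \<longrightarrow> (\<exists>\<theta> x. (\<theta>, x) \<in> A \<and> (\<forall>\<theta>' x'. \<bar>\<theta>' - \<theta>\<bar> \<le> \<epsilon> \<longrightarrow> \<bar>x' - x\<bar> \<le> \<epsilon> \<longrightarrow>
        (\<exists>q\<ge>N. dist_int (real q * x' - \<theta>') < \<psi> q))))"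
proof -
  obtain k0 where k0: "\<And>k. k \<ge> k0 \<Longrightarrow> 2 * k \<ge> 10 + l \<and> (\<forall>J. 2 ^ (2 * k - 10 - l) \<le>
      2 * card {c \<in> {J * 2 ^ (2 * k - 10 - l)..<(J + 1) * 2 ^ (2 * k - 10 - l)}. good_column k c})"
    using eventually_half_columns_good[of l] unfolding eventually_sequentially by blast
  define h where "h k = (1/2::real) ^ n k" for k
  have h0: "0 < h k" for k by (simp add: h_def)
  have gh0: "0 < g (h k)" for k using g_pos[OF h0] .
  have "\<exists>S \<eta>'. finite S \<and> S \<subseteq> {max k0 N..} \<and> 0 < \<eta>' \<and> \<eta>' \<le> \<eta> / 1024 \<and> 1 \<le> (\<Sum>k\<in>S. \<eta>' * (4 ^ k * g (h k))) \<and>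
     (\<Sum>k\<in>S. \<eta>' * (4 ^ k * g (h k))) \<le> 2 \<and> (\<forall>k\<in>S. \<forall>k'\<in>S. k < k' \<longrightarrow> 2 ^ k' * g (h k') \<le> 2 ^ k * g (h k))"
    using gh0 ns \<eta> unfolding h_def by (intro select_scales) auto
  then obtain S \<eta>' where S: "finite S" "S \<subseteq> {max k0 N..}" and e': "0 < \<eta>'" "\<eta>' \<le> \<eta> / 1024"
    and w: "1 \<le> (\<Sum>k\<in>S. \<eta>' * (4 ^ k * g (h k)))" "(\<Sum>k\<in>S. \<eta>' * (4 ^ k * g (h k))) \<le> 2"
    and dec: "\<And>k k'. k \<in> S \<Longrightarrow> k' \<in> S \<Longrightarrow> k < k' \<Longrightarrow> 2 ^ k' * g (h k') \<le> 2 ^ k * g (h k)"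
    by blast
  define m where "m k = 2 * k - 10" for k :: nat
  define s where "s k = (1/2::real) ^ m k" for k
  define Gd where "Gd k = {c. c < 2 ^ m k \<and> good_column k c}" for k
  define R where "R k i c q p \<longleftrightarrow> 2 ^ k \<le> q \<and> q < 2 ^ (k + 1) \<and>
     \<bar>(of_int p + real i * h k) / real q - (real c + 1/2) * (1024 / 4 ^ k)\<bar> \<le> 256 / 4 ^ k"
    for k i c q :: nat and p :: int
  have "\<forall>t. \<exists>y. case t of (k, i, c) \<Rightarrow> good_column k c \<longrightarrow> R k i c (fst y) (snd y)"
    unfolding good_column_def R_def by auto
  then obtain F where F: "\<And>t. case t of (k, i, c) \<Rightarrow> good_column k c \<longrightarrow> R k i c (fst (F t)) (snd (F t))"
    by (rule choice[THEN exE]) blast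
  define Q where "Q k i c = fst (F (k, i, c))" for k i c
  define P where "P k i c = snd (F (k, i, c))" for k i c
  have "good_column k c \<longrightarrow> R k i c (Q k i c) (P k i c)" for k i c
    using F[of "(k, i, c)"] by (simp add: Q_def P_def)
  then have QP: "(2::nat) ^ k \<le> Q k i c \<and> Q k i c < 2 ^ (k + 1) \<and>
     \<bar>(of_int (P k i c) + real i * h k) / real (Q k i c) - (real c + 1/2) * (1024 / 4 ^ k)\<bar> \<le> 256 / 4 ^ k"
    if "good_column k c" for k i c using that unfolding R_def by blast
  \<comment> \<open>The chosen strip at height \<theta> = i * h k. It passes through the middle half
    of the column, and h k is at most a quarter of the column width, so the cell stays
    inside.\<close>
  define X where "X k i c = (of_int (P k i c) + real i * h k) / real (Q k i c)" for k i c
  have s4: "s k = 1024 / 4 ^ k" if "k \<in> S" for k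
  proof -
    have "k \<ge> k0" using that S(2) by auto
    then have "2 * k = m k + 10" using k0[of k, THEN conjunct1] by (simp add: m_def)
    then have "(2::real) ^ (2 * k) = 2 ^ m k * 1024" by (simp add: power_add)
    then have "(4::real) ^ k = 2 ^ m k * 1024" by (simp add: power_mult)
    then show ?thesis by (simp add: s_def power_one_over)
  qed
  have blk: "dyadic_block (n k) (m k) (Gd k) (X k) (h k) (s k)" if k: "k \<in> S" for k
  proof
    fix i c assume "c \<in> Gd k"
    then have g: "good_column k c" by (simp add: Gd_def)
    have "\<bar>X k i c - (real c + 1/2) * s k\<bar> \<le> s k / 4" using QP[OF g, of i] unfolding X_def s4[OF k] by simp
    moreover have "h k \<le> s k / 4"
    proof -
      have "h k \<le> 1 / 4 ^ k" using hn[of k] by (simp add: h_def power_one_over)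
      also have "\<dots> \<le> s k / 4" unfolding s4[OF k] by (simp add: field_simps)
      finally show ?thesis .
    qed
    ultimately show "real c * s k \<le> X k i c \<and> X k i c + h k \<le> (real c + 1) * s k"
      using h0[of k] unfolding abs_le_iff distrib_right by linarith
  qed (auto simp: h_def s_def Gd_def)
  define U where "U k = dyadic_block.cells (n k) (Gd k) (X k) (h k)" for k
  \<comment> \<open>The factor 1024 comes from s k = 1024 / 4 ^ k and makes a k * (h k / s k) the
    selected weight; it explains the bound \<eta> / 1024 in the selection.\<close>
  define a where "a k = 1024 * \<eta>' * g (h k) / h k" for k
  have a0: "0 \<le> a k" for k using e' h0[of k] gh0[of k] by (simp add: a_def)
  have UB: "U k \<in> sets borel \<and> bounded (U k)" if "k \<in> S" for k
    unfolding U_def using dyadic_block.cells_borel[OF blk[OF that]] dyadic_block.bounded_cells[OF blk[OF that]] by simp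
  from weighted_lborel_exists[of S a U, OF S(1) a0 UB] obtain \<nu> where \<nu>: "sets \<nu> = sets borel" "finite_measure \<nu>"
    "\<And>A. A \<in> sets borel \<Longrightarrow> measure \<nu> A = (\<Sum>k\<in>S. a k * measure lborel (U k \<inter> A))" by blast
  have wk: "a k * (h k / s k) = \<eta>' * (4 ^ k * g (h k))" if "k \<in> S" for k
    using h0[of k] unfolding a_def s4[OF that] by simp
  have lower: "(1/4) ^ l / 2 \<le> measure \<nu> (sq l I J)" if IJ: "I < 2 ^ l" "J < 2 ^ l" for I J
  proof -
    have "(1/4) ^ l / 2 \<le> (1/4) ^ l / 2 * (\<Sum>k\<in>S. \<eta>' * (4 ^ k * g (h k)))" using w(1) by simp
    also have "\<dots> = (\<Sum>k\<in>S. a k * ((1/4) ^ l * h k / (2 * s k)))"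
      unfolding sum_distrib_left
    proof (rule sum.cong)
      fix k assume "k \<in> S"
      from wk[OF this] have "(1/4) ^ l / 2 * (\<eta>' * (4 ^ k * g (h k))) = (1/4) ^ l / 2 * (a k * (h k / s k))" by simp
      then show "(1/4) ^ l / 2 * (\<eta>' * (4 ^ k * g (h k))) = a k * ((1/4) ^ l * h k / (2 * s k))" by (simp add: mult_ac)
    qed simp
    also have "\<dots> \<le> (\<Sum>k\<in>S. a k * measure lborel (U k \<inter> sq l I J))"
    proof (intro sum_mono mult_left_mono a0)
      fix k assume k: "k \<in> S"
      then have kk: "k \<ge> k0" using S(2) by auto
      have lm: "l \<le> m k" using k0[OF kk, THEN conjunct1] by (simp add: m_def)
      have "(1/2::real) ^ n k \<le> (1/2) ^ (2 * k)" using hn[of k] by (simp add: power_mult power2_eq_square)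
      then have "2 * k \<le> n k" by (simp add: power_decreasing_iff)
      then have ln: "l \<le> n k" using lm by (simp add: m_def)
      have "2 ^ (m k - l) \<le> 2 * card {c \<in> {J * 2 ^ (m k - l)..<(J + 1) * 2 ^ (m k - l)}. good_column k c}"
        using k0[OF kk, THEN conjunct2] unfolding m_def by blast
      also have "{c \<in> {J * 2 ^ (m k - l)..<(J + 1) * 2 ^ (m k - l)}. good_column k c} =
          {c \<in> Gd k. c \<in> {J * 2 ^ (m k - l)..<(J + 1) * 2 ^ (m k - l)}}"
      proof -
        have "c < 2 ^ m k" if "c < (J + 1) * 2 ^ (m k - l)" for c
        proof -
          note that
          also have "(J + 1) * 2 ^ (m k - l) \<le> 2 ^ l * 2 ^ (m k - l)" using IJ by (intro mult_right_mono) auto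
          also have "\<dots> = 2 ^ m k" using lm by (simp add: power_add[symmetric])
          finally show ?thesis .
        qed
        then show ?thesis by (auto simp: Gd_def)
      qed
      finally show "(1/4) ^ l * h k / (2 * s k) \<le> measure lborel (U k \<inter> sq l I J)"
        unfolding U_def by (intro dyadic_block.cells_lower[OF blk[OF k] lm ln IJ(1)])
    qed
    also have "\<dots> = measure \<nu> (sq l I J)"
      by (rule \<nu>(3)[symmetric]) (auto simp: sq_def intro!: borel_Times)
    finally show ?thesis .
  qed
  have upper: "measure \<nu> ({u..u + r} \<times> {v..v + r}) \<le> (18 + 9 * geom) * (r\<^sup>2 + \<eta> * (r * g r))" if r: "0 < r" for u v r
  proof -
    define E where "E = 1024 * \<eta>'"
    have E: "0 < E" "E \<le> \<eta>" using e' by (auto simp: E_def)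
    have gr: "0 < g r" using g_pos[OF r] .
    \<comment> \<open>Three regimes. For r \<ge> s k the block looks like area times its weight; for
      h k \<le> r < s k the box meets boundedly many columns, and the mass is of order r * g (h k);
      for r < h k it meets boundedly many cells, and only the density a k counts.\<close>
    have term_le: "a k * measure lborel (U k \<inter> ({u..u + r} \<times> {v..v + r})) \<le>
        9 * r\<^sup>2 * (\<eta>' * (4 ^ k * g (h k))) + 9 * r * E * (if h k \<le> r then g (h k) else 0) +
        9 * r\<^sup>2 * E * (if r < h k then g (h k) / h k else 0)" if k: "k \<in> S" for k
    proof -
      have sk: "0 < s k" by (simp add: s_def)
      have hk: "0 < h k" using h0 .
      have aE: "a k = E * g (h k) / h k" by (simp add: a_def E_def)
      have "a k * measure lborel (U k \<inter> ({u..u + r} \<times> {v..v + r})) \<le> a k * ((r / h k + 2) * (r / s k + 2) * (min (h k) r)\<^sup>2)"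
        unfolding U_def by (intro mult_left_mono a0 dyadic_block.cells_upper[OF blk[OF k] r])
      also have "\<dots> \<le> 9 * r\<^sup>2 * (\<eta>' * (4 ^ k * g (h k))) + 9 * r * E * (if h k \<le> r then g (h k) else 0) +
        9 * r\<^sup>2 * E * (if r < h k then g (h k) / h k else 0)"
      proof -
        have nn: "0 \<le> 9 * r\<^sup>2 * (\<eta>' * (4 ^ k * g (h k)))" using e' gh0[of k] by simp
        consider "r < h k" | "h k \<le> r" "r < s k" | "h k \<le> r" "s k \<le> r" by linarith
        then show ?thesis
        proof cases
          case 1
          have "r \<le> s k"
          proof -
            have "h k \<le> 1 / 4 ^ k" using hn[of k] by (simp add: h_def power_one_over)
            also have "\<dots> \<le> s k" unfolding s4[OF k] by (simp add: field_simps)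
            finally show ?thesis using 1 by simp
          qed
          then have "(r / h k + 2) * (r / s k + 2) \<le> 3 * 3" using 1 hk sk r by (intro mult_mono) (auto simp: field_simps)
          then have "a k * ((r / h k + 2) * (r / s k + 2) * (min (h k) r)\<^sup>2) \<le> a k * (9 * r\<^sup>2)"
            unfolding min_absorb2[OF less_imp_le[OF 1]] by (intro mult_left_mono[OF mult_right_mono] a0) auto
          also have "\<dots> = 9 * r\<^sup>2 * E * (g (h k) / h k)" by (simp add: aE)
          finally have L: "a k * ((r / h k + 2) * (r / s k + 2) * (min (h k) r)\<^sup>2) \<le> 9 * r\<^sup>2 * E * (g (h k) / h k)" .
          have "(if h k \<le> r then g (h k) else 0) = 0" "(if r < h k then g (h k) / h k else 0) = g (h k) / h k" using 1 by auto
          then show ?thesis using nn L by (simp only: mult_zero_right add_0_right)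
        next
          case 2
          have "(r / h k + 2) * (r / s k + 2) \<le> (3 * r / h k) * 3" using 2 hk sk r by (intro mult_mono) (auto simp: field_simps)
          then have "a k * ((r / h k + 2) * (r / s k + 2) * (min (h k) r)\<^sup>2) \<le> a k * ((3 * r / h k) * 3 * (h k)\<^sup>2)"
            unfolding min_absorb1[OF 2(1)] by (intro mult_left_mono[OF mult_right_mono] a0) auto
          also have "\<dots> = 9 * r * E * g (h k)" using hk by (simp add: aE power2_eq_square)
          finally have L: "a k * ((r / h k + 2) * (r / s k + 2) * (min (h k) r)\<^sup>2) \<le> 9 * r * E * g (h k)" .
          have "(if h k \<le> r then g (h k) else 0) = g (h k)" "(if r < h k then g (h k) / h k else 0) = 0" using 2 by auto
          then show ?thesis using nn L by (simp only: mult_zero_right add_0_right)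
        next
          case 3
          have "(r / h k + 2) * (r / s k + 2) \<le> (3 * r / h k) * (3 * r / s k)" using 3 hk sk r by (intro mult_mono) (auto simp: field_simps)
          then have "a k * ((r / h k + 2) * (r / s k + 2) * (min (h k) r)\<^sup>2) \<le> a k * ((3 * r / h k) * (3 * r / s k) * (h k)\<^sup>2)"
            unfolding min_absorb1[OF 3(1)] by (intro mult_left_mono[OF mult_right_mono] a0) auto
          also have "\<dots> = 9 * r\<^sup>2 * (a k * (h k / s k))" using hk by (simp add: power2_eq_square)
          also have "\<dots> = 9 * r\<^sup>2 * (\<eta>' * (4 ^ k * g (h k)))" unfolding wk[OF k] ..
          finally have L: "a k * ((r / h k + 2) * (r / s k + 2) * (min (h k) r)\<^sup>2) \<le> 9 * r\<^sup>2 * (\<eta>' * (4 ^ k * g (h k)))" .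
          have "0 \<le> 9 * r * E * g (h k)" using r E gh0[of k] by simp
          moreover have "(if h k \<le> r then g (h k) else 0) = g (h k)" "(if r < h k then g (h k) / h k else 0) = 0" using 3 by auto
          ultimately show ?thesis using L by (simp only: mult_zero_right add_0_right)
        qed
      qed
      finally show ?thesis .
    qed
    have "measure \<nu> ({u..u + r} \<times> {v..v + r}) = (\<Sum>k\<in>S. a k * measure lborel (U k \<inter> ({u..u + r} \<times> {v..v + r})))"
      by (rule \<nu>(3)) (auto intro!: borel_Times)
    also have "\<dots> \<le> (\<Sum>k\<in>S. 9 * r\<^sup>2 * (\<eta>' * (4 ^ k * g (h k))) + 9 * r * E * (if h k \<le> r then g (h k) else 0) +
        9 * r\<^sup>2 * E * (if r < h k then g (h k) / h k else 0))" by (intro sum_mono term_le)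
    also have "\<dots> = 9 * r\<^sup>2 * (\<Sum>k\<in>S. \<eta>' * (4 ^ k * g (h k))) + 9 * r * E * (\<Sum>k\<in>{k\<in>S. h k \<le> r}. g (h k)) +
        9 * r\<^sup>2 * E * (\<Sum>k\<in>{k\<in>S. r < h k}. g (h k) / h k)"
      using S(1) by (simp only: sum.distrib sum_distrib_left[symmetric] sum.inter_filter)
    also have "\<dots> \<le> 9 * r\<^sup>2 * 2 + 9 * r * E * (2 * g r) + 9 * r\<^sup>2 * E * (geom * (g r / r))"
    proof (intro add_mono mult_left_mono w(2))
      show "(\<Sum>k\<in>{k\<in>S. h k \<le> r}. g (h k)) \<le> 2 * g r"
        unfolding h_def by (rule sum_g_small_scales_le[OF S(1) dec[unfolded h_def] r])
      show "(\<Sum>k\<in>{k\<in>S. r < h k}. g (h k) / h k) \<le> geom * (g r / r)"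
        unfolding h_def by (rule sum_g_large_scales_le[OF S(1) sm r])
    qed (use r E in auto)
    also have "\<dots> = 18 * r\<^sup>2 + (18 + 9 * geom) * (E * (r * g r))" using r by (simp add: power2_eq_square algebra_simps)
    also have "\<dots> \<le> (18 + 9 * geom) * r\<^sup>2 + (18 + 9 * geom) * (\<eta> * (r * g r))"
      using geom_nonneg E r gr by (intro add_mono mult_right_mono mult_left_mono) auto
    finally show ?thesis by (simp add: distrib_left)
  qed
  define PP where "PP = (\<Sum>k\<in>S. a k)"
  have bound: "measure \<nu> A \<le> PP * measure lborel A" if A: "A \<in> sets borel" "bounded A" for A
  proof -
    have "measure \<nu> A = (\<Sum>k\<in>S. a k * measure lborel (U k \<inter> A))" using A by (intro \<nu>(3))
    also have "\<dots> \<le> (\<Sum>k\<in>S. a k * measure lborel A)"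
    proof (intro sum_mono mult_left_mono a0 measure_mono_fmeasurable)
      show "A \<in> fmeasurable lborel" using A emeasure_lborel_bounded_finite[OF A(2)] by (intro fmeasurableI) auto
    qed (use UB A in auto)
    also have "\<dots> = PP * measure lborel A" by (simp add: PP_def sum_distrib_right)
    finally show ?thesis .
  qed
  \<comment> \<open>The exponent dominates every n k, so \<epsilon> lies below all h k at
    once.\<close>
  define \<epsilon> where "\<epsilon> = (1/2::real) ^ (\<Sum>k\<in>S. n k)"
  have eps: "\<epsilon> \<le> h k" if "k \<in> S" for k
    unfolding \<epsilon>_def h_def using S(1) that by (intro power_decreasing member_le_sum) auto
  have strip: "\<exists>q\<ge>N. dist_int (real q * x' - \<theta>') < \<psi> q"
    if z: "(\<theta>, x) \<in> U k" and k: "k \<in> S" and near: "\<bar>\<theta>' - \<theta>\<bar> \<le> \<epsilon>" "\<bar>x' - x\<bar> \<le> \<epsilon>" for \<theta> x \<theta>' x' k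
  proof -
    obtain i c where ic: "c \<in> Gd k" "(\<theta>, x) \<in> dyadic_block.cell (X k) (h k) i c"
      using z unfolding U_def dyadic_block.cells_def[OF blk[OF k]] by auto
    have t: "real i * h k \<le> \<theta>" "\<theta> < real i * h k + h k" "X k i c \<le> x" "x < X k i c + h k"
      using ic(2) unfolding dyadic_block.cell_def[OF blk[OF k]] by auto
    have gd: "good_column k c" using ic by (simp add: Gd_def)
    define q where "q = Q k i c"
    have q: "2 ^ k \<le> q" "q < 2 ^ (k + 1)" using QP[OF gd, of i] by (auto simp: q_def)
    have qN: "q \<ge> N"
    proof -
      have "N \<le> k" using k S(2) by auto
      also have "k < 2 ^ k" by (rule less_exp)
      finally show ?thesis using q by simp
    qed
    have q1: "1 \<le> q" using q(1) one_le_power[of "2::nat" k] by linarith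
    have Xq: "real q * X k i c = of_int (P k i c) + real i * h k" using q1 by (simp add: X_def q_def)
    \<comment> \<open>Moving by 2 * h k in both coordinates changes q * x' - \<theta>' by at most 4
      * q * h k, less than 2 ^ (k + 3) * h k; the factor 2 ^ (k + 4) in \<open>width\<close> covers
      this.\<close>
    have d1: "\<bar>x' - X k i c\<bar> \<le> 2 * h k" "\<bar>\<theta>' - real i * h k\<bar> \<le> 2 * h k"
      using t near eps[OF k] by linarith+
    have "real q * x' - \<theta>' - of_int (P k i c) = real q * (x' - X k i c) - (\<theta>' - real i * h k)"
      using Xq by (simp add: algebra_simps)
    then have "\<bar>real q * x' - \<theta>' - of_int (P k i c)\<bar> \<le> \<bar>real q * (x' - X k i c)\<bar> + \<bar>\<theta>' - real i * h k\<bar>" by linarith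
    also have "\<dots> \<le> real q * (2 * h k) + real q * (2 * h k)"
    proof (rule add_mono)
      show "\<bar>real q * (x' - X k i c)\<bar> \<le> real q * (2 * h k)" using d1 by (simp add: abs_mult mult_left_mono)
      have "1 * (2 * h k) \<le> real q * (2 * h k)" using q1 h0[of k] by (intro mult_right_mono) auto
      then show "\<bar>\<theta>' - real i * h k\<bar> \<le> real q * (2 * h k)" using d1 by linarith
    qed
    also have "\<dots> = real q * (4 * h k)" by simp
    also have "\<dots> < 2 ^ (k + 1) * (4 * h k)"
    proof (rule mult_strict_right_mono)
      show "real q < 2 ^ (k + 1)" using q(2) of_nat_less_iff[of q "2 ^ (k + 1)", where 'a = real] by simp
    qed (use h0 in simp)
    also have "\<dots> \<le> 2 ^ (k + 4) * h k" using h0[of k] by (simp add: power_add)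
    also have "\<dots> \<le> \<psi> q" using width[OF q] by (simp add: h_def)
    finally have "dist_int (real q * x' - \<theta>') < \<psi> q" using dist_int_le[of "real q * x' - \<theta>'" "P k i c"] by linarith
    then show ?thesis using qN by blast
  qed
  have supp: "\<exists>\<theta> x. (\<theta>, x) \<in> A \<and> (\<forall>\<theta>' x'. \<bar>\<theta>' - \<theta>\<bar> \<le> \<epsilon> \<longrightarrow> \<bar>x' - x\<bar> \<le> \<epsilon> \<longrightarrow>
        (\<exists>q\<ge>N. dist_int (real q * x' - \<theta>') < \<psi> q))" if A: "A \<in> sets borel" "0 < measure \<nu> A" for A
  proof -
    have "\<exists>k\<in>S. U k \<inter> A \<noteq> {}"
    proof (rule ccontr)
      assume "\<not> (\<exists>k\<in>S. U k \<inter> A \<noteq> {})"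
      then have "measure \<nu> A = 0" using \<nu>(3)[OF A(1)] by simp
      with A(2) show False by simp
    qed
    then obtain k \<theta> x where "k \<in> S" "(\<theta>, x) \<in> U k" "(\<theta>, x) \<in> A" by fast
    then show ?thesis using strip by blast
  qed
  have PP0: "0 \<le> PP" using a0 by (auto simp: PP_def intro: sum_nonneg)
  have e0: "0 < \<epsilon>" by (simp add: \<epsilon>_def)
  show ?thesis
    by (rule exI[of _ \<nu>], rule exI[of _ PP], rule exI[of _ \<epsilon>], intro conjI allI ballI impI)
      (rule \<nu>(1) \<nu>(2) PP0 e0 lower upper bound supp; assumption)+
qed

end

section \<open>Refining dyadic weights\<close>

definition grid :: "nat \<Rightarrow> (nat \<times> nat) set" where "grid l = {..<2 ^ l} \<times> {..<2 ^ l}"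

definition parent :: "nat \<Rightarrow> nat \<times> nat \<Rightarrow> nat \<times> nat" where
  "parent e p = (fst p div 2 ^ e, snd p div 2 ^ e)"

text \<open>Closed squares, which overlap on their borders, serve compactness and covering; mass is
  distributed by means of the half-open \<open>sq\<close>.\<close>

definition csq :: "nat \<Rightarrow> nat \<times> nat \<Rightarrow> (real \<times> real) set" where
  "csq l p = {real (fst p) * (1/2) ^ l..(real (fst p) + 1) * (1/2) ^ l} \<times>
     {real (snd p) * (1/2) ^ l..(real (snd p) + 1) * (1/2) ^ l}"

abbreviation sqp :: "nat \<Rightarrow> nat \<times> nat \<Rightarrow> (real \<times> real) set" where
  "sqp l p \<equiv> sq l (fst p) (snd p)"

lemma finite_grid [simp]: "finite (grid l)" by (simp add: grid_def)

lemma card_grid: "card (grid l) = 4 ^ l"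
  by (simp add: grid_def card_cartesian_product power_mult_distrib[symmetric])

lemma sq_borel [measurable]: "sq l i j \<in> sets borel"
  unfolding sq_def by (intro borel_Times) auto

lemma bounded_sq: "bounded (sq l i j)"
  unfolding sq_def by (intro bounded_Times) auto

lemma measure_sq: "measure lborel (sq l i j) = (1/4) ^ l"
  unfolding sq_def by (subst measure_lborel_Times) (auto simp: algebra_simps power_mult_distrib[symmetric])

lemma sq_nonempty: "sqp l p \<noteq> {}" 
  unfolding sq_def by (auto simp: distrib_right)

definition dyadic_index :: "nat \<Rightarrow> real \<times> real \<Rightarrow> nat \<times> nat" where
  "dyadic_index l z = (nat \<lfloor>fst z * 2 ^ l\<rfloor>, nat \<lfloor>snd z * 2 ^ l\<rfloor>)"

text \<open>Nonnegativity is stated separately because \<open>nat\<close> sends negative floors to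
  0.\<close>

lemma mem_sqp_iff: "z \<in> sqp l p \<longleftrightarrow> 0 \<le> fst z \<and> 0 \<le> snd z \<and> dyadic_index l z = p"
proof -
  have *: "x \<in> {real i * (1/2) ^ l..<(real i + 1) * (1/2) ^ l} \<longleftrightarrow> 0 \<le> x \<and> nat \<lfloor>x * 2 ^ l\<rfloor> = i" for x i
  proof -
    have "x \<in> {real i * (1/2) ^ l..<(real i + 1) * (1/2) ^ l} \<longleftrightarrow> real i \<le> x * 2 ^ l \<and> x * 2 ^ l < real i + 1"
      by (simp add: power_one_over field_simps)
    also have "\<dots> \<longleftrightarrow> 0 \<le> x * 2 ^ l \<and> nat \<lfloor>x * 2 ^ l\<rfloor> = i" by linarith
    also have "0 \<le> x * 2 ^ l \<longleftrightarrow> 0 \<le> x" using mult_le_cancel_right_pos[of "2 ^ l" 0 x] by simp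
    finally show ?thesis .
  qed
  show ?thesis unfolding sq_def mem_Times_iff * dyadic_index_def by (cases p) auto
qed

lemma dyadic_index_parent:
  assumes "l \<le> l'" "0 \<le> fst z" "0 \<le> snd z"
  shows "dyadic_index l z = parent (l' - l) (dyadic_index l' z)"
proof -
  have *: "nat \<lfloor>x * 2 ^ l\<rfloor> = nat \<lfloor>x * 2 ^ l'\<rfloor> div 2 ^ (l' - l)" if x: "0 \<le> x" for x :: real
  proof -
    have "(2::real) ^ l' = 2 ^ l * 2 ^ (l' - l)" using assms by (simp add: power_add[symmetric])
    then have "x * 2 ^ l = (x * 2 ^ l') / of_int (2 ^ (l' - l))" by simp
    then have "\<lfloor>x * 2 ^ l\<rfloor> = \<lfloor>x * 2 ^ l'\<rfloor> div 2 ^ (l' - l)" using floor_divide_real_eq_div[of "2 ^ (l' - l)"] by simp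
    then show ?thesis using x by (simp add: nat_div_distrib nat_power_eq)
  qed
  show ?thesis using assms by (simp add: dyadic_index_def parent_def *)
qed

lemma sqp_eq_UN:
  assumes l: "l \<le> l'" and p: "p \<in> grid l"
  shows "sqp l p = (\<Union>p'\<in>{p'\<in>grid l'. parent (l' - l) p' = p}. sqp l' p')"
proof -
  have lt: "i < 2 ^ l'" if "i div 2 ^ (l' - l) < 2 ^ l" for i :: nat
  proof -
    have "i < 2 ^ l * 2 ^ (l' - l)" using that by (simp add: div_less_iff_less_mult)
    then show ?thesis using l by (simp add: power_add[symmetric])
  qed
  have gr: "p' \<in> grid l'" if "parent (l' - l) p' = p" for p'
    using p lt that by (auto simp: grid_def parent_def mem_Times_iff)
  show ?thesis
  proof (rule set_eqI)
    fix z
    show "z \<in> sqp l p \<longleftrightarrow> z \<in> (\<Union>p'\<in>{p'\<in>grid l'. parent (l' - l) p' = p}. sqp l' p')"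
      unfolding UN_iff Bex_def mem_Collect_eq mem_sqp_iff using gr dyadic_index_parent[OF l, of z] by metis
  qed
qed

lemma disjoint_sqp: "disjoint_family_on (sqp l) T"
  unfolding disjoint_family_on_def by (metis disjoint_iff mem_sqp_iff)

lemma parent_grid: "l \<le> l' \<Longrightarrow> p' \<in> grid l' \<Longrightarrow> parent (l' - l) p' \<in> grid l"
  by (auto simp: grid_def parent_def div_less_iff_less_mult power_add[symmetric])

lemma csq_parent:
  assumes l: "l \<le> l'"
  shows "csq l' p' \<subseteq> csq l (parent (l' - l) p')"
proof -
  have h: "(1/2::real) ^ l = 2 ^ (l' - l) * (1/2) ^ l'"
  proof -
    have "(1/2::real) ^ l' = (1/2) ^ (l' - l) * (1/2) ^ l" using l by (simp add: power_add[symmetric])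
    then show ?thesis by (simp add: power_one_over)
  qed
  have *: "{real i * (1/2) ^ l'..(real i + 1) * (1/2) ^ l'} \<subseteq> {real (i div 2 ^ (l' - l)) * (1/2) ^ l..(real (i div 2 ^ (l' - l)) + 1) * (1/2) ^ l}" for i :: nat
  proof -
    define d where "d = i div 2 ^ (l' - l)"
    have "d * 2 ^ (l' - l) \<le> i" "Suc i \<le> (d + 1) * 2 ^ (l' - l)"
      using div_times_less_eq_dividend[of i "2 ^ (l' - l)"] dividend_less_div_times[of "2 ^ (l' - l)" i]
      by (auto simp: d_def algebra_simps Suc_le_eq)
    then have "real (d * 2 ^ (l' - l)) \<le> real i" "real (Suc i) \<le> real ((d + 1) * 2 ^ (l' - l))" by (simp_all only: of_nat_le_iff)
    then have 1: "real d * 2 ^ (l' - l) \<le> real i" "real i + 1 \<le> (real d + 1) * 2 ^ (l' - l)" by (auto simp: algebra_simps)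
    have "real d * (1/2) ^ l \<le> real i * (1/2) ^ l'" "(real i + 1) * (1/2) ^ l' \<le> (real d + 1) * (1/2) ^ l"
      unfolding h using mult_right_mono[OF 1(1), of "(1/2) ^ l'"] mult_right_mono[OF 1(2), of "(1/2) ^ l'"] by (auto simp: mult.assoc)
    then show ?thesis unfolding d_def by auto
  qed
  show ?thesis unfolding csq_def parent_def fst_conv snd_conv by (intro Sigma_mono *)
qed

lemma compact_csq: "compact (csq l p)"
  unfolding csq_def by (intro compact_Times) auto

lemma sq_subset_csq: "sqp l p \<subseteq> csq l p"
  unfolding sq_def csq_def by (intro Sigma_mono) auto

lemma csq_nonempty: "csq l p \<noteq> {}" using sq_nonempty sq_subset_csq by blast

lemma csq_near:
  assumes "z \<in> csq l p" "z' \<in> csq l p"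
  shows "\<bar>fst z - fst z'\<bar> \<le> (1/2) ^ l" "\<bar>snd z - snd z'\<bar> \<le> (1/2) ^ l"
  using assms by (auto simp: csq_def distrib_right)

lemma csq_unit:
  assumes "p \<in> grid l"
  shows "csq l p \<subseteq> {0..1} \<times> {0..1}"
proof -
  have *: "{real i * (1/2) ^ l..(real i + 1) * (1/2) ^ l} \<subseteq> {0..1}" if "i < 2 ^ l" for i :: nat
  proof -
    have "real (Suc i) \<le> real (2 ^ l)" using that by (simp only: of_nat_le_iff Suc_le_eq)
    then have "(real i + 1) * (1/2) ^ l \<le> 2 ^ l * (1/2) ^ l" by (intro mult_right_mono) auto
    also have "\<dots> = 1" by (simp add: power_one_over)
    finally have "(real i + 1) * (1/2) ^ l \<le> 1" .
    then show ?thesis by (auto intro: order_trans)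
  qed
  show ?thesis using assms unfolding csq_def by (intro Sigma_mono *) (auto simp: grid_def)
qed

section \<open>Weights on dyadic grids and one refinement step\<close>

context block_sequence
begin

text \<open>Growth between r and 1 gives g r \<ge> g 1 * r powr \<sigma> / C for r \<le> 1, and r is
  negligible against r powr \<sigma> because \<sigma> < 1.\<close>

lemma linear_le_g:
  assumes A: "0 \<le> A" and \<kappa>: "0 < \<kappa>"
  shows "\<exists>\<delta>>0. \<forall>r. 0 < r \<longrightarrow> r < \<delta> \<longrightarrow> A * r \<le> \<kappa> * g r"
proof -
  define t where "t = \<kappa> * g 1 / (A * C + 1)"
  have g1: "0 < g 1" by (rule g_pos) simp
  have AC: "0 < A * C + 1" using A C_ge_1 by (intro add_nonneg_pos) auto
  have t: "0 < t" using g1 \<kappa> AC by (simp add: t_def)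
  define \<delta> where "\<delta> = min 1 (t powr (1 / (1 - \<sigma>)))"
  have "A * r \<le> \<kappa> * g r" if r: "0 < r" "r < \<delta>" for r
  proof -
    have r1: "r \<le> 1" using r by (simp add: \<delta>_def)
    have gr: "0 < g r" using g_pos[OF r(1)] .
    have "g 1 \<le> C * (1 / r) powr \<sigma> * g r" using r r1 by (intro g_growth)
    then have "r * g 1 \<le> r * (C * (1 / r) powr \<sigma> * g r)" using r by (intro mult_left_mono) auto
    also have "\<dots> = C * r powr (1 - \<sigma>) * g r" using r by (simp add: powr_divide powr_diff)
    finally have 1: "r * g 1 \<le> C * r powr (1 - \<sigma>) * g r" .
    have "r powr (1 - \<sigma>) \<le> (t powr (1 / (1 - \<sigma>))) powr (1 - \<sigma>)" using r sigma by (intro powr_mono2) (auto simp: \<delta>_def)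
    also have "\<dots> = t" using t sigma by (simp add: powr_powr)
    finally have "A * C * r powr (1 - \<sigma>) \<le> A * C * t" using A C_ge_1 by (intro mult_left_mono) auto
    also have "\<dots> \<le> (A * C + 1) * t" using t by (simp add: algebra_simps)
    also have "\<dots> = \<kappa> * g 1" using AC by (simp add: t_def)
    finally have 2: "A * C * r powr (1 - \<sigma>) \<le> \<kappa> * g 1" .
    have "A * (r * g 1) \<le> A * (C * r powr (1 - \<sigma>) * g r)" using A 1 by (intro mult_left_mono)
    also have "\<dots> = (A * C * r powr (1 - \<sigma>)) * g r" by simp
    also have "\<dots> \<le> \<kappa> * g 1 * g r" using 2 gr by (intro mult_right_mono) auto
    finally have "(A * r) * g 1 \<le> (\<kappa> * g r) * g 1" by (simp add: mult_ac)
    then show ?thesis using g1 by simp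
  qed
  moreover have "0 < \<delta>" using t by (simp add: \<delta>_def)
  ultimately show ?thesis by blast
qed

text \<open>D bounds the density with respect to area. The last clause prepares the next refinement:
  mass spread with density D is negligible against the gauge at all radii below the present side. In
  144 = 2 * 72, the 72 comes from 2 * D * (6 * r) ^ 2 and the 2 from spending half of \<kappa> on
  this term.\<close>

definition good_weights :: "real \<Rightarrow> nat \<Rightarrow> (nat \<times> nat \<Rightarrow> real) \<Rightarrow> real \<Rightarrow> bool" where
  "good_weights \<kappa> l m D \<longleftrightarrow> 0 \<le> D \<and> (\<forall>p. 0 \<le> m p) \<and> (\<forall>p\<in>grid l. m p \<le> D * (1/4) ^ l) \<and>
     (\<Sum>p\<in>grid l. m p) = 1 \<and> (\<forall>r. 0 < r \<longrightarrow> r < (1/2) ^ l \<longrightarrow> 144 * (18 + 9 * geom) * D * r \<le> \<kappa> * g r)"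

text \<open>A square that touches B counts with its full weight, so the value can only decrease
  under refinement.\<close>

definition mass :: "nat \<Rightarrow> (nat \<times> nat \<Rightarrow> real) \<Rightarrow> (real \<times> real) set \<Rightarrow> real" where
  "mass l m B = (\<Sum>p\<in>{p\<in>grid l. csq l p \<inter> B \<noteq> {}}. m p)"

text \<open>The mass of every square is preserved exactly, so that no constant accumulates along the construction.\<close>

lemma refine_weights:
  assumes \<kappa>: "0 < \<kappa>" and gw: "good_weights \<kappa> l m D"
  shows "\<exists>l' m' D'. l < l' \<and> good_weights \<kappa> l' m' D' \<and>
     (\<forall>p\<in>grid l. (\<Sum>p'\<in>{p'\<in>grid l'. parent (l' - l) p' = p}. m' p') = m p) \<and>
     (\<forall>p'\<in>grid l'. 0 < m' p' \<longrightarrow> (\<forall>z\<in>csq l' p'. \<exists>q\<ge>N. dist_int (real q * snd z - fst z) < \<psi> q)) \<and>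
     (\<forall>b r. (1/2) ^ l' \<le> r \<longrightarrow> r < (1/2) ^ l \<longrightarrow> mass l' m' (ball b (2 * r)) \<le> \<kappa> * (r * g r))"
proof -
  have D: "0 \<le> D" and m0: "\<And>p. 0 \<le> m p" and mD: "\<And>p. p \<in> grid l \<Longrightarrow> m p \<le> D * (1/4) ^ l"
    and m1: "(\<Sum>p\<in>grid l. m p) = 1"
    and fine: "\<And>r. 0 < r \<Longrightarrow> r < (1/2) ^ l \<Longrightarrow> 144 * (18 + 9 * geom) * D * r \<le> \<kappa> * g r"
    using gw by (auto simp: good_weights_def)
  define C0 where "C0 = 18 + 9 * geom"
  have C0: "0 < C0" using geom_nonneg by (simp add: C0_def)
  \<comment> \<open>Chosen so that 72 * C0 * C * D * \<eta> \<le> \<kappa> / 2; D + 1 avoids a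
    division by zero.\<close>
  define \<eta> where "\<eta> = \<kappa> / (144 * C0 * C * (D + 1))"
  have \<eta>: "0 < \<eta>" using \<kappa> C0 C_ge_1 D by (simp add: \<eta>_def)
  from multiscale_measure_exists[OF \<eta>, of l N] obtain \<nu> P \<epsilon> where
    \<nu>: "sets \<nu> = sets borel" "finite_measure \<nu>" and P: "0 \<le> P" and \<epsilon>: "0 < \<epsilon>"
    and lower': "\<forall>I<2 ^ l. \<forall>J<2 ^ l. (1/4) ^ l / 2 \<le> measure \<nu> (sq l I J)"
    and upper': "\<forall>u v r. 0 < r \<longrightarrow> measure \<nu> ({u..u + r} \<times> {v..v + r}) \<le> (18 + 9 * geom) * (r\<^sup>2 + \<eta> * (r * g r))"
    and dens': "\<forall>A\<in>sets borel. bounded A \<longrightarrow> measure \<nu> A \<le> P * measure lborel A"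
    and supp': "\<forall>A\<in>sets borel. 0 < measure \<nu> A \<longrightarrow> (\<exists>\<theta> x. (\<theta>, x) \<in> A \<and> (\<forall>\<theta>' x'. \<bar>\<theta>' - \<theta>\<bar> \<le> \<epsilon> \<longrightarrow> \<bar>x' - x\<bar> \<le> \<epsilon> \<longrightarrow>
        (\<exists>q\<ge>N. dist_int (real q * x' - \<theta>') < \<psi> q)))"
    by - (elim exE conjE, rule that, assumption+)
  note lower = lower'[rule_format] and upper = upper'[folded C0_def, rule_format]
    and dens = dens'[rule_format] and supp = supp'[rule_format]
  interpret \<nu>: finite_measure \<nu> by (rule \<nu>(2))
  define D' where "D' = 2 * D * P"
  have D': "0 \<le> D'" using D P by (simp add: D'_def)
  obtain \<delta> where \<delta>: "0 < \<delta>" "\<And>r. 0 < r \<Longrightarrow> r < \<delta> \<Longrightarrow> 144 * (18 + 9 * geom) * D' * r \<le> \<kappa> * g r"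
    using linear_le_g[of "144 * (18 + 9 * geom) * D'" \<kappa>] \<kappa> D' geom_nonneg by auto
  obtain l0 where l0: "(1/2) ^ l0 < min \<delta> \<epsilon>" using real_arch_pow_inv[of "min \<delta> \<epsilon>" "1/2"] \<delta> \<epsilon> by auto
  \<comment> \<open>Fine enough for the last clause of \<open>good_weights\<close> with the new
    density D', and for a whole closed square to lie within \<epsilon> of any of its points.\<close>
  define l' where "l' = max l0 (Suc l)"
  have l': "l < l'" by (simp add: l'_def)
  have "(1/2::real) ^ l' \<le> (1/2) ^ l0" by (intro power_decreasing) (auto simp: l'_def)
  moreover have "(1/2) ^ l0 < \<delta>" "(1/2) ^ l0 < \<epsilon>" using l0 by auto
  ultimately have l'2: "(1/2) ^ l' < \<delta>" "(1/2) ^ l' < \<epsilon>" by linarith+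
  define e where "e = l' - l"
  \<comment> \<open>The weight of a square is divided among its descendants in proportion to \<nu>.
    The lower bound on \<nu> keeps each share at most 2 * D times the \<nu>-measure of its
    square.\<close>
  define m' where "m' p' = m (parent e p') * (measure \<nu> (sqp l' p') / measure \<nu> (sqp l (parent e p')))" for p'
  have m'0: "0 \<le> m' p'" for p' using m0 by (simp add: m'_def)
  have low: "(1/4) ^ l / 2 \<le> measure \<nu> (sqp l p)" if "p \<in> grid l" for p
    using that by (intro lower) (auto simp: grid_def)
  have par: "parent e p' \<in> grid l" if "p' \<in> grid l'" for p'
    using parent_grid[of l l' p'] l' that by (simp add: e_def)
  have m'2: "m' p' \<le> 2 * D * measure \<nu> (sqp l' p')" if p': "p' \<in> grid l'" for p'
  proof -
    let ?M = "measure \<nu> (sqp l (parent e p'))"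
    have M: "(1/4) ^ l / 2 \<le> ?M" using low[OF par[OF p']] .
    then have M0: "0 < ?M" by (rule less_le_trans[rotated]) simp
    have "m (parent e p') \<le> D * (1/4) ^ l" using mD[OF par[OF p']] .
    also have "\<dots> \<le> 2 * D * ?M" using mult_left_mono[OF M, of "2 * D"] D by simp
    finally have "m (parent e p') / ?M \<le> 2 * D" using M0 by (simp add: field_simps)
    then have "m (parent e p') / ?M * measure \<nu> (sqp l' p') \<le> 2 * D * measure \<nu> (sqp l' p')" by (intro mult_right_mono) auto
    then show ?thesis by (simp add: m'_def)
  qed
  have pres: "(\<Sum>p'\<in>{p'\<in>grid l'. parent e p' = p}. m' p') = m p" if p: "p \<in> grid l" for p
  proof -
    have "0 < measure \<nu> (sqp l p)" using low[OF p] by (rule less_le_trans[rotated]) simp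
    have "(\<Sum>p'\<in>{p'\<in>grid l'. parent e p' = p}. m' p') = (\<Sum>p'\<in>{p'\<in>grid l'. parent e p' = p}. m p / measure \<nu> (sqp l p) * measure \<nu> (sqp l' p'))"
      by (rule sum.cong) (auto simp: m'_def)
    also have "\<dots> = m p / measure \<nu> (sqp l p) * (\<Sum>p'\<in>{p'\<in>grid l'. parent e p' = p}. measure \<nu> (sqp l' p'))"
      by (simp add: sum_distrib_left)
    also have "(\<Sum>p'\<in>{p'\<in>grid l'. parent e p' = p}. measure \<nu> (sqp l' p')) = measure \<nu> (\<Union>p'\<in>{p'\<in>grid l'. parent e p' = p}. sqp l' p')"
      by (rule \<nu>.finite_measure_finite_Union[symmetric]) (auto simp: \<nu>(1) disjoint_sqp)
    also have "\<dots> = measure \<nu> (sqp l p)" using sqp_eq_UN[of l l' p] l' p by (simp add: e_def)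
    finally show ?thesis using \<open>0 < measure \<nu> (sqp l p)\<close> by simp
  qed
  have tot: "(\<Sum>p'\<in>grid l'. m' p') = 1"
  proof -
    have "(\<Sum>p'\<in>grid l'. m' p') = (\<Sum>p\<in>grid l. \<Sum>p'\<in>{p'\<in>grid l'. parent e p' = p}. m' p')"
      by (rule sum.group[symmetric]) (use par in auto)
    also have "\<dots> = (\<Sum>p\<in>grid l. m p)" by (rule sum.cong[OF refl pres])
    finally show ?thesis using m1 by simp
  qed
  have gw': "good_weights \<kappa> l' m' D'"
    unfolding good_weights_def
  proof (intro conjI ballI allI impI)
    fix p' assume p': "p' \<in> grid l'"
    have "m' p' \<le> 2 * D * measure \<nu> (sqp l' p')" by (rule m'2[OF p'])
    also have "\<dots> \<le> 2 * D * (P * measure lborel (sqp l' p'))" using D by (intro mult_left_mono dens sq_borel bounded_sq) auto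
    also have "\<dots> = D' * (1/4) ^ l'" by (simp add: measure_sq D'_def)
    finally show "m' p' \<le> D' * (1/4) ^ l'" .
  next
    fix r :: real assume "0 < r" "r < (1/2) ^ l'"
    then show "144 * (18 + 9 * geom) * D' * r \<le> \<kappa> * g r" using l'2 by (intro \<delta>(2)) auto
  qed (use D' m'0 tot in auto)
  have strips: "\<exists>q\<ge>N. dist_int (real q * snd z - fst z) < \<psi> q" if p': "0 < m' p'" and z: "z \<in> csq l' p'" for p' z
  proof -
    have "0 < measure \<nu> (sqp l' p')"
    proof (rule ccontr)
      assume "\<not> 0 < measure \<nu> (sqp l' p')"
      then have "measure \<nu> (sqp l' p') = 0" by (metis measure_nonneg order_le_less)
      then show False using p' by (simp add: m'_def)
    qed
    from supp[OF sq_borel this] obtain \<theta> x where tx: "(\<theta>, x) \<in> sqp l' p'"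
      and near: "\<And>\<theta>' x'. \<bar>\<theta>' - \<theta>\<bar> \<le> \<epsilon> \<Longrightarrow> \<bar>x' - x\<bar> \<le> \<epsilon> \<Longrightarrow> \<exists>q\<ge>N. dist_int (real q * x' - \<theta>') < \<psi> q" by blast
    have "(\<theta>, x) \<in> csq l' p'" using tx sq_subset_csq by blast
    from csq_near[OF z this] l'2 show ?thesis by (intro near) auto
  qed
  have balls: "mass l' m' (ball b (2 * r)) \<le> \<kappa> * (r * g r)" if r: "(1/2) ^ l' \<le> r" "r < (1/2) ^ l" for b r
  proof -
    have r0: "0 < r" using r(1) by (rule less_le_trans[rotated]) simp
    have gr: "0 < g r" using g_pos[OF r0] .
    define T where "T = {p\<in>grid l'. csq l' p \<inter> ball b (2 * r) \<noteq> {}}"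
    \<comment> \<open>Half side 3 * r: radius 2 * r of the ball, plus the side of the small squares,
      which is at most r.\<close>
    define Bx where "Bx = {fst b - 3 * r..fst b - 3 * r + 6 * r} \<times> {snd b - 3 * r..snd b - 3 * r + 6 * r}"
    have sub: "sqp l' p \<subseteq> Bx" if "p \<in> T" for p
    proof
      fix z assume z: "z \<in> sqp l' p"
      then have zc: "z \<in> csq l' p" using sq_subset_csq by blast
      from that obtain y where y: "y \<in> csq l' p" "dist b y < 2 * r" by (auto simp: T_def)
      have "\<bar>fst b - fst y\<bar> < 2 * r" "\<bar>snd b - snd y\<bar> < 2 * r"
        using dist_fst_le[of b y] dist_snd_le[of b y] y(2) by (auto simp: dist_real_def)
      with csq_near[OF zc y(1)] r(1) show "z \<in> Bx" unfolding Bx_def mem_Times_iff atLeastAtMost_iff by linarith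
    qed
    have "mass l' m' (ball b (2 * r)) = (\<Sum>p\<in>T. m' p)" by (simp add: mass_def T_def)
    also have "\<dots> \<le> (\<Sum>p\<in>T. 2 * D * measure \<nu> (sqp l' p))" by (intro sum_mono m'2) (auto simp: T_def)
    also have "\<dots> = 2 * D * (\<Sum>p\<in>T. measure \<nu> (sqp l' p))" by (simp add: sum_distrib_left)
    also have "(\<Sum>p\<in>T. measure \<nu> (sqp l' p)) = measure \<nu> (\<Union>p\<in>T. sqp l' p)"
      by (rule \<nu>.finite_measure_finite_Union[symmetric]) (auto simp: \<nu>(1) disjoint_sqp T_def)
    also have "2 * D * \<dots> \<le> 2 * D * measure \<nu> Bx"
    proof (intro mult_left_mono \<nu>.finite_measure_mono)
      show "Bx \<in> sets \<nu>" unfolding \<nu>(1) Bx_def by (intro borel_Times) auto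
    qed (use sub D in auto)
    also have "\<dots> \<le> 2 * D * (C0 * ((6 * r)\<^sup>2 + \<eta> * (6 * r * g (6 * r))))"
      unfolding Bx_def using D r0 by (intro mult_left_mono upper) auto
    also have "\<dots> \<le> 2 * D * (C0 * ((6 * r)\<^sup>2 + \<eta> * (6 * r * (C * 6 * g r))))"
      using D C0 \<eta> r0 g_scale[OF r0, of 6] by (intro mult_left_mono add_left_mono) auto
    also have "\<dots> = r * (72 * C0 * D * r) + r * ((72 * C0 * C * D * \<eta>) * g r)" by (simp add: power2_eq_square algebra_simps)
    also have "\<dots> \<le> r * (\<kappa> / 2 * g r) + r * ((\<kappa> / 2) * g r)"
    proof (intro add_mono mult_left_mono mult_right_mono)
      show "72 * C0 * D * r \<le> \<kappa> / 2 * g r" using fine[OF r0 r(2), folded C0_def] by linarith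
      have "72 * C0 * C * D * \<eta> \<le> 72 * C0 * C * (D + 1) * \<eta>"
        using C0 C_ge_1 \<eta> by (intro mult_right_mono mult_left_mono) auto
      moreover have "144 * C0 * C * (D + 1) * \<eta> = \<kappa>" using C0 C_ge_1 D by (simp add: \<eta>_def)
      ultimately show "72 * C0 * C * D * \<eta> \<le> \<kappa> / 2" by linarith
    qed (use r0 gr in auto)
    also have "\<dots> = \<kappa> * (r * g r)" by simp
    finally show ?thesis .
  qed
  show ?thesis
    by (rule exI[of _ l'], rule exI[of _ m'], rule exI[of _ D'], intro conjI allI ballI impI)
      (rule l' gw' pres[unfolded e_def] strips balls; assumption)+
qed

end

section \<open>The mass distribution argument\<close>

context block_sequence
begin

text \<open>Dependent choice on triples of level, weights and density, step k asking for q \<ge> k.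
  It starts from uniform weights of density 1 on a grid fine enough for
  \<open>good_weights\<close>.\<close>

lemma weights_tree_exists:
  assumes \<kappa>: "0 < \<kappa>"
  shows "\<exists>L M. strict_mono L \<and> (\<forall>k p. 0 \<le> M k p) \<and> (\<forall>k. (\<Sum>p\<in>grid (L k). M k p) = 1) \<and>
     (\<forall>k. \<forall>p\<in>grid (L k). (\<Sum>p'\<in>{p'\<in>grid (L (Suc k)). parent (L (Suc k) - L k) p' = p}. M (Suc k) p') = M k p) \<and>
     (\<forall>k. \<forall>p'\<in>grid (L (Suc k)). 0 < M (Suc k) p' \<longrightarrow> (\<forall>z\<in>csq (L (Suc k)) p'. \<exists>q\<ge>k. dist_int (real q * snd z - fst z) < \<psi> q)) \<and>
     (\<forall>k b r. (1/2) ^ L (Suc k) \<le> r \<longrightarrow> r < (1/2) ^ L k \<longrightarrow> mass (L (Suc k)) (M (Suc k)) (ball b (2 * r)) \<le> \<kappa> * (r * g r))"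
proof -
  define Q where "Q N l m l' m' \<longleftrightarrow> l < l' \<and>
     (\<forall>p\<in>grid l. (\<Sum>p'\<in>{p'\<in>grid l'. parent (l' - l) p' = p}. m' p') = m p) \<and>
     (\<forall>p'\<in>grid l'. 0 < m' p' \<longrightarrow> (\<forall>z\<in>csq l' p'. \<exists>q\<ge>N. dist_int (real q * snd z - fst z) < \<psi> q)) \<and>
     (\<forall>b r. (1/2) ^ l' \<le> r \<longrightarrow> r < (1/2) ^ l \<longrightarrow> mass l' m' (ball b (2 * r)) \<le> \<kappa> * (r * g r))"
    for N l l' :: nat and m m' :: "nat \<times> nat \<Rightarrow> real"
  have "\<exists>s. good_weights \<kappa> (fst s) (fst (snd s)) (snd (snd s))"
  proof -
    obtain \<delta> where \<delta>: "0 < \<delta>" "\<And>r. 0 < r \<Longrightarrow> r < \<delta> \<Longrightarrow> 144 * (18 + 9 * geom) * 1 * r \<le> \<kappa> * g r"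
      using linear_le_g[of "144 * (18 + 9 * geom) * 1" \<kappa>] \<kappa> geom_nonneg by auto
    obtain l where l: "(1/2) ^ l < \<delta>" using real_arch_pow_inv[OF \<delta>(1), of "1/2"] by auto
    have "good_weights \<kappa> l (\<lambda>_. (1/4) ^ l) 1"
      unfolding good_weights_def using \<delta> l by (auto simp: card_grid power_one_over)
    then show ?thesis by (intro exI[of _ "(l, (\<lambda>_. (1/4) ^ l), 1)"]) simp
  qed
  moreover have "\<exists>s'. good_weights \<kappa> (fst s') (fst (snd s')) (snd (snd s')) \<and> Q N (fst s) (fst (snd s)) (fst s') (fst (snd s'))"
    if gw: "good_weights \<kappa> (fst s) (fst (snd s)) (snd (snd s))" for N s
  proof -
    obtain l' m' D' where "l' > fst s" "good_weights \<kappa> l' m' D'" "Q N (fst s) (fst (snd s)) l' m'"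
      using refine_weights[OF \<kappa> gw, of N] unfolding Q_def by blast
    then show ?thesis by (intro exI[of _ "(l', m', D')"]) simp
  qed
  ultimately obtain F where F: "\<And>k. good_weights \<kappa> (fst (F k)) (fst (snd (F k))) (snd (snd (F k)))"
    "\<And>k. Q k (fst (F k)) (fst (snd (F k))) (fst (F (Suc k))) (fst (snd (F (Suc k))))"
    using dependent_nat_choice[of "\<lambda>_ s. good_weights \<kappa> (fst s) (fst (snd s)) (snd (snd s))"
        "\<lambda>k s s'. Q k (fst s) (fst (snd s)) (fst s') (fst (snd s'))"] by metis
  have "strict_mono (\<lambda>k. fst (F k))" using F(2) by (auto simp: Q_def intro!: strict_monoI_Suc)
  then show ?thesis
    using F unfolding Q_def good_weights_def
    by (intro exI[of _ "\<lambda>k. fst (F k)"] exI[of _ "\<lambda>k. fst (snd (F k))"]) simp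
qed

text \<open>The case d = 1 of \<open>W_set\<close>, written with pairs of reals.\<close>

definition limsup_set :: "(real \<times> real) set" where
  "limsup_set = {(\<theta>, x) \<in> {0..1} \<times> {0..1}. infinite {q. q \<ge> 1 \<and> dist_int (real q * x - \<theta>) < \<psi> q}}"

text \<open>No limit measure is formed. An open cover of the intersection of the nested compact sets
  E k already covers some E k, and finitely many of its members do. The total mass 1, read off at
  one level whose side is below all their radii, then bounds the sum of the gauges from
  below.\<close>

lemma hausdorff_pre_limsup_set_ge:
  assumes \<kappa>: "0 < \<kappa>"
  shows "\<exists>\<rho>>0. ennreal (1 / (2 * \<kappa>)) \<le> hausdorff_pre (\<lambda>r. r * g r) \<rho> limsup_set"
proof -
  from weights_tree_exists[OF \<kappa>] obtain L M where L: "strict_mono L" and M0': "\<forall>k p. 0 \<le> M k p"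
    and M1': "\<forall>k. (\<Sum>p\<in>grid (L k). M k p) = 1"
    and pres': "\<forall>k. \<forall>p\<in>grid (L k). (\<Sum>p'\<in>{p'\<in>grid (L (Suc k)). parent (L (Suc k) - L k) p' = p}. M (Suc k) p') = M k p"
    and strips': "\<forall>k. \<forall>p'\<in>grid (L (Suc k)). 0 < M (Suc k) p' \<longrightarrow> (\<forall>z\<in>csq (L (Suc k)) p'. \<exists>q\<ge>k. dist_int (real q * snd z - fst z) < \<psi> q)"
    and balls': "\<forall>k b r. (1/2) ^ L (Suc k) \<le> r \<longrightarrow> r < (1/2) ^ L k \<longrightarrow> mass (L (Suc k)) (M (Suc k)) (ball b (2 * r)) \<le> \<kappa> * (r * g r)"
    by - (elim exE conjE, rule that, assumption+)
  note M0 = M0'[rule_format] and M1 = M1'[rule_format] and pres = pres'[rule_format]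
    and strips = strips'[rule_format] and balls = balls'[rule_format]
  have LS: "L k \<le> L (Suc k)" for k using L by (simp add: strict_mono_def less_imp_le)
  have LK: "k \<le> L k" for k using L by (rule strict_mono_imp_increasing)
  have par: "parent (L (Suc k) - L k) p' \<in> grid (L k)" if "p' \<in> grid (L (Suc k))" for k p'
    by (rule parent_grid[OF LS that])
  define E where "E k = (\<Union>p\<in>{p\<in>grid (L k). 0 < M k p}. csq (L k) p)" for k
  have Ecomp: "compact (E k)" for k unfolding E_def by (intro compact_UN compact_csq) auto
  have Esub: "E (Suc k) \<subseteq> E k" for k
  proof
    fix z assume "z \<in> E (Suc k)"
    then obtain p' where p': "p' \<in> grid (L (Suc k))" "0 < M (Suc k) p'" "z \<in> csq (L (Suc k)) p'" by (auto simp: E_def)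
    let ?p = "parent (L (Suc k) - L k) p'"
    have "M (Suc k) p' \<le> (\<Sum>p''\<in>{p''\<in>grid (L (Suc k)). parent (L (Suc k) - L k) p'' = ?p}. M (Suc k) p'')"
      using p' M0 by (intro member_le_sum) auto
    then have "0 < M k ?p" using p'(2) pres[OF par[OF p'(1)]] by linarith
    moreover have "z \<in> csq (L k) ?p" using csq_parent[OF LS, of k p'] p'(3) by blast
    ultimately show "z \<in> E k" using par[OF p'(1)] unfolding E_def by blast
  qed
  have Emono: "E j \<subseteq> E k" if "k \<le> j" for j k
    using that by (rule lift_Suc_antimono_le[of E, rotated]) (rule Esub)
  have Elim: "(\<Inter>k. E k) \<subseteq> limsup_set"
  proof
    fix z assume z: "z \<in> (\<Inter>k. E k)"
    have "z \<in> {0..1} \<times> {0..1}" using z csq_unit by (auto simp: E_def simp del: atLeastAtMost_iff) blast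
    moreover have "infinite {q. q \<ge> 1 \<and> dist_int (real q * snd z - fst z) < \<psi> q}"
      unfolding infinite_nat_iff_unbounded_le
    proof
      fix N
      have "z \<in> E (Suc (Suc N))" using z by blast
      then obtain p' where "p' \<in> grid (L (Suc (Suc N)))" "0 < M (Suc (Suc N)) p'" "z \<in> csq (L (Suc (Suc N))) p'" by (auto simp: E_def)
      from strips[OF this] obtain q where "q \<ge> Suc N" "dist_int (real q * snd z - fst z) < \<psi> q" by blast
      then show "\<exists>q\<ge>N. q \<in> {q. q \<ge> 1 \<and> dist_int (real q * snd z - fst z) < \<psi> q}" by (intro exI[of _ q]) auto
    qed
    ultimately show "z \<in> limsup_set" by (cases z) (simp add: limsup_set_def)
  qed
  have mass_Suc: "mass (L (Suc k)) (M (Suc k)) B \<le> mass (L k) (M k) B" for k B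
  proof -
    let ?e = "L (Suc k) - L k"
    define T' where "T' = {p\<in>grid (L (Suc k)). csq (L (Suc k)) p \<inter> B \<noteq> {}}"
    define T where "T = {p\<in>grid (L k). csq (L k) p \<inter> B \<noteq> {}}"
    have sub: "parent ?e ` T' \<subseteq> T"
      using par csq_parent[OF LS] by (fastforce simp: T_def T'_def)
    have "(\<Sum>p'\<in>T'. M (Suc k) p') = (\<Sum>p\<in>T. \<Sum>p'\<in>{p'\<in>T'. parent ?e p' = p}. M (Suc k) p')"
      by (rule sum.group[symmetric]) (use sub in \<open>auto simp: T_def T'_def\<close>)
    also have "\<dots> \<le> (\<Sum>p\<in>T. \<Sum>p'\<in>{p'\<in>grid (L (Suc k)). parent ?e p' = p}. M (Suc k) p')"
      using M0 by (intro sum_mono sum_mono2) (auto simp: T'_def)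
    also have "\<dots> = (\<Sum>p\<in>T. M k p)" by (intro sum.cong refl pres) (simp add: T_def)
    finally show ?thesis by (simp add: mass_def T_def T'_def)
  qed
  have mass_mono: "mass (L j) (M j) B \<le> mass (L k) (M k) B" if "k \<le> j" for j k B
    using that by (rule lift_Suc_antimono_le[of "\<lambda>k. mass (L k) (M k) B", rotated]) (rule mass_Suc)
  have mass_ball: "mass (L K) (M K) (ball b (2 * r)) \<le> \<kappa> * (r * g r)" if r: "(1/2) ^ L K \<le> r" "r < (1/2) ^ L 0" for K b r
  proof -
    \<comment> \<open>The first level with side at most r. The side before it exceeds r, so the ball
      estimate applies exactly here, and \<open>mass_mono\<close> passes it on to all later
      levels.\<close>
    define k where "k = (LEAST k. (1/2) ^ L k \<le> r)"
    have k1: "(1/2) ^ L k \<le> r" unfolding k_def using r(1) by (rule LeastI)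
    have kK: "k \<le> K" unfolding k_def using r(1) by (rule Least_le)
    have "k \<noteq> 0"
    proof
      assume "k = 0"
      with k1 r(2) show False by simp
    qed
    then obtain j where j: "k = Suc j" by (cases k) auto
    have "\<not> (1/2) ^ L j \<le> r" using not_less_Least[of j "\<lambda>k. (1/2) ^ L k \<le> r"] j by (simp add: k_def)
    then have "mass (L k) (M k) (ball b (2 * r)) \<le> \<kappa> * (r * g r)" using k1 unfolding j by (intro balls) auto
    then show ?thesis using mass_mono[OF kK, of "ball b (2 * r)"] by linarith
  qed
  let ?G = "\<lambda>r. r * g r"
  define \<rho> where "\<rho> = (1/2::real) ^ L 0 / 2"
  have \<rho>: "0 < \<rho>" "\<rho> < (1/2) ^ L 0" "\<rho> \<le> 1"
    using power_le_one[of "1/2::real" "L 0"] zero_less_power[of "1/2::real" "L 0"] unfolding \<rho>_def by linarith+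
  have g1: "0 < g 1" by (rule g_pos) simp
  have "ennreal (1 / (2 * \<kappa>)) \<le> (\<Sum>j. gauge_diam ?G (B j))" if B: "B \<in> fine_covers \<rho> limsup_set" for B
  proof -
    have bd: "bounded (B j)" "diameter (B j) \<le> \<rho>" "0 \<le> diameter (B j)" for j
      using B by (auto simp: fine_covers_def diameter_ge_0)
    \<comment> \<open>Sets of diameter 0 cost nothing in the gauge but have to be enlarged to balls.
      The allowances t j for this total 1 / (2 * \<kappa>), which corresponds to mass 1/2.\<close>
    define t where "t j = (1 / (2 * \<kappa>)) * (1/2) ^ Suc j" for j
    have t0: "0 < t j" for j using \<kappa> by (simp add: t_def)
    define r where "r j = (if diameter (B j) = 0 then min \<rho> (t j / g 1) else diameter (B j))" for j
    have r0: "0 < r j" "r j < (1/2) ^ L 0" "diameter (B j) \<le> r j" for j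
      using bd[of j] \<rho> t0[of j] g1 by (auto simp: r_def)
    define gg where "gg j = (if diameter (B j) = 0 then 0 else ?G (diameter (B j)))" for j
    have gg: "gauge_diam ?G (B j) = ennreal (gg j)" for j by (simp add: gauge_diam_def gg_def)
    have gg0: "0 \<le> gg j" for j using bd(3)[of j] g_pos[of "diameter (B j)"] by (auto simp: gg_def)
    have rg: "?G (r j) \<le> gg j + t j" for j
    proof (cases "diameter (B j) = 0")
      case True
      have "r j * g (r j) \<le> (t j / g 1) * g 1"
        using True r0[of j] \<rho> t0[of j] g1 by (intro mult_mono g_mono less_imp_le[OF g_pos]) (auto simp: r_def)
      then show ?thesis using True g1 by (simp add: gg_def)
    next
      case False
      then show ?thesis using t0[of j] by (simp add: r_def gg_def)
    qed
    define b where "b j = (SOME z. z \<in> B j)" for j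
    define W where "W j = (if B j = {} then {} else ball (b j) (2 * r j))" for j
    have BW: "B j \<subseteq> W j" for j
    proof
      fix z assume z: "z \<in> B j"
      then have "b j \<in> B j" by (auto simp: b_def intro: someI)
      then have "dist (b j) z \<le> r j" using diameter_bounded_bound[OF bd(1), of "b j" j z] z r0(3)[of j] by linarith
      then show "z \<in> W j" using r0(1)[of j] z by (auto simp: W_def)
    qed
    have openW: "open (W j)" for j by (simp add: W_def)
    have cov: "limsup_set \<subseteq> (\<Union>j. W j)" using B BW by (auto simp: fine_covers_def) blast
    have "\<exists>k. E k - (\<Union>j. W j) = {}"
    proof (rule ccontr)
      assume "\<not> (\<exists>k. E k - (\<Union>j. W j) = {})"
      then have "(\<Inter>k. E k - (\<Union>j. W j)) \<noteq> {}"
        using Emono openW by (intro compact_nest compact_diff Ecomp open_UN) (auto, blast)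
      then show False using Elim cov by auto
    qed
    then obtain k where k: "E k \<subseteq> (\<Union>j. W j)" by blast
    obtain J where J: "finite J" "E k \<subseteq> (\<Union>j\<in>J. W j)"
      using compactE_image[OF Ecomp, of UNIV W k] openW k by auto
    define \<delta> where "\<delta> = Min (insert 1 (r ` J))"
    have "0 < \<delta>" using J(1) r0 by (auto simp: \<delta>_def)
    then obtain N where N: "(1/2) ^ N < \<delta>" using real_arch_pow_inv[of \<delta> "1/2"] by auto
    have rN: "(1/2) ^ N \<le> r j" if "j \<in> J" for j
    proof -
      have "\<delta> \<le> r j" using J(1) that by (auto simp: \<delta>_def)
      then show ?thesis using N by linarith
    qed
    \<comment> \<open>Beyond k, so that squares of positive weight lie in the finite cover, and
      beyond N, so that every radius is at least the side.\<close>
    define K where "K = max k N"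
    have rK: "(1/2) ^ L K \<le> r j" if "j \<in> J" for j
    proof -
      have "N \<le> L K" using LK[of K] by (simp add: K_def)
      then have "(1/2::real) ^ L K \<le> (1/2) ^ N" by (intro power_decreasing) auto
      then show ?thesis using rN[OF that] by linarith
    qed
    have "1 = (\<Sum>p\<in>grid (L K). M K p)" using M1 by simp
    also have "\<dots> \<le> (\<Sum>p\<in>grid (L K). \<Sum>j\<in>J. if csq (L K) p \<inter> W j \<noteq> {} then M K p else 0)"
    proof (rule sum_mono)
      fix p assume p: "p \<in> grid (L K)"
      show "M K p \<le> (\<Sum>j\<in>J. if csq (L K) p \<inter> W j \<noteq> {} then M K p else 0)"
      proof (cases "M K p = 0")
        case True
        then show ?thesis by (simp add: sum_nonneg)
      next
        case False
        then have pos: "0 < M K p" using M0[of K p] by linarith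
        obtain z where z: "z \<in> csq (L K) p" using csq_nonempty by blast
        have "z \<in> E K" using z p pos unfolding E_def by blast
        then have "z \<in> E k" using Emono[of k K] by (auto simp: K_def)
        then obtain j where j: "j \<in> J" "z \<in> W j" using J(2) by blast
        have "M K p = (if csq (L K) p \<inter> W j \<noteq> {} then M K p else 0)" using z j by auto
        also have "\<dots> \<le> (\<Sum>j\<in>J. if csq (L K) p \<inter> W j \<noteq> {} then M K p else 0)"
          by (rule member_le_sum[OF j(1), where f = "\<lambda>j. if csq (L K) p \<inter> W j \<noteq> {} then M K p else 0"]) (use M0 J(1) in auto)
        finally show ?thesis .
      qed
    qed
    also have "\<dots> = (\<Sum>j\<in>J. \<Sum>p\<in>grid (L K). if csq (L K) p \<inter> W j \<noteq> {} then M K p else 0)" by (rule sum.swap)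
    also have "\<dots> = (\<Sum>j\<in>J. mass (L K) (M K) (W j))" unfolding mass_def by (simp only: sum.inter_filter[OF finite_grid])
    also have "\<dots> \<le> (\<Sum>j\<in>J. \<kappa> * (gg j + t j))"
    proof (rule sum_mono)
      fix j assume j: "j \<in> J"
      show "mass (L K) (M K) (W j) \<le> \<kappa> * (gg j + t j)"
      proof (cases "B j = {}")
        case True
        then have "mass (L K) (M K) (W j) = 0" by (simp add: W_def mass_def)
        then show ?thesis using \<kappa> gg0[of j] t0[of j] by simp
      next
        case False
        then have "mass (L K) (M K) (W j) \<le> \<kappa> * (r j * g (r j))" unfolding W_def using rK[OF j] r0(2) by (simp add: mass_ball)
        also have "\<dots> \<le> \<kappa> * (gg j + t j)" using \<kappa> rg by (intro mult_left_mono) auto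
        finally show ?thesis .
      qed
    qed
    also have "\<dots> = \<kappa> * (\<Sum>j\<in>J. gg j) + \<kappa> * (\<Sum>j\<in>J. t j)" by (simp add: sum_distrib_left sum.distrib distrib_left)
    also have "\<kappa> * (\<Sum>j\<in>J. t j) \<le> 1/2"
    proof -
      have "(\<Sum>j\<in>J. (1/2::real) ^ Suc j) \<le> (\<Sum>j. (1/2) ^ Suc j)"
        using J(1) power_half_series by (intro sum_le_suminf) (auto simp: sums_iff)
      also have "\<dots> = 1" using power_half_series by (simp add: sums_iff)
      finally have h: "(\<Sum>j\<in>J. (1/2::real) ^ Suc j) \<le> 1" .
      have "\<kappa> * (\<Sum>j\<in>J. t j) = \<kappa> * (1 / (2 * \<kappa>)) * (\<Sum>j\<in>J. (1/2) ^ Suc j)"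
        unfolding t_def sum_distrib_left[symmetric] by (simp only: mult.assoc)
      also have "\<kappa> * (1 / (2 * \<kappa>)) = 1/2" using \<kappa> by simp
      finally show ?thesis using h by linarith
    qed
    finally have "1/2 \<le> \<kappa> * (\<Sum>j\<in>J. gg j)" by simp
    then have "1 / (2 * \<kappa>) \<le> (\<Sum>j\<in>J. gg j)" using \<kappa> by (simp add: field_simps)
    then have "ennreal (1 / (2 * \<kappa>)) \<le> ennreal (\<Sum>j\<in>J. gg j)" by (rule ennreal_leI)
    also have "\<dots> = (\<Sum>j\<in>J. gauge_diam ?G (B j))" unfolding gg using gg0 by (intro sum_ennreal[symmetric]) auto
    also have "\<dots> \<le> (\<Sum>j. gauge_diam ?G (B j))" using J(1) by (intro sum_le_suminf) auto
    finally show ?thesis .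
  qed
  then have "ennreal (1 / (2 * \<kappa>)) \<le> hausdorff_pre ?G \<rho> limsup_set" unfolding hausdorff_pre_def by (rule INF_greatest)
  then show ?thesis using \<rho>(1) by blast
qed

lemma hausdorff_measure_limsup_set: "hausdorff_measure (\<lambda>r. r * g r) limsup_set = \<infinity>"
proof -
  have "ennreal c \<le> hausdorff_measure (\<lambda>r. r * g r) limsup_set" if c: "0 < c" for c
  proof -
    obtain \<rho> where \<rho>: "0 < \<rho>" "ennreal (1 / (2 * (1 / (2 * c)))) \<le> hausdorff_pre (\<lambda>r. r * g r) \<rho> limsup_set"
      using hausdorff_pre_limsup_set_ge[of "1 / (2 * c)"] c by auto
    have "hausdorff_pre (\<lambda>r. r * g r) \<rho> limsup_set \<le> hausdorff_measure (\<lambda>r. r * g r) limsup_set"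
      unfolding hausdorff_measure_eq_SUP using \<rho>(1) by (intro SUP_upper) auto
    with \<rho>(2) c show ?thesis by (simp add: order_trans)
  qed
  note ge = this
  show ?thesis
  proof (rule ccontr)
    assume "hausdorff_measure (\<lambda>r. r * g r) limsup_set \<noteq> \<infinity>"
    then obtain c where c: "0 \<le> c" "hausdorff_measure (\<lambda>r. r * g r) limsup_set = ennreal c"
      by (cases "hausdorff_measure (\<lambda>r. r * g r) limsup_set") auto
    with ge[of "c + 1"] show False by (simp del: ennreal_plus)
  qed
qed

end

section \<open>The zero-infinity law\<close>

lemma hausdorff_measure_cong:
  assumes "\<And>r. 0 < r \<Longrightarrow> F r = F' r"
  shows "hausdorff_measure F S = hausdorff_measure F' S"
proof -
  have "gauge_diam F (B i) = gauge_diam F' (B i)" if "B \<in> fine_covers \<rho> S" for B \<rho> and i :: nat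
  proof -
    have "0 \<le> diameter (B i)" using that by (auto simp: fine_covers_def diameter_ge_0)
    then show ?thesis using assms[of "diameter (B i)"] by (simp add: gauge_diam_def)
  qed
  then have "hausdorff_pre F \<rho> S = hausdorff_pre F' \<rho> S" for \<rho>
    unfolding hausdorff_pre_def by (intro INF_cong) auto
  then show ?thesis by (simp add: hausdorff_measure_eq_SUP)
qed

lemma prod_dist_int_le:
  fixes y :: "'n::finite \<Rightarrow> real"
  shows "(\<Prod>i\<in>UNIV. dist_int (y i)) \<le> dist_int (y k)"
proof -
  have "(\<Prod>i\<in>UNIV. dist_int (y i)) = dist_int (y k) * (\<Prod>i\<in>UNIV - {k}. dist_int (y i))" by (simp add: prod.remove)
  also have "\<dots> \<le> dist_int (y k) * 1"
  proof (intro mult_left_mono prod_le_1 conjI dist_int_nonneg)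
    fix i show "dist_int (y i) \<le> 1" using dist_int_le_half[of "y i"] by linarith
  qed
  finally show ?thesis by simp
qed

context gauge_growth
begin

text \<open>By \<open>g_scale\<close> every term is at least g c / C. This serves increasing \<psi>,
  which are bounded below by \<psi> 1.\<close>

lemma not_summable_const:
  assumes c: "0 < c"
  shows "\<not> summable (\<lambda>q. real (Suc q) * g (c / real (Suc q)))"
proof
  assume "summable (\<lambda>q. real (Suc q) * g (c / real (Suc q)))"
  then have "(\<lambda>q. real (Suc q) * g (c / real (Suc q))) \<longlonglongrightarrow> 0" by (rule summable_LIMSEQ_zero)
  moreover have "0 < g c / C" using g_pos[OF c] C_ge_1 by simp
  ultimately have "\<forall>\<^sub>F q in sequentially. real (Suc q) * g (c / real (Suc q)) < g c / C" by (rule order_tendstoD)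
  then obtain q where q: "real (Suc q) * g (c / real (Suc q)) < g c / C" by (auto simp: eventually_sequentially)
  have "g (real (Suc q) * (c / real (Suc q))) \<le> C * real (Suc q) * g (c / real (Suc q))"
    using c by (intro g_scale) auto
  then have "g c \<le> C * (real (Suc q) * g (c / real (Suc q)))" by (simp add: mult.assoc)
  then show False using q C_ge_1 by (simp add: field_simps)
qed

text \<open>A smaller \<phi> only shrinks the set, so an increasing \<psi> can be replaced by the
  constant \<psi> 1, which is also decreasing. Infinite measure in the plane is then transported by
  slicing along one coordinate k, whose distance dominates the product of all distances.\<close>

lemma hausdorff_measure_W_set_eq_infinity:
  fixes \<psi> :: "nat \<Rightarrow> real"
  assumes psi: "\<And>q. q \<ge> 1 \<Longrightarrow> \<psi> q > 0" and mon: "mono_on {1..} \<psi> \<or> antimono_on {1..} \<psi>"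
    and nsum: "\<not> summable (\<lambda>q. real (Suc q) * g (\<psi> (Suc q) / real (Suc q)))"
  shows "hausdorff_measure (\<lambda>x. x ^ (2 * CARD('n::finite) - 1) * g x) (W_set \<psi> :: ((real ^ 'n) \<times> (real ^ 'n)) set) = \<infinity>"
proof -
  obtain \<phi> where \<phi>: "\<And>q. q \<ge> 1 \<Longrightarrow> 0 < \<phi> q" "\<And>q q'. 1 \<le> q \<Longrightarrow> q \<le> q' \<Longrightarrow> \<phi> q' \<le> \<phi> q"
    "\<not> summable (\<lambda>q. real (Suc q) * g (\<phi> (Suc q) / real (Suc q)))" and le: "\<And>q. q \<ge> 1 \<Longrightarrow> \<phi> q \<le> \<psi> q"
    using mon
  proof
    assume m: "mono_on {1..} \<psi>"
    show thesis
    proof (rule that[of "\<lambda>_. \<psi> 1"])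
      show "\<not> summable (\<lambda>q. real (Suc q) * g (\<psi> 1 / real (Suc q)))" using psi by (intro not_summable_const) auto
      show "\<psi> 1 \<le> \<psi> q" if "q \<ge> 1" for q using m that by (auto intro: mono_onD)
    qed (use psi in auto)
  next
    assume m: "antimono_on {1..} \<psi>"
    show thesis
    proof (rule that[of \<psi>])
      show "\<psi> q' \<le> \<psi> q" if "1 \<le> q" "q \<le> q'" for q q' using m that by (auto simp: monotone_on_def)
    qed (use psi nsum in auto)
  qed
  obtain n where n: "strict_mono n" "\<And>k. (1/2) ^ n k \<le> (1/4::real) ^ k"
    "\<And>k q. 2 ^ k \<le> q \<Longrightarrow> q < 2 ^ (k + 1) \<Longrightarrow> 2 ^ (k + 4) * (1/2) ^ n k \<le> \<phi> q"
    "\<not> summable (\<lambda>k. 4 ^ k * g ((1/2) ^ n k))"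
    using block_scales[OF \<phi>] by blast
  interpret block_sequence g \<sigma> C n \<phi> by unfold_locales (fact n)+
  let ?W = "W_set \<psi> :: ((real ^ 'n) \<times> (real ^ 'n)) set"
  let ?F = "\<lambda>x. x ^ (2 * CARD('n) - 1) * g x"
  let ?c = "ennreal (4 ^ (CARD('n) - 1))"
  obtain k :: 'n where True by simp
  have pre: "hausdorff_pre (\<lambda>r. r * g r) \<rho> limsup_set \<le> ?c * hausdorff_pre ?F \<rho> ?W" for \<rho>
  proof -
    have "(\<lambda>r. r ^ (2 * (CARD('n) - 1)) * (r * g r)) = ?F"
    proof
      fix r :: real
      have "2 * CARD('n) - 1 = Suc (2 * (CARD('n) - 1))" using zero_less_card_finite[where 'a = 'n] by linarith
      then show "r ^ (2 * (CARD('n) - 1)) * (r * g r) = ?F r" by simp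
    qed
    moreover have "hausdorff_pre (\<lambda>r. r * g r) \<rho> limsup_set \<le> ?c * hausdorff_pre (\<lambda>r. r ^ (2 * (CARD('n) - 1)) * (r * g r)) \<rho> ?W"
    proof (rule hausdorff_pre_slice_le[where k = k])
      fix \<theta> x :: "real ^ 'n" assume cb: "\<theta> \<in> cbox 0 1" "x \<in> cbox 0 1" and "(\<theta> $ k, x $ k) \<in> limsup_set"
      then have "infinite {q. q \<ge> 1 \<and> dist_int (real q * x $ k - \<theta> $ k) < \<phi> q}" by (simp add: limsup_set_def)
      moreover have "{q. q \<ge> 1 \<and> dist_int (real q * x $ k - \<theta> $ k) < \<phi> q} \<subseteq>
          {q. q \<ge> 1 \<and> (\<Prod>i\<in>UNIV. dist_int (real q * x $ i - \<theta> $ i)) < \<psi> q}"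
        by (auto intro!: le_less_trans[OF prod_dist_int_le[where k = k]] less_le_trans[OF _ le])
      ultimately have "x \<in> W_fibre \<psi> \<theta>" unfolding W_fibre_def using infinite_super by blast
      then show "(\<theta>, x) \<in> ?W" using cb by (simp add: W_set_def)
    next
      show "limsup_set \<subseteq> {0..1} \<times> {0..1}" by (auto simp: limsup_set_def)
      show "r * g r \<le> r' * g r'" if "0 < r" "r \<le> r'" for r r'
        using that g_pos[of r] by (intro mult_mono g_mono) auto
      show "0 \<le> r * g r" if "0 < r" for r using g_pos[OF that] that by simp
    qed
    ultimately show ?thesis by simp
  qed
  show ?thesis
  proof (rule ccontr)
    assume H: "hausdorff_measure ?F ?W \<noteq> \<infinity>"
    have "hausdorff_pre (\<lambda>r. r * g r) \<rho> limsup_set \<le> ?c * hausdorff_measure ?F ?W" if "0 < \<rho>" for \<rho>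
    proof -
      have "hausdorff_pre ?F \<rho> ?W \<le> hausdorff_measure ?F ?W"
        unfolding hausdorff_measure_eq_SUP using that by (intro SUP_upper) auto
      then show ?thesis using order_trans[OF pre[of \<rho>]] by (simp add: mult_left_mono)
    qed
    then have "hausdorff_measure (\<lambda>r. r * g r) limsup_set \<le> ?c * hausdorff_measure ?F ?W"
      unfolding hausdorff_measure_eq_SUP[of "\<lambda>r. r * g r"] by (intro SUP_least) auto
    moreover have "?c * hausdorff_measure ?F ?W < \<infinity>" using H by (simp add: ennreal_mult_less_top less_top)
    ultimately show False using hausdorff_measure_limsup_set by simp
  qed
qed

end

theorem theorem6:
  fixes \<psi> :: "nat \<Rightarrow> real" and f :: "real \<Rightarrow> real"
  assumes psi_pos: "\<And>q. q \<ge> 1 \<Longrightarrow> \<psi> q > 0"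
    and dim_f: "dimension_function f"
    and I: "\<exists>s C. real CARD('n) - 1 < s \<and> s < real CARD('n) \<and> C > 0 \<and>
              (\<forall>x y. 0 < x \<and> x < y \<longrightarrow> f y \<le> C * (y / x) powr s * f x)"
    and II: "mono_on {0<..} (\<lambda>x. x powi (1 - int CARD('n)) * f x)"
  shows "((\<Sum>q. ennreal (real (Suc q) ^ CARD('n) * \<psi> (Suc q) powi (1 - int CARD('n)) *
             f (\<psi> (Suc q) / real (Suc q)))) < \<infinity> \<longrightarrow>
           hausdorff_measure (\<lambda>x. x ^ CARD('n) * f x)
             (W_set \<psi> \<inter> (cbox 0 1 \<times> cbox 0 1) :: ((real ^ 'n) \<times> (real ^ 'n)) set) = 0) \<and>
         ((\<Sum>q. ennreal (real (Suc q) ^ CARD('n) * \<psi> (Suc q) powi (1 - int CARD('n)) *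
             f (\<psi> (Suc q) / real (Suc q)))) = \<infinity> \<and>
           (mono_on {1..} \<psi> \<or> antimono_on {1..} \<psi>) \<longrightarrow>
           hausdorff_measure (\<lambda>x. x ^ CARD('n) * f x)
             (W_set \<psi> \<inter> (cbox 0 1 \<times> cbox 0 1) :: ((real ^ 'n) \<times> (real ^ 'n)) set) = \<infinity>)"
proof -
  define d where "d = CARD('n)"
  have d: "d \<ge> 1" by (simp add: d_def Suc_leI)
  obtain s C where sC: "real d - 1 < s" "s < real d" "C > 0"
    "\<And>x y. 0 < x \<Longrightarrow> x < y \<Longrightarrow> f y \<le> C * (y / x) powr s * f x"
    using I unfolding d_def by blast
  define g where "g x = x powi (1 - int d) * f x" for x :: real
  have f_pos: "0 < f x" if "0 < x" for x using dim_f that by (simp add: dimension_function_def)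
  have fg: "x ^ d * f x = x ^ (2 * d - 1) * g x" if x: "0 < x" for x
  proof -
    have "x ^ (2 * d - 1) * x powi (1 - int d) = x powi (int (2 * d - 1) + (1 - int d))"
      using x by (simp add: power_int_add)
    also have "int (2 * d - 1) + (1 - int d) = int d" using d by simp
    finally show ?thesis by (simp add: g_def mult.assoc[symmetric])
  qed
  \<comment> \<open>The range d - 1 < s < d becomes 0 < \<sigma> < 1. The maximum with 1 takes care
    of x = y, which the strict inequality in (I) leaves out.\<close>
  interpret gauge_growth g "s - real d + 1" "max C 1"
  proof
    show gp: "0 < g x" if "0 < x" for x using that f_pos[OF that] by (simp add: g_def zero_less_power_int)
    show "g x \<le> g y" if "0 < x" "x \<le> y" for x y
      using mono_onD[OF II, of x y] that by (simp add: g_def d_def)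
    show "g y \<le> max C 1 * (y / x) powr (s - real d + 1) * g x" if x: "0 < x" "x \<le> y" for x y
    proof (cases "x = y")
      case True
      have "1 * g y \<le> max C 1 * g y" using gp[of y] x by (intro mult_right_mono) auto
      then show ?thesis using True x by simp
    next
      case False
      then have xy: "0 < x" "x < y" using x by auto
      have r: "0 < y / x" using xy by simp
      have "(y / x) powi (1 - int d) = (y / x) powr (real_of_int (1 - int d))"
        using r by (subst powr_real_of_int') auto
      then have e: "(y / x) powi (1 - int d) = (y / x) powr (1 - real d)" by simp
      have "y powi (1 - int d) = (y / x) powi (1 - int d) * x powi (1 - int d)"
        using xy by (simp add: power_int_mult_distrib[symmetric])
      then have y: "y powi (1 - int d) = (y / x) powr (1 - real d) * x powi (1 - int d)" using e by simp
      have "g y \<le> y powi (1 - int d) * (C * (y / x) powr s * f x)"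
        unfolding g_def using sC(4)[OF xy] xy by (intro mult_left_mono) auto
      also have "\<dots> = C * ((y / x) powr (1 - real d) * (y / x) powr s) * g x"
        unfolding y g_def by (simp only: mult_ac)
      also have "(y / x) powr (1 - real d) * (y / x) powr s = (y / x) powr (s - real d + 1)"
        by (simp add: powr_add[symmetric] algebra_simps)
      also have "C * (y / x) powr (s - real d + 1) * g x \<le> max C 1 * (y / x) powr (s - real d + 1) * g x"
        using gp[OF xy(1)] by (intro mult_right_mono) auto
      finally show ?thesis .
    qed
  qed (use sC in auto)
  have summand: "real (Suc q) ^ d * \<psi> (Suc q) powi (1 - int d) * f (\<psi> (Suc q) / real (Suc q)) = real (Suc q) * g (\<psi> (Suc q) / real (Suc q))" for q
  proof -
    obtain m where m: "d = Suc m" using d by (cases d) auto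
    have "(\<psi> (Suc q) / real (Suc q)) powi (1 - int d) = \<psi> (Suc q) powi (1 - int d) / real (Suc q) powi (1 - int d)"
      by (rule power_int_divide_distrib)
    also have "real (Suc q) powi (1 - int d) = 1 / real (Suc q) ^ m"
      by (simp add: m power_int_minus divide_inverse)
    finally show ?thesis by (simp add: g_def m)
  qed
  have T0: "0 \<le> real (Suc q) * g (\<psi> (Suc q) / real (Suc q))" for q
    using g_pos[of "\<psi> (Suc q) / real (Suc q)"] psi_pos[of "Suc q"] by simp
  have W: "W_set \<psi> \<inter> (cbox 0 1 \<times> cbox 0 1) = (W_set \<psi> :: ((real ^ 'n) \<times> (real ^ 'n)) set)"
    by (auto simp: W_set_def)
  have F: "hausdorff_measure (\<lambda>x. x ^ d * f x) S = hausdorff_measure (\<lambda>x. x ^ (2 * d - 1) * g x) S"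
    for S :: "((real ^ 'n) \<times> (real ^ 'n)) set"
    by (rule hausdorff_measure_cong[OF fg])
  show ?thesis
    unfolding d_def[symmetric] W F summand
  proof (intro conjI impI; (elim conjE)?)
    assume "(\<Sum>q. ennreal (real (Suc q) * g (\<psi> (Suc q) / real (Suc q)))) < \<infinity>"
    then have "summable (\<lambda>q. real (Suc q) * g (\<psi> (Suc q) / real (Suc q)))"
      by (intro summable_suminf_not_top T0) simp
    then show "hausdorff_measure (\<lambda>x. x ^ (2 * d - 1) * g x) (W_set \<psi> :: ((real ^ 'n) \<times> (real ^ 'n)) set) = 0"
      unfolding d_def by (rule hausdorff_measure_W_set_eq_0[rotated]) (rule psi_pos)
  next
    assume inf: "(\<Sum>q. ennreal (real (Suc q) * g (\<psi> (Suc q) / real (Suc q)))) = \<infinity>"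
      and mon: "mono_on {1..} \<psi> \<or> antimono_on {1..} \<psi>"
    have "\<not> summable (\<lambda>q. real (Suc q) * g (\<psi> (Suc q) / real (Suc q)))"
    proof
      assume "summable (\<lambda>q. real (Suc q) * g (\<psi> (Suc q) / real (Suc q)))"
      then have "(\<Sum>q. ennreal (real (Suc q) * g (\<psi> (Suc q) / real (Suc q)))) = ennreal (\<Sum>q. real (Suc q) * g (\<psi> (Suc q) / real (Suc q)))"
        by (intro suminf_ennreal2 T0)
      with inf show False by simp
    qed
    then show "hausdorff_measure (\<lambda>x. x ^ (2 * d - 1) * g x) (W_set \<psi> :: ((real ^ 'n) \<times> (real ^ 'n)) set) = \<infinity>"
      unfolding d_def by (rule hausdorff_measure_W_set_eq_infinity[rotated 2]) (rule mon | erule psi_pos)+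
  qed
qed

end
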